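(* Let $H=(H_{\mathbf Q},W_\bullet,F^\bullet,\overline F^\bullet)$ be a mixed Hodge structure and let $\xi_{\mathbf P^2}(H_{\mathbf C},W_{.}^{\bullet},F^\bullet,\overline F^\bullet)$ be the associated Rees bundle on $\mathbf P^2$. Then $$\mathrm{ch}\big(\xi_{\mathbf P^2}(H_{\mathbf C},W_{.}^{\bullet},F^\bullet,\overline F^\bullet)\big)=\dim_{\mathbf C}H_{\mathbf C}+\frac12\sum_{p,q}(p+q)^2\,(t^{p,q}_H-h^{p,q}_H)\,w^4,$$ and hence $$c_2\big(\xi_{\mathbf P^2}(H_{\mathbf C},W_{.}^{\bullet},F^\bullet,\overline F^\bullet)\big)=\frac12\sum_{p,q}(p+q)^2\,(h^{p,q}_H-t^{p,q}_H)\,w^4.$$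
   Context: A mixed Hodge structure $H$ is a finite-dimensional $\mathbf{Q}$-vector space $H_{\mathbf Q}$ with a finite increasing filtration $W_\bullet$ (also written $W_\bullet$ on $H_{\mathbf C}=H_{\mathbf Q}\otimes\mathbf{C}$) and a finite decreasing filtration $F^\bullet$ of $H_{\mathbf C}$ such that $F^\bullet$ induces on each $Gr^W_nH_{\mathbf C}$ a pure Hodge structure of weight $n$; $\overline F^\bullet$ is the complex conjugate filtration with respect to $H_{\mathbf R}=H_{\mathbf Q}\otimes\mathbf R$. $W_{.}^\bullet$ is the decreasing filtration $W_{.}^p=W_{-p}$ of $H_{\mathbf C}$. Put $h^{p,q}_H=\dim_{\mathbf C}Gr^q_{\overline F}Gr^p_FGr^W_{p+q}H_{\mathbf C}$ and $t^{p,q}_H=\dim_{\mathbf C}Gr^q_{\overline F}Gr^p_FH_{\mathbf C}$. Rees bundle. Let $V$ be a finite-dimensional complex vector space with decreasing filtrations indexed by $\mathbf Z$, each complete ($F^p=V$ for some $p$ and $F^q=0$ for some $q$). For two filtrations $F^\bullet,G^\bullet$ set $R^2(V,F,G)=\sum_{(p,q)\in\mathbf Z^2}u^{-p}v^{-q}(F^p\cap G^q)\subset \mathbf C[u,v,u^{-1},v^{-1}]\otimes V$, a free $\mathbf C[u,v]$-module. Given three filtrations $F_0^\bullet,F_1^\bullet,F_2^\bullet$, let $\mathbf P^2$ have homogeneous coordinates $(u_0:u_1:u_2)$ and $U_k=\{u_k\ne0\}$. For $\{i,j,k\}=\{0,1,2\}$ with $i<j$, take on $U_k=\mathrm{Spec}\,\mathbf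 C[\frac{u_i}{u_k},\frac{u_j}{u_k}]$ the vector bundle associated with $R^2(V,F_i,F_j)$, where $u=\frac{u_i}{u_k}$ is attached to $F_i$ and $v=\frac{u_j}{u_k}$ to $F_j$. These are subsheaves of the push-forward of $\mathcal O_{U_0\cap U_1\cap U_2}\otimes V$ which coincide on overlaps; they glue to the vector bundle $\xi_{\mathbf P^2}(V,F_0^\bullet,F_1^\bullet,F_2^\bullet)$. $w^4$ denotes the generator of $H^4(\mathbf P^2,\mathbf Z)\cong\mathbf Z$ given by the class of a point. *)

theory Defs
  imports
    "HOL-Analysis.Finite_Cartesian_Product"
    "HOL-Library.Numeral_Type"
    "HOL-Library.Poly_Mapping"
    "HOL-Computational_Algebra.Polynomial"
begin

section \<open>Filtrations and subquotients\<close>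

definition finite_decreasing_filtration ::
    "(complex \<Rightarrow> 'v \<Rightarrow> 'v) \<Rightarrow> (int \<Rightarrow> 'v::ab_group_add set) \<Rightarrow> bool" where
  "finite_decreasing_filtration scl F \<longleftrightarrow>
     (\<forall>p. module.subspace scl (F p)) \<and> (\<forall>p q. p \<le> q \<longrightarrow> F q \<subseteq> F p) \<and>
     (\<exists>p. F p = UNIV) \<and> (\<exists>q. F q = {0})"

definition sum_sets :: "'v::ab_group_add set \<Rightarrow> 'v set \<Rightarrow> 'v set" where
  "sum_sets A B = {a + b | a b. a \<in> A \<and> b \<in> B}"

text \<open>
  A subquotient \<open>A/B\<close> of a vector space (with \<open>B \<subseteq> A\<close>) is represented by the pair \<open>(A, B)\<close>.
  A subspace of \<open>A/B\<close> is represented by its preimage in \<open>A\<close>.  The filtration induced by \<open>F\<close>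
  has as its \<open>p\<close>-th step the image of \<open>F p \<inter> A\<close> in \<open>A/B\<close>.
\<close>

definition induced_step ::
    "(int \<Rightarrow> 'v::ab_group_add set) \<Rightarrow> 'v set \<times> 'v set \<Rightarrow> int \<Rightarrow> 'v set" where
  "induced_step F Q p = sum_sets (F p \<inter> fst Q) (snd Q)"

definition Gr ::
    "(int \<Rightarrow> 'v::ab_group_add set) \<Rightarrow> int \<Rightarrow> 'v set \<times> 'v set \<Rightarrow> 'v set \<times> 'v set" where
  "Gr F p Q = (induced_step F Q p, induced_step F Q (p + 1))"

definition subquotient_dim ::
    "(complex \<Rightarrow> 'v \<Rightarrow> 'v) \<Rightarrow> 'v::ab_group_add set \<times> 'v set \<Rightarrow> nat" where
  "subquotient_dim scl Q = vector_space.dim scl (fst Q) - vector_space.dim scl (snd Q)"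


section \<open>Mixed Hodge structures\<close>

definition rat_scale :: "(complex \<Rightarrow> 'v \<Rightarrow> 'v) \<Rightarrow> rat \<Rightarrow> 'v \<Rightarrow> 'v" where
  "rat_scale scl r = scl (of_rat r)"

text \<open>
  \<open>HQ\<close> is a finite-dimensional rational subspace for which the canonical map from
  \<open>HQ \<otimes> \<complex>\<close> to the complex space is an isomorphism: some (equivalently, every) rational
  basis of \<open>HQ\<close> is a complex basis of the whole space.
\<close>

definition rational_form ::
    "(complex \<Rightarrow> 'v \<Rightarrow> 'v) \<Rightarrow> 'v::ab_group_add set \<Rightarrow> bool" where
  "rational_form scl HQ \<longleftrightarrow>
     (\<exists>B. finite B \<and> \<not> module.dependent scl B \<and> module.span scl B = UNIV \<and>
          HQ = module.span (rat_scale scl) B)"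

text \<open>Complex conjugation: the unique antilinear map that fixes \<open>HQ\<close> (hence \<open>HQ \<otimes> \<real>\<close>).\<close>

definition conjugation ::
    "(complex \<Rightarrow> 'v \<Rightarrow> 'v) \<Rightarrow> 'v::ab_group_add set \<Rightarrow> 'v \<Rightarrow> 'v" where
  "conjugation scl HQ = (THE \<kappa>. (\<forall>x y. \<kappa> (x + y) = \<kappa> x + \<kappa> y) \<and>
     (\<forall>z x. \<kappa> (scl z x) = scl (cnj z) (\<kappa> x)) \<and> (\<forall>x\<in>HQ. \<kappa> x = x))"

definition conj_filtration ::
    "(complex \<Rightarrow> 'v \<Rightarrow> 'v) \<Rightarrow> 'v::ab_group_add set \<Rightarrow> (int \<Rightarrow> 'v set) \<Rightarrow> int \<Rightarrow> 'v set" where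
  "conj_filtration scl HQ F p = conjugation scl HQ ` F p"

definition weight_dec ::
    "(complex \<Rightarrow> 'v \<Rightarrow> 'v) \<Rightarrow> (int \<Rightarrow> 'v::ab_group_add set) \<Rightarrow> int \<Rightarrow> 'v set" where
  "weight_dec scl W p = module.span scl (W (- p))"

definition Gr_weight ::
    "(complex \<Rightarrow> 'v \<Rightarrow> 'v) \<Rightarrow> (int \<Rightarrow> 'v::ab_group_add set) \<Rightarrow> int \<Rightarrow> 'v set \<times> 'v set" where
  "Gr_weight scl W n = (module.span scl (W n), module.span scl (W (n - 1)))"

text \<open>
  The filtrations induced by \<open>F\<close> and by its conjugate \<open>F'\<close> on the subquotient \<open>A/B\<close> form a
  pure Hodge structure of weight \<open>n\<close>: \<open>A/B\<close> is the direct sum of \<open>F\<^sup>p\<close> and \<open>F'\<^sup>q\<close> whenever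
  \<open>p + q = n + 1\<close>.
\<close>

definition pure_on ::
    "(int \<Rightarrow> 'v::ab_group_add set) \<Rightarrow> (int \<Rightarrow> 'v set) \<Rightarrow> int \<Rightarrow> 'v set \<times> 'v set \<Rightarrow> bool" where
  "pure_on F F' n Q \<longleftrightarrow>
     (\<forall>p q. p + q = n + 1 \<longrightarrow>
        sum_sets (induced_step F Q p) (induced_step F' Q q) = fst Q \<and>
        induced_step F Q p \<inter> induced_step F' Q q = snd Q)"

locale mixed_hodge_structure = vector_space scl
  for scl :: "complex \<Rightarrow> 'v::ab_group_add \<Rightarrow> 'v" +
  fixes HQ :: "'v set"
    and W :: "int \<Rightarrow> 'v set"
    and F :: "int \<Rightarrow> 'v set"
  assumes rational_form: "rational_form scl HQ"
    and W_subspace: "\<And>n. module.subspace (rat_scale scl) (W n)"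
    and W_subset: "\<And>n. W n \<subseteq> HQ"
    and W_mono: "\<And>m n. m \<le> n \<Longrightarrow> W m \<subseteq> W n"
    and W_separated: "\<exists>m. W m = {0}"
    and W_exhaustive: "\<exists>n. W n = HQ"
    and F_filtration: "finite_decreasing_filtration scl F"
    and pure: "\<And>n. pure_on F (conj_filtration scl HQ F) n (Gr_weight scl W n)"

definition hodge_h ::
    "(complex \<Rightarrow> 'v \<Rightarrow> 'v) \<Rightarrow> 'v::ab_group_add set \<Rightarrow> (int \<Rightarrow> 'v set) \<Rightarrow> (int \<Rightarrow> 'v set) \<Rightarrow>
     int \<Rightarrow> int \<Rightarrow> nat" where
  "hodge_h scl HQ W F p q = subquotient_dim scl
     (Gr (conj_filtration scl HQ F) q (Gr F p (Gr_weight scl W (p + q))))"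

definition hodge_t ::
    "(complex \<Rightarrow> 'v \<Rightarrow> 'v) \<Rightarrow> 'v::ab_group_add set \<Rightarrow> (int \<Rightarrow> 'v set) \<Rightarrow>
     int \<Rightarrow> int \<Rightarrow> nat" where
  "hodge_t scl HQ F p q = subquotient_dim scl
     (Gr (conj_filtration scl HQ F) q (Gr F p (UNIV, {0})))"


section \<open>Vector bundles on the projective plane\<close>

text \<open>
  \<open>laurent\<close> is the ring of Laurent polynomials in the homogeneous coordinates
  \<open>u\<^sub>0, u\<^sub>1, u\<^sub>2\<close>; the exponent vector \<open>a\<close> stands for the product of the \<open>u\<^sub>i\<close> to the power \<open>a $ i\<close>.
  For a complex vector space \<open>'w\<close>, the type \<open>'w sections\<close> is the module of Laurent polynomials
  with coefficients in \<open>'w\<close>.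
\<close>

type_synonym laurent = "(int ^ 3) \<Rightarrow>\<^sub>0 complex"
type_synonym 'w sections = "(int ^ 3) \<Rightarrow>\<^sub>0 'w"

definition total_degree :: "int ^ 3 \<Rightarrow> int" where
  "total_degree a = (\<Sum>i\<in>UNIV. a $ i)"

definition smul ::
    "(complex \<Rightarrow> 'w \<Rightarrow> 'w) \<Rightarrow> laurent \<Rightarrow> 'w::ab_group_add sections \<Rightarrow> 'w sections" where
  "smul scl f x = (\<Sum>a\<in>Poly_Mapping.keys f. \<Sum>b\<in>Poly_Mapping.keys x.
     Poly_Mapping.single (a + b) (scl (Poly_Mapping.lookup f a) (Poly_Mapping.lookup x b)))"

text \<open>
  For nonempty \<open>I\<close>, the coordinate ring of the intersection of the charts \<open>U\<^sub>k = {u\<^sub>k \<noteq> 0}\<close>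
  with \<open>k \<in> I\<close>.  In particular \<open>chart_ring {k}\<close> is the polynomial ring in the two quotients
  \<open>u\<^sub>i/u\<^sub>k\<close>, and \<open>chart_ring UNIV\<close> is the coordinate ring of the torus.
\<close>

definition chart_ring :: "3 set \<Rightarrow> laurent set" where
  "chart_ring I = {f. \<forall>a\<in>Poly_Mapping.keys f. total_degree a = 0 \<and> (\<forall>i. i \<notin> I \<longrightarrow> 0 \<le> a $ i)}"

definition chart_submodule ::
    "(complex \<Rightarrow> 'w \<Rightarrow> 'w) \<Rightarrow> 3 set \<Rightarrow> 'w::ab_group_add sections set \<Rightarrow> bool" where
  "chart_submodule scl I M \<longleftrightarrow>
     0 \<in> M \<and> (\<forall>x\<in>M. \<forall>y\<in>M. x + y \<in> M) \<and> (\<forall>f\<in>chart_ring I. \<forall>x\<in>M. smul scl f x \<in> M)"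

definition chart_span ::
    "(complex \<Rightarrow> 'w \<Rightarrow> 'w) \<Rightarrow> 3 set \<Rightarrow> 'w::ab_group_add sections set \<Rightarrow> 'w sections set" where
  "chart_span scl I X = {y. \<exists>(n::nat) f x.
     (\<forall>i<n. f i \<in> chart_ring I \<and> x i \<in> X) \<and> y = (\<Sum>i<n. smul scl (f i) (x i))}"

text \<open>
  Local freeness on the affine chart \<open>U\<^sub>k\<close>: there are finitely many functions that generate the
  unit ideal, such that the localisation of \<open>M\<close> at each of them is free of rank \<open>r\<close>.  As \<open>M\<close> is
  torsion-free, a basis of the localisation at \<open>f\<close> can be chosen in \<open>M\<close>.
\<close>

definition locally_free ::
    "(complex \<Rightarrow> 'w \<Rightarrow> 'w) \<Rightarrow> nat \<Rightarrow> 3 \<Rightarrow> 'w::ab_group_add sections set \<Rightarrow> bool" where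
  "locally_free scl r k M \<longleftrightarrow>
     (\<exists>D. finite D \<and> D \<subseteq> chart_ring {k} \<and>
        (\<exists>g. (\<forall>f\<in>D. g f \<in> chart_ring {k}) \<and> (\<Sum>f\<in>D. g f * f) = 1) \<and>
        (\<forall>f\<in>D. \<exists>b :: nat \<Rightarrow> 'w sections.
           (\<forall>i<r. b i \<in> M) \<and>
           (\<forall>g. (\<forall>i<r. g i \<in> chart_ring {k}) \<and> (\<Sum>i<r. smul scl (g i) (b i)) = 0
                \<longrightarrow> (\<forall>i<r. g i = 0)) \<and>
           (\<forall>x\<in>M. \<exists>N g. (\<forall>i<r. g i \<in> chart_ring {k}) \<and>
                smul scl (f ^ N) x = (\<Sum>i<r. smul scl (g i) (b i)))))"

text \<open>
  A vector bundle is given by its modules \<open>E k\<close> of sections over the three charts, all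
  of them embedded in the module of sections over the torus, such that \<open>E i\<close> and \<open>E j\<close> have the
  same localisation on the overlap of \<open>U\<^sub>i\<close> and \<open>U\<^sub>j\<close>.  Because a vector bundle is torsion-free,
  and because a finitely generated projective module over the coordinate ring of the torus is
  contained in a free one, every algebraic vector bundle on the plane is of this form
  (already with \<open>'w\<close> = \<open>nat \<Rightarrow>\<^sub>0 complex\<close>).
\<close>

type_synonym 'w chart_modules = "3 \<Rightarrow> 'w sections set"

definition vector_bundle ::
    "(complex \<Rightarrow> 'w \<Rightarrow> 'w) \<Rightarrow> nat \<Rightarrow> 'w::ab_group_add chart_modules \<Rightarrow> bool" where
  "vector_bundle scl r E \<longleftrightarrow>
     (\<forall>k. chart_submodule scl {k} (E k) \<and> locally_free scl r k (E k)) \<and>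
     (\<forall>i j. chart_span scl {i, j} (E i) = chart_span scl {i, j} (E j))"

definition bundle_rank ::
    "(complex \<Rightarrow> 'w \<Rightarrow> 'w) \<Rightarrow> 'w::ab_group_add chart_modules \<Rightarrow> nat" where
  "bundle_rank scl E = (THE r. vector_bundle scl r E)"

text \<open>
  A morphism is a linear map between the modules of sections over the torus that maps sections
  over each chart to sections over that chart.
\<close>

definition torus_sections ::
    "(complex \<Rightarrow> 'w \<Rightarrow> 'w) \<Rightarrow> 'w::ab_group_add chart_modules \<Rightarrow> 'w sections set" where
  "torus_sections scl E = chart_span scl UNIV (E 0)"

definition bundle_hom ::
    "(complex \<Rightarrow> 'w \<Rightarrow> 'w) \<Rightarrow> (complex \<Rightarrow> 'x \<Rightarrow> 'x) \<Rightarrow>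
     'w::ab_group_add chart_modules \<Rightarrow> 'x::ab_group_add chart_modules \<Rightarrow>
     ('w sections \<Rightarrow> 'x sections) \<Rightarrow> bool" where
  "bundle_hom scl scl' E E' \<phi> \<longleftrightarrow>
     (\<forall>x\<in>torus_sections scl E. \<forall>y\<in>torus_sections scl E. \<phi> (x + y) = \<phi> x + \<phi> y) \<and>
     (\<forall>f\<in>chart_ring UNIV. \<forall>x\<in>torus_sections scl E. \<phi> (smul scl f x) = smul scl' f (\<phi> x)) \<and>
     (\<forall>k. \<phi> ` E k \<subseteq> E' k)"

definition bundle_isomorphic ::
    "(complex \<Rightarrow> 'w \<Rightarrow> 'w) \<Rightarrow> (complex \<Rightarrow> 'x \<Rightarrow> 'x) \<Rightarrow>
     'w::ab_group_add chart_modules \<Rightarrow> 'x::ab_group_add chart_modules \<Rightarrow> bool" where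
  "bundle_isomorphic scl scl' E E' \<longleftrightarrow>
     (\<exists>\<phi>. bundle_hom scl scl' E E' \<phi> \<and> (\<forall>k. bij_betw \<phi> (E k) (E' k)))"

text \<open>Exactness of \<open>0 \<rightarrow> E' \<rightarrow> E \<rightarrow> E'' \<rightarrow> 0\<close> is tested on sections over the affine charts.\<close>

definition short_exact ::
    "(complex \<Rightarrow> 'w \<Rightarrow> 'w) \<Rightarrow> 'w::ab_group_add chart_modules \<Rightarrow> 'w chart_modules \<Rightarrow>
     'w chart_modules \<Rightarrow> bool" where
  "short_exact scl E' E E'' \<longleftrightarrow>
     (\<exists>\<phi> \<psi>. bundle_hom scl scl E' E \<phi> \<and> bundle_hom scl scl E E'' \<psi> \<and>
        (\<forall>k. inj_on \<phi> (E' k) \<and> \<phi> ` E' k = {x \<in> E k. \<psi> x = 0} \<and> \<psi> ` E k = E'' k))"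


section \<open>The Rees bundle\<close>

text \<open>
  On \<open>U\<^sub>k\<close> with \<open>{i,j,k} = {0,1,2}\<close> the monomial with exponent vector \<open>a\<close> of degree \<open>0\<close> equals
  \<open>(u\<^sub>i/u\<^sub>k)\<close> to the power \<open>a $ i\<close> times \<open>(u\<^sub>j/u\<^sub>k)\<close> to the power \<open>a $ j\<close>; its coefficient has
  to lie in the intersection of \<open>F\<^sub>i\<^sup>p\<close> and \<open>F\<^sub>j\<^sup>q\<close> with \<open>p = - a $ i\<close> and \<open>q = - a $ j\<close>.
\<close>

definition rees_bundle ::
    "(3 \<Rightarrow> int \<Rightarrow> 'v set) \<Rightarrow> 'v::ab_group_add chart_modules" where
  "rees_bundle Fs k = {x. \<forall>a\<in>Poly_Mapping.keys x. total_degree a = 0 \<and>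
     (\<forall>i. i \<noteq> k \<longrightarrow> Poly_Mapping.lookup x a \<in> Fs i (- (a $ i)))}"

definition hodge_rees_bundle ::
    "(complex \<Rightarrow> 'v \<Rightarrow> 'v) \<Rightarrow> 'v::ab_group_add set \<Rightarrow> (int \<Rightarrow> 'v set) \<Rightarrow> (int \<Rightarrow> 'v set) \<Rightarrow>
     'v chart_modules" where
  "hodge_rees_bundle scl HQ W F = rees_bundle
     (\<lambda>i. if i = 0 then weight_dec scl W
          else if i = 1 then F
          else conj_filtration scl HQ F)"


section \<open>Chern classes and Chern character\<close>

text \<open>
  The even cohomology ring of the plane with integral (rational) coefficients is the ring of
  polynomials in the hyperplane class truncated at degree \<open>3\<close>; its elements are represented by
  polynomials of degree at most \<open>2\<close>, and the coefficient of \<open>X\<^sup>i\<close> is the component in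
  \<open>H\<^sup>2\<^sup>i\<close>.  The square of the hyperplane class is the class of a point.
\<close>

definition w4 :: "rat poly" where
  "w4 = monom 1 2"

text \<open>A vector space of countable dimension, large enough to host all vector bundles.\<close>

type_synonym std = "nat \<Rightarrow>\<^sub>0 complex"

definition std_scale :: "complex \<Rightarrow> std \<Rightarrow> std" where
  "std_scale z v = Poly_Mapping.map (\<lambda>c. z * c) v"

text \<open>
  The line bundle \<open>O(d)\<close>: its sections over \<open>U\<^sub>k\<close> are the Laurent polynomials of total degree \<open>d\<close>
  in which only \<open>u\<^sub>k\<close> may occur with a negative exponent, placed in the \<open>0\<close>-th coordinate.
\<close>

definition line_bundle :: "int \<Rightarrow> std chart_modules" where
  "line_bundle d k = {x. \<forall>a\<in>Poly_Mapping.keys x.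
     total_degree a = d \<and> (\<forall>i. i \<noteq> k \<longrightarrow> 0 \<le> a $ i) \<and>
     Poly_Mapping.keys (Poly_Mapping.lookup x a) \<subseteq> {0}}"

text \<open>
  Grothendieck's axioms for the total Chern class on the plane: normalisation on
  line bundles and the Whitney formula.  They determine \<open>c\<close> on all vector bundles, because
  every vector bundle on the plane has a finite resolution by direct sums of line bundles
  \<open>O(d)\<close>.  Invariance under isomorphism is the Whitney formula for the zero bundle.
\<close>

definition total_chern_class :: "(std chart_modules \<Rightarrow> int poly) \<Rightarrow> bool" where
  "total_chern_class c \<longleftrightarrow>
     (\<forall>E r. vector_bundle std_scale r E \<longrightarrow> degree (c E) \<le> 2 \<and> coeff (c E) 0 = 1) \<and>
     (\<forall>d. c (line_bundle d) = [:1, d:]) \<and>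
     (\<forall>E' E E'' r' r r''. vector_bundle std_scale r' E' \<and> vector_bundle std_scale r E \<and>
        vector_bundle std_scale r'' E'' \<and> short_exact std_scale E' E E'' \<longrightarrow>
        c E = poly_cutoff 3 (c E' * c E''))"

text \<open>
  A bundle with coefficients in an arbitrary space is replaced by an isomorphic bundle with
  coefficients in \<open>std\<close>; the choice does not matter by invariance under isomorphism.
\<close>

definition std_model ::
    "(complex \<Rightarrow> 'w \<Rightarrow> 'w) \<Rightarrow> 'w::ab_group_add chart_modules \<Rightarrow> std chart_modules" where
  "std_model scl E =
     (SOME E'. (\<exists>r. vector_bundle std_scale r E') \<and> bundle_isomorphic scl std_scale E E')"

definition chern_class ::
    "(std chart_modules \<Rightarrow> int poly) \<Rightarrow> (complex \<Rightarrow> 'w \<Rightarrow> 'w) \<Rightarrow> nat \<Rightarrow>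
     'w::ab_group_add chart_modules \<Rightarrow> rat poly" where
  "chern_class c scl i E = monom (of_int (coeff (c (std_model scl E)) i)) i"

text \<open>
  Expressed through the Chern roots, the components of degree \<open>2\<close> and \<open>4\<close> of the Chern
  character are their first power sum and half of their second power sum; the components of
  degree above \<open>4\<close> vanish on the plane.
\<close>

definition chern_character ::
    "(std chart_modules \<Rightarrow> int poly) \<Rightarrow> (complex \<Rightarrow> 'w \<Rightarrow> 'w) \<Rightarrow>
     'w::ab_group_add chart_modules \<Rightarrow> rat poly" where
  "chern_character c scl E = of_nat (bundle_rank scl E) + chern_class c scl 1 E +
     smult (1/2) ((chern_class c scl 1 E)\<^sup>2 - 2 * chern_class c scl 2 E)"

end

(* By Klyachko's description of toric bundles, the Rees bundle depends only on V with its three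
   filtrations, and a sequence of trifiltered spaces that is exact on all intersections
   F_i^p \<inter> F_j^q with i \<noteq> j induces a short exact sequence of bundles.  The power sums of the Chern
   roots and the linear combinations power_sum1 and power_sum2 of the dimensions of these
   intersections are both additive on such sequences, and they agree on lines, where the Rees bundle
   is some O(d).  Lines suffice: if F_0^m is the last nonzero step of F_0, shrinking it to a
   hyperplane changes the bundle by an elementary modification along the coordinate line u_0 = 0,
   and the fibre product of the bundle with a line bundle over the common quotient O(d) of the
   coordinate line sits in two exact sequences of trifiltered spaces.  This reduces to a filtration
   F_0 with a single jump, when a basis adapted to F_1 and F_2 splits the bundle.
   For a mixed Hodge structure the purity of the weight quotients expresses the terms that
   involve W through the numbers h^{p,q}, and the formula becomes the one claimed. *)

theory Submission
  imports Defs "HOL-Analysis.Cartesian_Space"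
begin

section \<open>Linear algebra\<close>

text \<open>Three filtrations need not admit a common adapted basis, so the Rees bundle need not
  split globally; what always splits is its restriction to a chart, where only two filtrations are
  visible. Hence pairwise intersections suffice, both for exactness and for the invariants: for a
  line with jumps a_0, a_1, a_2 every term in the expansion of (a_0 + a_1 + a_2)^2 involves at most
  two filtrations. Power sums replace c_1 and c_2 because c_2 is not additive. The fibre product is
  forced by the axioms for Chern classes: the quotient of an elementary modification is a sheaf on a
  coordinate line, outside the scope of a Whitney formula for bundles, whereas both sequences
  through the fibre product consist of bundles. The fibre product needs one dimension more than V.
  The infinite-dimensional space \<open>std\<close> offers it, so the argument takes place there and
  the Hodge structure is carried over by a linear embedding. Purity says nothing about the relative
  position of F and its conjugate on the whole space; that pair is what t counts, while the pairs
  with W are counted by h.\<close>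

lemma int_threshold:
  fixes P :: "int \<Rightarrow> bool"
  assumes anti: "\<And>p q. p \<le> q \<Longrightarrow> P q \<Longrightarrow> P p" and "P a" and "\<not> P b"
  obtains m where "a \<le> m" "m < b" "\<And>p. P p \<longleftrightarrow> p \<le> m"
proof -
  have ab: "a < b" using assms by (meson not_le)
  define S where "S = {p \<in> {a..<b}. P p}"
  have "finite S" by (rule finite_subset[of _ "{a..<b}"]) (auto simp: S_def)
  moreover have "a \<in> S" using ab assms by (auto simp: S_def)
  ultimately have S: "finite S" "a \<in> S" .
  have M: "Max S \<in> S" using Max_in[of S] S by blast
  have le: "p \<le> Max S" if "P p" for p
  proof (cases "p < a")
    case True then show ?thesis using Max_ge[OF S] by linarith
  next
    case False
    have "p < b" using anti[OF _ that, of b] assms(3) by (cases "p < b") auto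
    then have "p \<in> S" using that False by (simp add: S_def)
    then show ?thesis using S(1) by simp
  qed
  show ?thesis
  proof (rule that)
    show "a \<le> Max S" "Max S < b" using M by (simp_all add: S_def)
    show "P p \<longleftrightarrow> p \<le> Max S" for p
      using le anti[of p "Max S"] M by (auto simp: S_def)
  qed
qed

section \<open>Subspaces of finite dimension in a space of arbitrary dimension\<close>

locale complex_space = vector_space scl
  for scl :: "complex \<Rightarrow> 'v::ab_group_add \<Rightarrow> 'v"
begin

text \<open>Finiteness is a property of subsets and not of the whole space, because
  \<open>std\<close>, in which the Chern classes live, has infinite dimension.\<close>

definition fin_dim :: "'v set \<Rightarrow> bool" where
  "fin_dim V \<longleftrightarrow> (\<exists>S. finite S \<and> V \<subseteq> span S)"

lemma subspace_basis:
  assumes "subspace A"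
  obtains B where "B \<subseteq> A" "independent B" "span B = A"
proof -
  obtain B where B: "B \<subseteq> A" "independent B" "A \<subseteq> span B"
    using maximal_independent_subset .
  then show ?thesis using that span_subspace[OF B(1,3) assms] by blast
qed

lemma fin_dim_subset: "fin_dim V \<Longrightarrow> A \<subseteq> V \<Longrightarrow> fin_dim A"
  by (auto simp: fin_dim_def)

lemma fin_dim_span: "finite S \<Longrightarrow> fin_dim (span S)"
  by (auto simp: fin_dim_def)

lemma fin_dim_independent: "fin_dim V \<Longrightarrow> independent B \<Longrightarrow> B \<subseteq> V \<Longrightarrow> finite B"
  unfolding fin_dim_def using independent_span_bound by blast

lemma fin_dim_basis_extend:
  assumes "fin_dim V" "subspace V" "independent C" "C \<subseteq> V"
  obtains B where "C \<subseteq> B" "finite B" "independent B" "span B = V"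
proof -
  obtain B where B: "C \<subseteq> B" "B \<subseteq> V" "independent B" "V \<subseteq> span B"
    using maximal_independent_subset_extend[OF assms(4,3)] .
  have "span B = V" by (rule span_subspace[OF B(2,4) assms(2)])
  then show ?thesis using that[OF B(1) _ B(3)] fin_dim_independent[OF assms(1) B(3,2)] by blast
qed

lemma fin_dim_basis:
  assumes "fin_dim V" "subspace V"
  obtains B where "finite B" "independent B" "span B = V" "card B = dim V"
proof -
  obtain B where "finite B" "independent B" "span B = V"
    by (rule fin_dim_basis_extend[OF assms independent_empty]) auto
  then show ?thesis using that dim_span_eq_card_independent by metis
qed

lemma dim_mono_fin_dim:
  assumes "fin_dim V" "subspace V" "subspace A" "A \<subseteq> V"
  shows "dim A \<le> dim V"
proof -
  obtain B where B: "finite B" "span B = V" "card B = dim V"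
    by (rule fin_dim_basis[OF assms(1,2)])
  then show ?thesis using dim_le_card[of A B] assms by simp
qed

lemma dim_less_fin_dim:
  assumes "fin_dim V" "subspace V" "subspace A" "A \<subset> V"
  shows "dim A < dim V"
proof -
  obtain B where B: "finite B" "independent B" "span B = A" "card B = dim A"
    using assms(4) by (blast intro: fin_dim_basis[OF fin_dim_subset[OF assms(1)] assms(3)])
  have "B \<subseteq> V" using span_superset[of B] B(3) assms(4) by auto
  then obtain D where D: "B \<subseteq> D" "finite D" "independent D" "span D = V"
    by (rule fin_dim_basis_extend[OF assms(1,2) B(2)])
  then have "B \<subset> D" using B assms by auto
  then have "card B < card D" using D(2) psubset_card_mono by blast
  then show ?thesis using B(4) D(3,4) dim_span_eq_card_independent[OF D(3)] by simp
qed

lemma dim_zero_subspace [simp]: "dim {0} = 0"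
  using dim_span_eq_card_independent[OF independent_empty] by simp

lemma dim_singleton: "v \<noteq> 0 \<Longrightarrow> dim {v} = 1"
  using dim_eq_card_independent[of "{v}"] by simp

text \<open>The functional is the coordinate along \<open>x\<close> in a basis that extends
  \<open>x\<close> together with a basis of \<open>A\<close>.\<close>

lemma separating_functional:
  assumes "subspace A" "x \<notin> A"
  obtains l where "Vector_Spaces.linear scl (*) l" "l x = 1" "\<And>a. a \<in> A \<Longrightarrow> l a = 0"
proof -
  obtain B where B: "B \<subseteq> A" "independent B" "span B = A"
    using subspace_basis[OF assms(1)] .
  have iB: "independent (insert x B)" and xB: "x \<notin> B"
    using B assms by (auto simp: independent_insert)
  define E where "E = extend_basis (insert x B)"
  have E: "independent E" "span E = UNIV" "insert x B \<subseteq> E"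
    using independent_extend_basis[OF iB] span_extend_basis[OF iB] extend_basis_superset[OF iB]
    unfolding E_def by simp_all
  show ?thesis
  proof
    show "Vector_Spaces.linear scl (*) (\<lambda>v. representation E v x)"
      using linear_representation E by blast
    show "representation E x x = 1" using E by (simp add: representation_basis)
    show "representation E a x = 0" if "a \<in> A" for a
      using representation_extend[OF E(1), of a B] E B that xB representation_ne_zero[of B a x]
      by auto
  qed
qed

text \<open>A substitute for the quotient map V -> V/A that stays inside the space: kill a basis of
  \<open>A\<close> and fix a complementary part of a basis of \<open>V\<close>.\<close>

lemma kernel_exists:
  assumes "subspace A" "subspace V" "A \<subseteq> V"
  obtains g where "Vector_Spaces.linear scl scl g" "\<And>x. x \<in> V \<Longrightarrow> g x = 0 \<longleftrightarrow> x \<in> A"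
proof -
  interpret vector_space_pair scl scl ..
  obtain B where B: "B \<subseteq> A" "independent B" "span B = A"
    using subspace_basis[OF assms(1)] .
  obtain C where C: "B \<subseteq> C" "C \<subseteq> V" "independent C" "V \<subseteq> span C"
    using maximal_independent_subset_extend[OF order_trans[OF B(1) assms(3)] B(2)] .
  obtain g where g: "Vector_Spaces.linear scl scl g" "\<forall>x\<in>C. g x = (if x \<in> B then 0 else x)"
    using linear_independent_extend[OF C(3), of "\<lambda>x. if x \<in> B then 0 else x"] by blast
  interpret g: Vector_Spaces.linear scl scl g by (rule g(1))
  have D: "independent (C - B)" using C independent_mono by blast
  have inj: "inj_on g (span (C - B))"
  proof (rule g.inj_on_span_independent_image)
    have "g ` (C - B) = (\<lambda>x. x) ` (C - B)" using g(2) by (intro image_cong) auto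
    then show "independent (g ` (C - B))" using D by simp
    show "inj_on g (C - B)" using g(2) by (auto simp: inj_on_def)
  qed
  show ?thesis
  proof
    fix x assume x: "x \<in> V"
    have "C = (C - B) \<union> B" using C by auto
    then obtain y z where yz: "x = y + z" "y \<in> span (C - B)" "z \<in> span B"
      using C(4) x span_Un[of "C - B" B] by auto
    have z: "g z = 0" by (rule g.eq_0_on_span[OF _ yz(3)]) (use g(2) C in auto)
    have "g x = 0 \<longleftrightarrow> y = 0"
      using inj yz z g.inj_on_iff_eq_0[OF subspace_span, of "C - B"] by (auto simp: g.add)
    also have "\<dots> \<longleftrightarrow> x \<in> A"
    proof
      assume "x \<in> A"
      then have "y \<in> span B" using yz B by (metis add_diff_cancel_right' span_diff)
      moreover have "span B \<inter> span (C - B) = {0}"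
      proof -
        have "u = 0" if "u \<in> span B" "u \<in> span (C - B)" for u
        proof -
          have "g u = 0" by (rule g.eq_0_on_span[OF _ that(1)]) (use g(2) C in auto)
          then show ?thesis using inj that g.inj_on_iff_eq_0[OF subspace_span, of "C - B"] by auto
        qed
        then show ?thesis by (auto simp: span_zero)
      qed
      ultimately show "y = 0" using yz by auto
    qed (use yz B in auto)
    finally show "g x = 0 \<longleftrightarrow> x \<in> A" .
  qed (rule g(1))
qed

end

locale complex_space_pair = vs1: complex_space s1 + vs2: complex_space s2
  for s1 :: "complex \<Rightarrow> 'v::ab_group_add \<Rightarrow> 'v"
    and s2 :: "complex \<Rightarrow> 'w::ab_group_add \<Rightarrow> 'w"

sublocale complex_space_pair \<subseteq> vector_space_pair s1 s2 ..

lemma (in complex_space_pair) rank_nullity_on: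
  assumes lin: "Vector_Spaces.linear s1 s2 g" and S: "vs1.fin_dim S" "vs1.subspace S"
  shows "vs1.dim S = vs1.dim {x \<in> S. g x = 0} + vs2.dim (g ` S)"
proof -
  interpret g: Vector_Spaces.linear s1 s2 g by (rule lin)
  let ?N = "{x \<in> S. g x = 0}"
  have N: "vs1.subspace ?N"
    using S g.subspace_kernel vs1.subspace_inter[of S "{x. g x = 0}"] by (simp add: Int_def)
  obtain B where B: "finite B" "vs1.independent B" "vs1.span B = ?N" "card B = vs1.dim ?N"
    by (rule vs1.fin_dim_basis[OF vs1.fin_dim_subset[OF S(1)] N]) auto
  have "B \<subseteq> S" using B vs1.span_superset[of B] by auto
  then obtain D where D: "B \<subseteq> D" "finite D" "vs1.independent D" "vs1.span D = S"
    by (rule vs1.fin_dim_basis_extend[OF S B(2)])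
  have iD: "vs1.independent (D - B)" using D vs1.independent_mono by blast
  have Int0: "x = 0" if x: "x \<in> vs1.span (D - B)" "x \<in> vs1.span B" for x
  proof -
    have "vs1.representation (D - B) x b = 0" for b
      using vs1.representation_extend[OF D(3) x(1)] vs1.representation_extend[OF D(3) x(2) D(1)]
        vs1.representation_ne_zero[of "D - B" x b] vs1.representation_ne_zero[of B x b] by auto
    then show ?thesis
      using vs1.sum_nonzero_representation_eq[OF iD x(1)] by simp
  qed
  have inj: "inj_on g (vs1.span (D - B))"
    unfolding g.inj_on_iff_eq_0[OF vs1.subspace_span]
  proof (intro ballI impI)
    fix x assume x: "x \<in> vs1.span (D - B)" "g x = 0"
    then have "x \<in> vs1.span B" using B D vs1.span_mono[of "D - B" D] by auto
    then show "x = 0" using Int0 x by blast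
  qed
  have "g ` S = vs2.span (g ` (D - B))"
  proof -
    have "g ` S = vs2.span (g ` D)" using D g.span_image by simp
    also have "\<dots> = vs2.span (g ` (D - B))"
    proof (rule antisym)
      have "g b \<in> vs2.span (g ` (D - B))" if "b \<in> D" for b
        using that B vs1.span_base[of b B] by (cases "b \<in> B") (auto simp: vs2.span_base vs2.span_zero)
      then show "vs2.span (g ` D) \<subseteq> vs2.span (g ` (D - B))"
        by (intro vs2.span_minimal) auto
    qed (auto intro!: vs2.span_mono)
    finally show ?thesis .
  qed
  moreover have "vs2.independent (g ` (D - B))"
    using g.independent_injective_image[OF iD inj] .
  ultimately have "vs2.dim (g ` S) = card (g ` (D - B))"
    using vs2.dim_span_eq_card_independent by simp
  also have "\<dots> = card (D - B)"
    using inj by (meson card_image inj_on_subset vs1.span_superset)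
  finally show ?thesis
    using B D vs1.dim_span_eq_card_independent[OF D(3)] card_mono[OF D(2,1)]
    by (simp add: card_Diff_subset)
qed

context complex_space
begin

lemma subspace_sum_sets: "subspace A \<Longrightarrow> subspace B \<Longrightarrow> subspace (sum_sets A B)"
  unfolding sum_sets_def by (rule subspace_sums)

text \<open>A map whose kernel on A + B is \<open>B\<close> has the same image on A + B as on
  \<open>A\<close>; comparing rank and nullity on both gives the formula.\<close>

lemma dim_sum_sets:
  assumes "fin_dim A" "fin_dim B" "subspace A" "subspace B"
  shows "dim (sum_sets A B) + dim (A \<inter> B) = dim A + dim B"
proof -
  interpret complex_space_pair scl scl ..
  have sub: "subspace (sum_sets A B)" using assms subspace_sum_sets by blast
  have AS: "A \<subseteq> sum_sets A B"
    using subspace_0[OF assms(4)] by (force simp: sum_sets_def)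
  have BS: "B \<subseteq> sum_sets A B"
    using subspace_0[OF assms(3)] by (force simp: sum_sets_def)
  obtain SA SB where "finite SA" "finite SB" "A \<subseteq> span SA" "B \<subseteq> span SB"
    using assms unfolding fin_dim_def by auto
  then have fd: "fin_dim (sum_sets A B)"
    unfolding fin_dim_def sum_sets_def
    by (intro exI[of _ "SA \<union> SB"]) (auto simp: span_Un)
  obtain g where g: "Vector_Spaces.linear scl scl g"
    and ker: "\<And>x. x \<in> sum_sets A B \<Longrightarrow> g x = 0 \<longleftrightarrow> x \<in> B"
    by (rule kernel_exists[OF assms(4) sub BS]) blast
  interpret g: Vector_Spaces.linear scl scl g by (rule g)
  have gB: "g b = 0" if "b \<in> B" for b using ker BS that by auto
  have "g ` sum_sets A B = g ` A"
  proof
    show "g ` sum_sets A B \<subseteq> g ` A" by (auto simp: sum_sets_def g.add gB)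
  qed (use AS in auto)
  moreover have "{x \<in> sum_sets A B. g x = 0} = B" "{x \<in> A. g x = 0} = A \<inter> B"
    using ker AS BS by auto
  ultimately show ?thesis
    using rank_nullity_on[OF g fd sub] rank_nullity_on[OF g assms(1,3)] by simp
qed

text \<open>One symmetric bound \<open>K\<close> serves all filtrations at once: every jump, an
  index with F p different from F (p + 1), lies in the half-open range \<open>{-K..<K}\<close>, over
  which all later sums run.\<close>

definition filt :: "int \<Rightarrow> 'v set \<Rightarrow> (int \<Rightarrow> 'v set) \<Rightarrow> bool" where
  "filt K V F \<longleftrightarrow> (\<forall>p. subspace (F p)) \<and> (\<forall>p q. p \<le> q \<longrightarrow> F q \<subseteq> F p) \<and>
     (\<forall>p\<le>-K. F p = V) \<and> (\<forall>p\<ge>K. F p = {0})"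

lemma filtD:
  assumes "filt K V F"
  shows "subspace (F p)" "p \<le> q \<Longrightarrow> F q \<subseteq> F p" "p \<le> - K \<Longrightarrow> F p = V" "K \<le> p \<Longrightarrow> F p = {0}"
    "F p \<subseteq> V" "subspace V"
proof -
  have sub: "subspace (F p)" and mono: "p \<le> q \<Longrightarrow> F q \<subseteq> F p"
    and V: "p \<le> - K \<Longrightarrow> F p = V" and "K \<le> p \<Longrightarrow> F p = {0}" for p q
    using assms unfolding filt_def by auto
  then show "subspace (F p)" "p \<le> q \<Longrightarrow> F q \<subseteq> F p" "p \<le> - K \<Longrightarrow> F p = V" "K \<le> p \<Longrightarrow> F p = {0}"
    by auto
  show "F p \<subseteq> V" using mono[of "min p (-K)" p] V[of "min p (-K)"] by simp
  show "subspace V" using sub[of "-K"] V[of "-K"] by simp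
qed

text \<open>Splitting off a vector \<open>v\<close> of the last nonzero \<open>F p \<inter> G q\<close>: a hyperplane that contains
  \<open>G (q + 1)\<close> but not \<open>v\<close> is compatible with every \<open>F a \<inter> G b\<close>.\<close>

lemma adapted_basis:
  assumes "filt K V F" "filt K V G" "fin_dim V"
  shows "\<exists>B P Q. finite B \<and> independent B \<and>
    (\<forall>a b. F a \<inter> G b = span {v \<in> B. a \<le> P v \<and> b \<le> Q v}) \<and>
    (\<forall>v\<in>B. P v \<in> {-K..<K} \<and> Q v \<in> {-K..<K})"
  using assms
proof (induction "dim V" arbitrary: V F G rule: less_induct)
  case less
  note F = filtD[OF less.prems(1)] and G = filtD[OF less.prems(2)]
  show ?case
  proof (cases "V = {0}")
    case True
    have "F a \<inter> G b = {0}" for a b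
      using F(5)[of a] True subspace_0[OF F(1)[of a]] subspace_0[OF G(1)[of b]] by auto
    then show ?thesis by (intro exI[of _ "{}"]) (auto simp: independent_empty)
  next
    case False
    obtain p where p: "-K \<le> p" "p < K" "\<And>a. F a \<noteq> {0} \<longleftrightarrow> a \<le> p"
    proof (rule int_threshold[of "\<lambda>a. F a \<noteq> {0}" "-K" K])
      show "F a \<noteq> {0}" if "a \<le> b" "F b \<noteq> {0}" for a b
        using F(2)[OF that(1)] that(2) subspace_0[OF F(1)] by blast
    qed (use F(3,4) False in auto)
    have Fp: "F p \<noteq> {0}" using p(3) by blast
    obtain q where q: "-K \<le> q" "q < K" "\<And>b. F p \<inter> G b \<noteq> {0} \<longleftrightarrow> b \<le> q"
    proof (rule int_threshold[of "\<lambda>b. F p \<inter> G b \<noteq> {0}" "-K" K])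
      show "F p \<inter> G a \<noteq> {0}" if "a \<le> b" "F p \<inter> G b \<noteq> {0}" for a b
        using G(2)[OF that(1)] that(2) subspace_0[OF F(1)] subspace_0[OF G(1)] by blast
      show "F p \<inter> G (- K) \<noteq> {0}" using G(3)[of "-K"] F(5)[of p] Fp by (simp add: Int_absorb2)
      show "\<not> F p \<inter> G K \<noteq> {0}" using G(4)[of K] subspace_0[OF F(1)] by auto
    qed blast
    obtain v where v: "v \<in> F p" "v \<in> G q" "v \<noteq> 0"
      using q(3)[of q] subspace_0[OF F(1), of p] subspace_0[OF G(1), of q] by auto
    have "v \<notin> G (q + 1)" using q(3)[of "q + 1"] v by auto
    then obtain l where l: "Vector_Spaces.linear scl (*) l" "l v = 1" "\<And>a. a \<in> G (q + 1) \<Longrightarrow> l a = 0"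
      by (rule separating_functional[OF G(1)]) blast
    interpret l: Vector_Spaces.linear scl "(*)" l by (rule l(1))
    define H where "H = {x \<in> V. l x = 0}"
    have subN: "subspace {x. l x = 0}" by (rule l.subspace_kernel)
    have H: "subspace H" using subspace_inter[OF F(6) subN] by (simp add: H_def Int_def)
    have vV: "v \<in> V" using v F(5) by blast
    have vH: "v \<notin> H" using l(2) by (simp add: H_def)
    have HV: "H \<subset> V" using vV vH by (auto simp: H_def)
    have filt_H: "filt K H (\<lambda>a. E a \<inter> H)" if E: "filt K V E" for E
    proof -
      have "0 \<in> H" using H by (rule subspace_0)
      then show ?thesis
        using filtD[OF E] HV H by (auto simp: filt_def intro: subspace_inter)
    qed
    have "dim H < dim V" using dim_less_fin_dim[OF less.prems(3) F(6) H HV] .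
    from less.hyps[OF this filt_H[OF less.prems(1)] filt_H[OF less.prems(2)]]
    obtain B P Q where B: "finite B" "independent B"
      "\<And>a b. (F a \<inter> H) \<inter> (G b \<inter> H) = span {v \<in> B. a \<le> P v \<and> b \<le> Q v}"
      "\<forall>v\<in>B. P v \<in> {-K..<K} \<and> Q v \<in> {-K..<K}"
      using fin_dim_subset[OF less.prems(3), of H] HV by auto
    have BH: "B \<subseteq> H"
    proof
      fix b assume "b \<in> B"
      then have "b \<in> {v \<in> B. -K \<le> P v \<and> -K \<le> Q v}" using B(4) by auto
      then have "b \<in> span {v \<in> B. -K \<le> P v \<and> -K \<le> Q v}" by (rule span_base)
      then show "b \<in> H" unfolding B(3)[symmetric] by blast
    qed
    have vB: "v \<notin> B" and spB: "span B \<subseteq> H" using BH vH span_minimal[OF BH H] by auto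
    define P' Q' where "P' = P(v := p)" and "Q' = Q(v := q)"
    have eq: "F a \<inter> G b = span {x \<in> insert v B. a \<le> P' x \<and> b \<le> Q' x}" for a b
    proof (cases "a \<le> p \<and> b \<le> q")
      case True
      have vm: "v \<in> F a" "v \<in> G b" using True v F(2) G(2) by blast+
      have *: "{x \<in> insert v B. a \<le> P' x \<and> b \<le> Q' x} = insert v {x \<in> B. a \<le> P x \<and> b \<le> Q x}"
        using True vB by (auto simp: P'_def Q'_def)
      have "x \<in> F a \<inter> G b \<longleftrightarrow> x \<in> span (insert v {x \<in> B. a \<le> P x \<and> b \<le> Q x})" for x
      proof
        assume x: "x \<in> F a \<inter> G b"
        \<comment> \<open>Since l v = 1, subtracting this multiple of \<open>v\<close> projects onto
          the hyperplane, and \<open>v\<close> itself lies in both steps.\<close>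
        have "x - scl (l x) v \<in> F a \<inter> H \<inter> (G b \<inter> H)"
          using x vm F(1,5) F(6) G(1) l(2) vV
          by (auto simp: H_def l.diff l.scale intro!: subspace_diff subspace_scale)
        then show "x \<in> span (insert v {x \<in> B. a \<le> P x \<and> b \<le> Q x})"
          unfolding B(3) span_insert by blast
      next
        assume "x \<in> span (insert v {x \<in> B. a \<le> P x \<and> b \<le> Q x})"
        then obtain k where k: "x - scl k v \<in> F a \<inter> H \<inter> (G b \<inter> H)"
          unfolding B(3) span_insert by blast
        have "x = (x - scl k v) + scl k v" by simp
        then show "x \<in> F a \<inter> G b"
          using k vm F(1) G(1) by (metis IntD1 IntD2 IntI subspace_add subspace_scale)
      qed
      then show ?thesis unfolding * by blast
    next
      case False
      then have *: "{x \<in> insert v B. a \<le> P' x \<and> b \<le> Q' x} = {x \<in> B. a \<le> P x \<and> b \<le> Q x}"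
        using vB by (auto simp: P'_def Q'_def)
      have "F a \<inter> G b \<subseteq> H"
      proof (cases "a \<le> p")
        case True
        then have "G b \<subseteq> G (q + 1)" using False G(2) by simp
        then show ?thesis using l(3) G(5) by (auto simp: H_def)
      next
        case False
        then have "F a = {0}" using p(3) by blast
        then show ?thesis using subspace_0[OF H] by auto
      qed
      then have "F a \<inter> G b = F a \<inter> H \<inter> (G b \<inter> H)" by blast
      then show ?thesis unfolding * B(3) .
    qed
    have "independent (insert v B)" using vB spB vH B(2) by (auto simp: independent_insert)
    moreover have "\<forall>x\<in>insert v B. P' x \<in> {-K..<K} \<and> Q' x \<in> {-K..<K}"
      using p q B(4) by (auto simp: P'_def Q'_def)
    ultimately show ?thesis using eq B(1)
      by (intro exI[of _ "insert v B"] exI[of _ P'] exI[of _ Q']) auto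
  qed
qed

lemma span_Int_independent:
  assumes "independent B" "S \<subseteq> B" "T \<subseteq> B"
  shows "span S \<inter> span T = span (S \<inter> T)"
proof
  show "span S \<inter> span T \<subseteq> span (S \<inter> T)"
  proof
    fix x assume x: "x \<in> span S \<inter> span T"
    have S: "representation B x = representation S x" and T: "representation B x = representation T x"
      using representation_extend[OF assms(1) _ assms(2), of x]
        representation_extend[OF assms(1) _ assms(3), of x] x by auto
    have "b \<in> S \<inter> T" if "representation B x b \<noteq> 0" for b
      using that S T representation_ne_zero[of S x b] representation_ne_zero[of T x b] by auto
    moreover have "x \<in> span B" using x assms span_mono by blast
    then have "(\<Sum>b | representation B x b \<noteq> 0. scl (representation B x b) b) = x"
      using sum_nonzero_representation_eq[OF assms(1)] by blast
    ultimately show "x \<in> span (S \<inter> T)"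
      by (smt (verit) mem_Collect_eq span_base span_scale span_sum)
  qed
qed (simp add: span_mono)

end

section \<open>Modules of Laurent polynomials\<close>

lemma sum_single_lookup:
  assumes "finite A" "Poly_Mapping.keys x \<subseteq> A"
  shows "(\<Sum>a\<in>A. Poly_Mapping.single a (Poly_Mapping.lookup x a)) = x"
proof (rule poly_mapping_eqI)
  fix k
  have "Poly_Mapping.lookup (\<Sum>a\<in>A. Poly_Mapping.single a (Poly_Mapping.lookup x a)) k =
      (\<Sum>a\<in>A. if a = k then Poly_Mapping.lookup x k else 0)"
    by (auto simp: lookup_sum lookup_single when_def intro!: sum.cong)
  also have "\<dots> = Poly_Mapping.lookup x k"
    using assms by (auto simp: sum.delta in_keys_iff subset_iff)
  finally show "Poly_Mapping.lookup (\<Sum>a\<in>A. Poly_Mapping.single a (Poly_Mapping.lookup x a)) k =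
      Poly_Mapping.lookup x k" .
qed

text \<open>Additive identities need checking on monomials only; this replaces computations with the
  double sum in \<open>smul\<close>.\<close>

lemma poly_mapping_add_induct [case_names single add]:
  fixes x :: "'a \<Rightarrow>\<^sub>0 'b::comm_monoid_add"
  assumes single: "\<And>a v. P (Poly_Mapping.single a v)"
    and add: "\<And>x y. P x \<Longrightarrow> P y \<Longrightarrow> P (x + y)"
  shows "P x"
proof -
  have "P (\<Sum>a\<in>A. Poly_Mapping.single a (Poly_Mapping.lookup x a))" if "finite A" for A
    using that
  proof (induction A)
    case empty
    then show ?case using single[of undefined 0] by simp
  qed (simp add: single add)
  from this[of "Poly_Mapping.keys x"] show ?thesis by (simp add: sum_single_lookup)
qed

text \<open>Every monomial is set to 1, so this is restriction to the point (1 : 1 : 1) of the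
  torus: a ring homomorphism on functions and a compatible map on sections.\<close>

definition ev :: "('a \<Rightarrow>\<^sub>0 'b::comm_monoid_add) \<Rightarrow> 'b" where
  "ev x = (\<Sum>a\<in>Poly_Mapping.keys x. Poly_Mapping.lookup x a)"

lemma ev_eq_sum: "finite A \<Longrightarrow> Poly_Mapping.keys x \<subseteq> A \<Longrightarrow> ev x = (\<Sum>a\<in>A. Poly_Mapping.lookup x a)"
  unfolding ev_def by (rule sum.mono_neutral_left) (auto simp: in_keys_iff)

lemma ev_zero [simp]: "ev 0 = 0"
  by (simp add: ev_def)

lemma ev_single [simp]: "ev (Poly_Mapping.single a v) = v"
  by (simp add: ev_def)

lemma ev_add: "ev (x + y) = ev x + ev y"
proof -
  let ?A = "Poly_Mapping.keys x \<union> Poly_Mapping.keys y"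
  have "Poly_Mapping.keys (x + y) \<subseteq> ?A" by (rule Poly_Mapping.keys_add)
  then show ?thesis
    by (simp add: ev_eq_sum[of ?A] lookup_add sum.distrib)
qed

lemma ev_sum: "ev (sum f A) = (\<Sum>a\<in>A. ev (f a))"
  by (induction A rule: infinite_finite_induct) (simp_all add: ev_add)

lemma ev_mult: "ev (f * g) = ev f * ev g" for f g :: "'a::monoid_add \<Rightarrow>\<^sub>0 'b::semiring_0"
proof (induction f rule: poly_mapping_add_induct)
  case (single a u)
  show ?case
  proof (induction g rule: poly_mapping_add_induct)
    case (single b v)
    show ?case by (simp add: mult_single)
  qed (simp add: ev_add algebra_simps)
qed (simp add: ev_add algebra_simps)

lemma ev_one [simp]: "ev 1 = 1"
  by (simp add: ev_def)

lemma ev_power: "ev (f ^ n) = ev f ^ n" for f :: "'a::monoid_add \<Rightarrow>\<^sub>0 'b::semiring_1"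
  by (induction n) (simp_all add: ev_mult)

lemma ev_diff: "ev (x - y) = ev x - ev y" for x y :: "'a \<Rightarrow>\<^sub>0 'b::ab_group_add"
  using ev_add[of "x - y" y] by (simp add: algebra_simps)

section \<open>Total degree and the coordinate rings of the charts\<close>

lemma total_degree_add: "total_degree (a + b) = total_degree a + total_degree b"
  by (simp add: total_degree_def sum.distrib)

lemma total_degree_diff: "total_degree (a - b) = total_degree a - total_degree b"
  by (simp add: total_degree_def sum_subtractf)

lemma total_degree_zero [simp]: "total_degree 0 = 0"
  by (simp add: total_degree_def)

lemma other_charts:
  fixes k :: 3
  obtains i j where "i \<noteq> j" "\<And>l. l \<noteq> k \<longleftrightarrow> l = i \<or> l = j"
proof -
  have "\<exists>i j. i \<noteq> j \<and> (\<forall>l. l \<noteq> k \<longleftrightarrow> l = i \<or> l = j)"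
    using exhaust_3[of k]
  proof (elim disjE)
    assume "k = 1" then show ?thesis by (intro exI[of _ 2] exI[of _ 3]) (simp add: forall_3)
  next
    assume "k = 2" then show ?thesis by (intro exI[of _ 1] exI[of _ 3]) (simp add: forall_3)
  next
    \<comment> \<open>In the numeral type \<open>3\<close> this is the element 0.\<close>
    assume "k = 3" then show ?thesis by (intro exI[of _ 1] exI[of _ 2]) (simp add: forall_3)
  qed
  then show ?thesis using that by blast
qed

lemma total_degree_3:
  assumes "i \<noteq> j" "\<And>l. l \<noteq> k \<longleftrightarrow> l = i \<or> l = j"
  shows "total_degree a = a $ i + a $ j + a $ k"
proof -
  have "i \<noteq> k" "j \<noteq> k" using assms by auto
  moreover have U: "UNIV = {i, j, k}" using assms(2) by blast
  ultimately show ?thesis using assms(1) unfolding total_degree_def U by simp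
qed

lemma chart_ring_zero: "0 \<in> chart_ring I"
  by (simp add: chart_ring_def)

lemma chart_ring_one: "1 \<in> chart_ring I"
  by (simp add: chart_ring_def)

lemma chart_ring_add: "f \<in> chart_ring I \<Longrightarrow> g \<in> chart_ring I \<Longrightarrow> f + g \<in> chart_ring I"
  using Poly_Mapping.keys_add[of f g] unfolding chart_ring_def by blast

lemma chart_ring_mult: "f \<in> chart_ring I \<Longrightarrow> g \<in> chart_ring I \<Longrightarrow> f * g \<in> chart_ring I"
  using Poly_Mapping.keys_mult[of f g] unfolding chart_ring_def
  by (fastforce simp: total_degree_add)

lemma chart_ring_single:
  "total_degree a = 0 \<Longrightarrow> (\<And>i. i \<notin> I \<Longrightarrow> 0 \<le> a $ i) \<Longrightarrow> Poly_Mapping.single a z \<in> chart_ring I"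
  by (simp add: chart_ring_def)

lemma chart_ring_diff: "f \<in> chart_ring I \<Longrightarrow> g \<in> chart_ring I \<Longrightarrow> f - g \<in> chart_ring I"
  using chart_ring_add[of f I "- g"] by (simp add: chart_ring_def in_keys_iff)

lemma chart_ring_sum: "(\<And>i. i \<in> A \<Longrightarrow> f i \<in> chart_ring I) \<Longrightarrow> sum f A \<in> chart_ring I"
  by (induction A rule: infinite_finite_induct) (auto simp: chart_ring_zero chart_ring_add)

lemma chart_ring_power: "f \<in> chart_ring I \<Longrightarrow> f ^ n \<in> chart_ring I"
  by (induction n) (auto simp: chart_ring_one chart_ring_mult)

section \<open>Sections as a module over the Laurent polynomials\<close>

context complex_space
begin

lemma smul_eq_sum:
  assumes "finite A" "Poly_Mapping.keys f \<subseteq> A" "finite B" "Poly_Mapping.keys x \<subseteq> B"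
  shows "smul scl f x = (\<Sum>a\<in>A. \<Sum>b\<in>B.
     Poly_Mapping.single (a + b) (scl (Poly_Mapping.lookup f a) (Poly_Mapping.lookup x b)))"
proof -
  have "smul scl f x = (\<Sum>a\<in>Poly_Mapping.keys f. \<Sum>b\<in>B.
     Poly_Mapping.single (a + b) (scl (Poly_Mapping.lookup f a) (Poly_Mapping.lookup x b)))"
    unfolding smul_def using assms
    by (intro sum.cong refl sum.mono_neutral_left) (auto simp: in_keys_iff)
  also have "\<dots> = (\<Sum>a\<in>A. \<Sum>b\<in>B.
     Poly_Mapping.single (a + b) (scl (Poly_Mapping.lookup f a) (Poly_Mapping.lookup x b)))"
    using assms by (intro sum.mono_neutral_left) (auto simp: in_keys_iff)
  finally show ?thesis .
qed

lemma smul_zero_left [simp]: "smul scl 0 x = 0" and smul_zero_right [simp]: "smul scl f 0 = 0"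
  by (simp_all add: smul_def)

lemma smul_single_single:
  "smul scl (Poly_Mapping.single a z) (Poly_Mapping.single b v) = Poly_Mapping.single (a + b) (scl z v)"
  by (simp add: smul_def)

lemma smul_add_left: "smul scl (f + g) x = smul scl f x + smul scl g x"
proof -
  let ?A = "Poly_Mapping.keys f \<union> Poly_Mapping.keys g"
  have "Poly_Mapping.keys (f + g) \<subseteq> ?A" by (rule Poly_Mapping.keys_add)
  then show ?thesis
    by (simp add: smul_eq_sum[of ?A _ "Poly_Mapping.keys x"] lookup_add scale_left_distrib
        single_add sum.distrib)
qed

lemma smul_add_right: "smul scl f (x + y) = smul scl f x + smul scl f y"
proof -
  let ?B = "Poly_Mapping.keys x \<union> Poly_Mapping.keys y"
  have "Poly_Mapping.keys (x + y) \<subseteq> ?B" by (rule Poly_Mapping.keys_add)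
  then show ?thesis
    by (simp add: smul_eq_sum[of "Poly_Mapping.keys f" _ ?B] lookup_add scale_right_distrib
        single_add sum.distrib)
qed

lemma smul_sum_left: "smul scl (sum f A) x = (\<Sum>i\<in>A. smul scl (f i) x)"
  by (induction A rule: infinite_finite_induct) (simp_all add: smul_add_left)

lemma smul_sum_right: "smul scl f (sum x A) = (\<Sum>i\<in>A. smul scl f (x i))"
  by (induction A rule: infinite_finite_induct) (simp_all add: smul_add_right)

lemma smul_diff_left: "smul scl (f - g) x = smul scl f x - smul scl g x"
  using smul_add_left[of "f - g" g x] by (simp add: algebra_simps)

lemma smul_assoc: "smul scl f (smul scl g x) = smul scl (f * g) x"
proof (induction f rule: poly_mapping_add_induct)
  case (single a u)
  show ?case
  proof (induction g rule: poly_mapping_add_induct)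
    case (single b v)
    show ?case
    proof (induction x rule: poly_mapping_add_induct)
      case (single c w)
      show ?case by (simp add: smul_single_single mult_single add.assoc)
    qed (simp add: smul_add_right)
  qed (simp add: smul_add_right smul_add_left distrib_left)
qed (simp add: smul_add_left distrib_right)

lemma smul_one [simp]: "smul scl 1 x = x"
proof (induction x rule: poly_mapping_add_induct)
  case (single a v)
  show ?case using smul_single_single[of 0 1 a v] by simp
qed (simp add: smul_add_right)

lemma ev_smul: "ev (smul scl f x) = scl (ev f) (ev x)"
proof (induction f rule: poly_mapping_add_induct)
  case (single a u)
  show ?case
  proof (induction x rule: poly_mapping_add_induct)
    case (single b v)
    show ?case by (simp add: smul_single_single)
  qed (simp add: smul_add_right ev_add scale_right_distrib)
qed (simp add: smul_add_left ev_add scale_left_distrib)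

lemma lookup_smul_single:
  "Poly_Mapping.lookup (smul scl f (Poly_Mapping.single a v)) b = scl (Poly_Mapping.lookup f (b - a)) v"
proof (induction f rule: poly_mapping_add_induct)
  case (single c u)
  have "c + a = b \<longleftrightarrow> c = b - a" by (auto simp: algebra_simps)
  then show ?case by (simp add: smul_single_single lookup_single when_def)
qed (simp add: smul_add_left lookup_add scale_left_distrib)

text \<open>A module cut out coefficient by coefficient is stable under \<open>f\<close> once a
  shift by an exponent of \<open>f\<close> can only enlarge the prescribed subspaces. The charts and
  their overlaps are both of this kind.\<close>

lemma lookup_smul_mem:
  assumes C: "\<And>b. subspace (C b)" and f: "\<And>a b. a \<in> Poly_Mapping.keys f \<Longrightarrow> C b \<subseteq> C (a + b)"
    and x: "\<And>b. Poly_Mapping.lookup x b \<in> C b"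
  shows "Poly_Mapping.lookup (smul scl f x) b \<in> C b"
  unfolding smul_def lookup_sum lookup_single when_def
proof (intro subspace_sum C)
  fix a c assume a: "a \<in> Poly_Mapping.keys f"
  have "Poly_Mapping.lookup x c \<in> C (a + c)" using f[OF a] x by blast
  then show "(if a + c = b then scl (Poly_Mapping.lookup f a) (Poly_Mapping.lookup x c) else 0) \<in> C b"
    using C by (auto intro: subspace_scale simp: subspace_0)
qed

text \<open>With the value \<open>{0}\<close> in the wrong degrees, membership in a chart module
  becomes a subspace condition at every exponent, without reference to the support.\<close>

definition coeff_space :: "int \<Rightarrow> (3 \<Rightarrow> int \<Rightarrow> 'v set) \<Rightarrow> 3 \<Rightarrow> int ^ 3 \<Rightarrow> 'v set" where
  "coeff_space d Fs k a = (if total_degree a = d then \<Inter>i\<in>-{k}. Fs i (- (a $ i)) else {0})"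

end

section \<open>Twisted Rees bundles\<close>

text \<open>The twist by \<open>O(d)\<close> of the Rees bundle; it treats \<open>rees_bundle\<close> (\<open>d = 0\<close>) and
  \<open>line_bundle d\<close> (filtrations of a line that jump at \<open>0\<close>) uniformly.\<close>

definition rees :: "int \<Rightarrow> (3 \<Rightarrow> int \<Rightarrow> 'v::ab_group_add set) \<Rightarrow> 'v chart_modules" where
  "rees d Fs k = {x. \<forall>a\<in>Poly_Mapping.keys x. total_degree a = d \<and>
     (\<forall>i. i \<noteq> k \<longrightarrow> Poly_Mapping.lookup x a \<in> Fs i (- (a $ i)))}"

lemma rees_0: "rees 0 Fs = rees_bundle Fs"
  by (rule ext) (simp add: rees_def rees_bundle_def)

locale trifiltered_space = complex_space scl
  for scl :: "complex \<Rightarrow> 'v::ab_group_add \<Rightarrow> 'v" +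
  fixes K :: int and V :: "'v set" and Fs :: "3 \<Rightarrow> int \<Rightarrow> 'v set"
  assumes filt: "filt K V (Fs i)" and fin_dim: "fin_dim V"
begin

lemmas Fs = filtD[OF filt]

lemma subspace_coeff_space: "subspace (coeff_space d Fs k a)"
  by (auto simp: coeff_space_def intro: subspace_Int Fs(1))

lemma rees_iff: "x \<in> rees d Fs k \<longleftrightarrow> (\<forall>a. Poly_Mapping.lookup x a \<in> coeff_space d Fs k a)"
proof -
  have "Poly_Mapping.lookup x a \<in> coeff_space d Fs k a \<longleftrightarrow> (a \<in> Poly_Mapping.keys x \<longrightarrow>
      total_degree a = d \<and> (\<forall>i. i \<noteq> k \<longrightarrow> Poly_Mapping.lookup x a \<in> Fs i (- (a $ i))))" for a
    using subspace_0[OF subspace_coeff_space, of d k a]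
    by (cases "a \<in> Poly_Mapping.keys x") (auto simp: coeff_space_def in_keys_iff)
  then show ?thesis by (auto simp: rees_def)
qed

lemma single_rees:
  "total_degree a = d \<Longrightarrow> (\<And>i. i \<noteq> k \<Longrightarrow> v \<in> Fs i (- (a $ i))) \<Longrightarrow> Poly_Mapping.single a v \<in> rees d Fs k"
  by (simp add: rees_def)

lemma rees_lookup_V: "x \<in> rees d Fs k \<Longrightarrow> Poly_Mapping.lookup x a \<in> V"
proof -
  assume x: "x \<in> rees d Fs k"
  obtain i j where "\<And>l. l \<noteq> k \<longleftrightarrow> l = i \<or> l = j" using other_charts[of k] by blast
  then have "i \<noteq> k" by blast
  then have "a \<in> Poly_Mapping.keys x \<Longrightarrow> Poly_Mapping.lookup x a \<in> Fs i (- (a $ i))"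
    using x by (auto simp: rees_def)
  then show ?thesis
    using Fs(5)[of i "- (a $ i)"] subspace_0[OF Fs(6)]
    by (cases "a \<in> Poly_Mapping.keys x") (auto simp: in_keys_iff)
qed

lemma chart_submodule_rees: "chart_submodule scl {k} (rees d Fs k)"
  unfolding chart_submodule_def
proof (intro conjI ballI)
  show "0 \<in> rees d Fs k" by (simp add: rees_def)
  show "x + y \<in> rees d Fs k" if "x \<in> rees d Fs k" "y \<in> rees d Fs k" for x y
    using that by (auto simp: rees_iff lookup_add intro: subspace_add subspace_coeff_space)
  show "smul scl f x \<in> rees d Fs k" if f: "f \<in> chart_ring {k}" and x: "x \<in> rees d Fs k" for f x
    unfolding rees_iff
  proof (intro allI lookup_smul_mem subspace_coeff_space)
    fix a b assume a: "a \<in> Poly_Mapping.keys f"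
    have "Fs i (- (b $ i)) \<subseteq> Fs i (- ((a + b) $ i))" if "i \<noteq> k" for i
      using f a that by (intro Fs(2)) (auto simp: chart_ring_def)
    then have "(\<Inter>i\<in>-{k}. Fs i (- (b $ i))) \<subseteq> (\<Inter>i\<in>-{k}. Fs i (- ((a + b) $ i)))" by blast
    moreover have "total_degree (a + b) = total_degree b"
      using f a by (simp add: chart_ring_def total_degree_add)
    ultimately show "coeff_space d Fs k b \<subseteq> coeff_space d Fs k (a + b)"
      by (simp add: coeff_space_def)
  qed (use x rees_iff in blast)
qed

lemma rees_closed:
  shows rees_sum: "(\<And>i. i \<in> A \<Longrightarrow> x i \<in> rees d Fs k) \<Longrightarrow> sum x A \<in> rees d Fs k"
    and rees_smul: "f \<in> chart_ring {k} \<Longrightarrow> y \<in> rees d Fs k \<Longrightarrow> smul scl f y \<in> rees d Fs k"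
proof -
  show "(\<And>i. i \<in> A \<Longrightarrow> x i \<in> rees d Fs k) \<Longrightarrow> sum x A \<in> rees d Fs k"
    using chart_submodule_rees[of k d] unfolding chart_submodule_def
    by (induction A rule: infinite_finite_induct) auto
qed (use chart_submodule_rees[of k d] in \<open>auto simp: chart_submodule_def\<close>)

text \<open>The local splitting: on U_k only two filtrations count, and the vectors of a basis
  adapted to both, each multiplied by the lowest monomial allowed, generate the module.\<close>

lemma rees_free:
  obtains v :: "nat \<Rightarrow> 'v" and a :: "nat \<Rightarrow> int ^ 3"
  where "inj_on v {..<dim V}" "independent (v ` {..<dim V})" "span (v ` {..<dim V}) = V"
    "\<forall>l<dim V. Poly_Mapping.single (a l) (v l) \<in> rees d Fs k"
    "\<forall>x\<in>rees d Fs k. \<exists>h. (\<forall>l<dim V. h l \<in> chart_ring {k}) \<and>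
       x = (\<Sum>l<dim V. smul scl (h l) (Poly_Mapping.single (a l) (v l)))"
proof -
  obtain i j where ij: "i \<noteq> j" and k: "\<And>l. l \<noteq> k \<longleftrightarrow> l = i \<or> l = j"
    using other_charts[of k] by blast
  obtain B P Q where B: "finite B" "independent B"
    "\<And>a b. Fs i a \<inter> Fs j b = span {v \<in> B. a \<le> P v \<and> b \<le> Q v}"
    "\<forall>v\<in>B. P v \<in> {-K..<K} \<and> Q v \<in> {-K..<K}"
    using adapted_basis[OF filt filt fin_dim, of i j] by blast
  have BV: "span B = V"
  proof -
    have "{v \<in> B. -K \<le> P v \<and> -K \<le> Q v} = B" using B(4) by auto
    then show ?thesis using B(3)[of "-K" "-K"] Fs(3)[of "-K"] by simp
  qed
  have card: "card B = dim V" using dim_span_eq_card_independent[OF B(2)] BV by simp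
  obtain v where v: "bij_betw v {..<dim V} B"
    using ex_bij_betw_nat_finite[OF B(1)] unfolding card atLeast0LessThan by blast
  \<comment> \<open>The exponents at \<open>i\<close> and \<open>j\<close> are the least ones that
    the jumps permit; the exponent at \<open>k\<close>, unrestricted on this chart, brings the
    degree to \<open>d\<close>.\<close>
  define A :: "'v \<Rightarrow> int ^ 3" where
    "A = (\<lambda>b. \<chi> l. if l = i then - P b else if l = j then - Q b else d + P b + Q b)"
  have A: "A b $ i = - P b" "A b $ j = - Q b" "total_degree (A b) = d" for b
    using ij k k[of k] total_degree_3[OF ij k, of "A b"] by (auto simp: A_def)
  have adapted: "(\<Inter>l\<in>-{k}. Fs l (- (b $ l))) = span {w \<in> B. - (b $ i) \<le> P w \<and> - (b $ j) \<le> Q w}" for b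
  proof -
    have "-{k} = {i, j}" using k by auto
    then show ?thesis using B(3)[of "- (b $ i)" "- (b $ j)"] by auto
  qed
  show ?thesis
  proof
    show "inj_on v {..<dim V}" "independent (v ` {..<dim V})" "span (v ` {..<dim V}) = V"
      using v B(2) BV by (auto simp: bij_betw_def)
    show "\<forall>l<dim V. Poly_Mapping.single (A (v l)) (v l) \<in> rees d Fs k"
    proof (intro allI impI single_rees)
      fix l assume l: "l < dim V"
      have "v l \<in> B" using v l by (auto simp: bij_betw_def)
      then have "v l \<in> (\<Inter>m\<in>-{k}. Fs m (- (A (v l) $ m)))"
        unfolding adapted by (intro span_base) (simp add: A)
      then show "v l \<in> Fs m (- (A (v l) $ m))" if "m \<noteq> k" for m using that by blast
    qed (rule A)
    show "\<forall>x\<in>rees d Fs k. \<exists>h. (\<forall>l<dim V. h l \<in> chart_ring {k}) \<and>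
       x = (\<Sum>l<dim V. smul scl (h l) (Poly_Mapping.single (A (v l)) (v l)))"
    proof
      fix x assume x: "x \<in> rees d Fs k"
      let ?X = "Poly_Mapping.keys x"
      define c where "c b = representation B (Poly_Mapping.lookup x b)" for b
      define h where "h l = (\<Sum>b\<in>?X. Poly_Mapping.single (b - A (v l)) (c b (v l)))" for l
      \<comment> \<open>Only basis vectors of the relevant intersection occur in a coefficient of
        \<open>x\<close>; hence the exponent of the quotient monomial is nonnegative at
        \<open>i\<close> and \<open>j\<close>, and the monomial is a function on the chart.\<close>
      have supp: "total_degree b = d \<and> - (b $ i) \<le> P w \<and> - (b $ j) \<le> Q w" if "b \<in> ?X" "c b w \<noteq> 0" for b w
      proof -
        have td: "total_degree b = d"
          and mem: "Poly_Mapping.lookup x b \<in> span {w \<in> B. - (b $ i) \<le> P w \<and> - (b $ j) \<le> Q w}"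
          using x that(1) unfolding adapted[symmetric] by (auto simp: rees_def)
        then have "c b = representation {w \<in> B. - (b $ i) \<le> P w \<and> - (b $ j) \<le> Q w} (Poly_Mapping.lookup x b)"
          unfolding c_def by (intro representation_extend[OF B(2)]) auto
        then show ?thesis using td that(2) representation_ne_zero by fastforce
      qed
      have "h l \<in> chart_ring {k}" for l
        unfolding h_def
      proof (rule chart_ring_sum)
        fix b assume b: "b \<in> ?X"
        show "Poly_Mapping.single (b - A (v l)) (c b (v l)) \<in> chart_ring {k}"
        proof (cases "c b (v l) = 0")
          case True
          then show ?thesis by (simp add: chart_ring_zero)
        next
          case False
          from supp[OF b this] show ?thesis
            using k A by (intro chart_ring_single) (auto simp: total_degree_diff)
        qed
      qed
      moreover have "x = (\<Sum>l<dim V. smul scl (h l) (Poly_Mapping.single (A (v l)) (v l)))"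
      proof -
        have "(\<Sum>l<dim V. smul scl (h l) (Poly_Mapping.single (A (v l)) (v l))) =
            (\<Sum>l<dim V. \<Sum>b\<in>?X. Poly_Mapping.single b (scl (c b (v l)) (v l)))"
          by (simp add: h_def smul_sum_left smul_single_single)
        also have "\<dots> = (\<Sum>b\<in>?X. \<Sum>l<dim V. Poly_Mapping.single b (scl (c b (v l)) (v l)))"
          by (rule sum.swap)
        also have "\<dots> = (\<Sum>b\<in>?X. Poly_Mapping.single b (\<Sum>l<dim V. scl (c b (v l)) (v l)))"
          by (intro sum.cong refl poly_mapping_eqI) (simp add: lookup_sum lookup_single when_def)
        also have "\<dots> = (\<Sum>b\<in>?X. Poly_Mapping.single b (Poly_Mapping.lookup x b))"
        proof (intro sum.cong refl arg_cong[of _ _ "Poly_Mapping.single _"])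
          fix b
          have "(\<Sum>l<dim V. scl (c b (v l)) (v l)) = (\<Sum>w\<in>B. scl (c b w) w)"
            by (rule sum.reindex_bij_betw[OF v])
          also have "\<dots> = Poly_Mapping.lookup x b"
            unfolding c_def by (rule sum_representation_eq) (use B BV rees_lookup_V[OF x] in auto)
          finally show "(\<Sum>l<dim V. scl (c b (v l)) (v l)) = Poly_Mapping.lookup x b" .
        qed
        also have "\<dots> = x" by (rule sum_single_lookup) auto
        finally show ?thesis by simp
      qed
      ultimately show "\<exists>h. (\<forall>l<dim V. h l \<in> chart_ring {k}) \<and>
         x = (\<Sum>l<dim V. smul scl (h l) (Poly_Mapping.single (A (v l)) (v l)))"
        by (intro exI[of _ h]) simp
    qed
  qed
qed

text \<open>Inverting u_j/u_i removes the condition imposed by the filtration \<open>j\<close>. What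
  remains is symmetric in \<open>i\<close> and \<open>j\<close>, and this is the gluing
  condition.\<close>

lemma rees_overlap:
  assumes "i \<noteq> j"
  shows "chart_span scl {i, j} (rees d Fs i) =
    {y. \<forall>a\<in>Poly_Mapping.keys y. total_degree a = d \<and> Poly_Mapping.lookup y a \<in> V \<and>
       (\<forall>l. l \<notin> {i, j} \<longrightarrow> Poly_Mapping.lookup y a \<in> Fs l (- (a $ l)))}" (is "_ = ?T")
proof
  define C where "C a = (if total_degree a = d then V \<inter> (\<Inter>l\<in>-{i, j}. Fs l (- (a $ l))) else {0})" for a
  have C: "subspace (C a)" for a
    by (auto simp: C_def intro!: subspace_inter subspace_Int Fs(1,6))
  have T: "y \<in> ?T \<longleftrightarrow> (\<forall>a. Poly_Mapping.lookup y a \<in> C a)" for y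
  proof -
    have "Poly_Mapping.lookup y a \<in> C a \<longleftrightarrow> (a \<in> Poly_Mapping.keys y \<longrightarrow> total_degree a = d \<and>
        Poly_Mapping.lookup y a \<in> V \<and> (\<forall>l. l \<notin> {i, j} \<longrightarrow> Poly_Mapping.lookup y a \<in> Fs l (- (a $ l))))" for a
      using subspace_0[OF C, of a] by (cases "a \<in> Poly_Mapping.keys y") (auto simp: C_def in_keys_iff)
    then show ?thesis by auto
  qed
  show "chart_span scl {i, j} (rees d Fs i) \<subseteq> ?T"
  proof
    fix y assume "y \<in> chart_span scl {i, j} (rees d Fs i)"
    then obtain n f x where fx: "\<And>t. t < (n::nat) \<Longrightarrow> f t \<in> chart_ring {i, j} \<and> x t \<in> rees d Fs i"
      and y: "y = (\<Sum>t<n. smul scl (f t) (x t))" unfolding chart_span_def by blast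
    have "Poly_Mapping.lookup (smul scl (f t) (x t)) a \<in> C a" if t: "t < n" for t a
    proof (rule lookup_smul_mem[OF C])
      fix a b assume a: "a \<in> Poly_Mapping.keys (f t)"
      have "Fs l (- (b $ l)) \<subseteq> Fs l (- ((a + b) $ l))" if "l \<notin> {i, j}" for l
        using fx[OF t] a that by (intro Fs(2)) (auto simp: chart_ring_def)
      then have "(\<Inter>l\<in>-{i, j}. Fs l (- (b $ l))) \<subseteq> (\<Inter>l\<in>-{i, j}. Fs l (- ((a + b) $ l)))" by blast
      moreover have "total_degree (a + b) = total_degree b"
        using fx[OF t] a by (simp add: chart_ring_def total_degree_add)
      ultimately show "C b \<subseteq> C (a + b)" unfolding C_def by auto
    next
      fix b
      have "Poly_Mapping.lookup (x t) b \<in> V" using fx[OF t] rees_lookup_V by blast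
      then show "Poly_Mapping.lookup (x t) b \<in> C b"
        using fx[OF t] subspace_0[OF C, of b]
        by (cases "b \<in> Poly_Mapping.keys (x t)") (auto simp: C_def rees_def in_keys_iff)
    qed
    then show "y \<in> ?T" unfolding T y by (auto simp: lookup_sum intro: subspace_sum C)
  qed
  show "?T \<subseteq> chart_span scl {i, j} (rees d Fs i)"
  proof
    fix y assume y: "y \<in> ?T"
    obtain h where h: "bij_betw h {..<card (Poly_Mapping.keys y)} (Poly_Mapping.keys y)"
      using ex_bij_betw_nat_finite[OF finite_keys] unfolding atLeast0LessThan by blast
    \<comment> \<open>The shift along u_j/u_i brings the exponent at \<open>j\<close> to
      \<open>K\<close>, where the step -K of the filtration is all of \<open>V\<close>; the opposite
      shift is a function on the overlap.\<close>
    define s where "s a = axis j (K - a $ j) - axis i (K - a $ j)" for a :: "int ^ 3"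
    have s: "total_degree (s a) = 0" "s a $ j = K - a $ j" "l \<notin> {i, j} \<Longrightarrow> s a $ l = 0" for a l
      using assms by (auto simp: s_def total_degree_diff axis_def) (simp add: total_degree_def)
    have "y = (\<Sum>a\<in>Poly_Mapping.keys y. Poly_Mapping.single a (Poly_Mapping.lookup y a))"
      by (simp add: sum_single_lookup)
    also have "\<dots> = (\<Sum>a\<in>Poly_Mapping.keys y. smul scl (Poly_Mapping.single (- s a) 1)
        (Poly_Mapping.single (a + s a) (Poly_Mapping.lookup y a)))"
      by (simp add: smul_single_single)
    also have "\<dots> = (\<Sum>t<card (Poly_Mapping.keys y). smul scl (Poly_Mapping.single (- s (h t)) 1)
        (Poly_Mapping.single (h t + s (h t)) (Poly_Mapping.lookup y (h t))))"
      by (rule sum.reindex_bij_betw[OF h, symmetric])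
    finally have y_eq: "y = (\<Sum>t<card (Poly_Mapping.keys y). smul scl (Poly_Mapping.single (- s (h t)) 1)
        (Poly_Mapping.single (h t + s (h t)) (Poly_Mapping.lookup y (h t))))" .
    have f: "Poly_Mapping.single (- s a) 1 \<in> chart_ring {i, j}" for a
      using s(1)[of a] s(3)[of _ a] total_degree_diff[of 0 "s a"] by (intro chart_ring_single) auto
    have x: "Poly_Mapping.single (a + s a) (Poly_Mapping.lookup y a) \<in> rees d Fs i"
      if a: "a \<in> Poly_Mapping.keys y" for a
    proof (rule single_rees)
      show "total_degree (a + s a) = d" using y a by (simp add: total_degree_add s)
      fix l assume l: "l \<noteq> i"
      show "Poly_Mapping.lookup y a \<in> Fs l (- ((a + s a) $ l))"
      proof (cases "l = j")
        case True
        then show ?thesis using y a s(2)[of a] Fs(3)[of "-K" j] by simp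
      next
        case False
        then show ?thesis using y a s(3)[of l a] l by simp
      qed
    qed
    show "y \<in> chart_span scl {i, j} (rees d Fs i)"
      unfolding chart_span_def mem_Collect_eq
      using f x h y_eq by (intro exI conjI) (auto simp: bij_betw_def)
  qed
qed

lemma independent_family:
  fixes r :: nat
  assumes "\<And>c. (\<Sum>i<r. scl (c i) (w i)) = 0 \<Longrightarrow> \<forall>i<r. c i = 0"
  shows "inj_on w {..<r}" "independent (w ` {..<r})"
proof -
  show inj: "inj_on w {..<r}"
  proof (rule inj_onI, rule ccontr)
    fix i j assume ij: "i \<in> {..<r}" "j \<in> {..<r}" "w i = w j" "i \<noteq> j"
    let ?c = "\<lambda>l. (if l = i then 1 else 0) - (if l = j then 1 else 0) :: complex"
    have "(\<Sum>l<r. scl (?c l) (w l)) = (\<Sum>l<r. (if l = i then w l else 0)) - (\<Sum>l<r. (if l = j then w l else 0))"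
      unfolding sum_subtractf[symmetric] by (intro sum.cong) (auto simp: scale_left_diff_distrib)
    also have "\<dots> = 0" using ij by simp
    finally have "\<forall>l<r. ?c l = 0" by (rule assms)
    then show False using ij by auto
  qed
  show "independent (w ` {..<r})"
  proof (rule independent_if_scalars_zero)
    fix f x assume sum: "(\<Sum>x\<in>w ` {..<r}. scl (f x) x) = 0" and x: "x \<in> w ` {..<r}"
    have "(\<Sum>i<r. scl (f (w i)) (w i)) = 0" using sum sum.reindex[OF inj, of "\<lambda>x. scl (f x) x"] by simp
    from assms[OF this] x show "f x = 0" by auto
  qed simp
qed

lemma locally_free_rees: "locally_free scl (dim V) k (rees d Fs k)"
proof -
  obtain v a where v: "inj_on v {..<dim V}" "independent (v ` {..<dim V})" "span (v ` {..<dim V}) = V"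
    and e: "\<forall>l<dim V. Poly_Mapping.single (a l) (v l) \<in> rees d Fs k"
    and h: "\<forall>x\<in>rees d Fs k. \<exists>h. (\<forall>l<dim V. h l \<in> chart_ring {k}) \<and>
       x = (\<Sum>l<dim V. smul scl (h l) (Poly_Mapping.single (a l) (v l)))"
    using rees_free[of d k] .
  have indep: "g l = 0"
    if g: "(\<Sum>i<dim V. smul scl (g i) (Poly_Mapping.single (a i) (v i))) = 0" and l: "l < dim V" for g l
  proof (rule poly_mapping_eqI)
    fix c
    \<comment> \<open>The coefficient of the relation at the exponent c + a l is a relation between
      the independent vectors v i, in which v l carries the coefficient of g l at c. The inverse of
      \<open>v\<close> turns the indexed sum into a sum over a set of vectors.\<close>
    let ?u = "\<lambda>w. Poly_Mapping.lookup (g (the_inv_into {..<dim V} v w)) (c + a l - a (the_inv_into {..<dim V} v w))"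
    have "0 = Poly_Mapping.lookup (\<Sum>i<dim V. smul scl (g i) (Poly_Mapping.single (a i) (v i))) (c + a l)"
      using g by simp
    also have "\<dots> = (\<Sum>i<dim V. scl (Poly_Mapping.lookup (g i) (c + a l - a i)) (v i))"
      by (simp add: lookup_sum lookup_smul_single)
    also have "\<dots> = (\<Sum>w\<in>v ` {..<dim V}. scl (?u w) w)"
      using v(1) by (simp add: sum.reindex the_inv_into_f_f)
    finally have "?u (v l) = 0"
      using independentD[OF v(2), of "v ` {..<dim V}" ?u "v l"] l by auto
    then show "Poly_Mapping.lookup (g l) c = Poly_Mapping.lookup 0 c"
      using v(1) l by (simp add: the_inv_into_f_f)
  qed
  show ?thesis
    unfolding locally_free_def
  \<comment> \<open>The module is free over the whole chart, so the function 1 alone serves as the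
    cover.\<close>
  proof (intro exI[of _ "{1}"] conjI ballI)
    show "\<exists>g. (\<forall>f\<in>{1}. g f \<in> chart_ring {k}) \<and> (\<Sum>f\<in>{1}. g f * f) = 1"
      by (intro exI[of _ "\<lambda>_. 1"]) (simp add: chart_ring_one)
    fix f :: laurent assume f: "f \<in> {1}"
    show "\<exists>b. (\<forall>i<dim V. b i \<in> rees d Fs k) \<and>
        (\<forall>g. (\<forall>i<dim V. g i \<in> chart_ring {k}) \<and> (\<Sum>i<dim V. smul scl (g i) (b i)) = 0
          \<longrightarrow> (\<forall>i<dim V. g i = 0)) \<and>
        (\<forall>x\<in>rees d Fs k. \<exists>N g. (\<forall>i<dim V. g i \<in> chart_ring {k}) \<and>
          smul scl (f ^ N) x = (\<Sum>i<dim V. smul scl (g i) (b i)))"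
    proof (intro exI[of _ "\<lambda>l. Poly_Mapping.single (a l) (v l)"] conjI allI impI ballI)
      fix x assume "x \<in> rees d Fs k"
      from bspec[OF h this] obtain g where "\<forall>l<dim V. g l \<in> chart_ring {k}"
        "x = (\<Sum>l<dim V. smul scl (g l) (Poly_Mapping.single (a l) (v l)))" by blast
      then show "\<exists>N g. (\<forall>i<dim V. g i \<in> chart_ring {k}) \<and>
          smul scl (f ^ N) x = (\<Sum>i<dim V. smul scl (g i) (Poly_Mapping.single (a i) (v i)))"
        using f by (intro exI[of _ 0] exI[of _ g]) simp
    qed (use e indep in blast)+
  qed (simp_all add: chart_ring_one)
qed

lemma vector_bundle_rees: "vector_bundle scl (dim V) (rees d Fs)"
  unfolding vector_bundle_def
proof (intro conjI allI)
  fix i j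
  show "chart_span scl {i, j} (rees d Fs i) = chart_span scl {i, j} (rees d Fs j)"
  proof (cases "i = j")
    case False
    then have "chart_span scl {j, i} (rees d Fs j) = chart_span scl {i, j} (rees d Fs i)"
      unfolding rees_overlap[OF False] rees_overlap[OF False[symmetric]] by (simp add: disj_commute insert_commute)
    then show ?thesis by (simp add: insert_commute)
  qed simp
qed (rule chart_submodule_rees locally_free_rees)+

text \<open>Evaluation at the point \<open>(1 : 1 : 1)\<close> maps the sections over \<open>U\<^sub>k\<close> onto \<open>V\<close>, and every
  local basis to a basis of \<open>V\<close>.\<close>

lemma locally_free_rees_rank:
  assumes "locally_free scl r k (rees d Fs k)"
  shows "r = dim V"
proof -
  obtain D g where D: "D \<subseteq> chart_ring {k}" "(\<Sum>f\<in>D. g f * f) = (1 :: laurent)"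
    and loc: "\<forall>f\<in>D. \<exists>b :: nat \<Rightarrow> 'v sections. (\<forall>i<r. b i \<in> rees d Fs k) \<and>
           (\<forall>g. (\<forall>i<r. g i \<in> chart_ring {k}) \<and> (\<Sum>i<r. smul scl (g i) (b i)) = 0
                \<longrightarrow> (\<forall>i<r. g i = 0)) \<and>
           (\<forall>x\<in>rees d Fs k. \<exists>N g. (\<forall>i<r. g i \<in> chart_ring {k}) \<and>
                smul scl (f ^ N) x = (\<Sum>i<r. smul scl (g i) (b i)))"
    using assms unfolding locally_free_def by blast
  \<comment> \<open>As the functions in \<open>D\<close> generate the unit ideal, one of them does
    not vanish at (1 : 1 : 1); the local basis there is the one that is used.\<close>
  have "(\<Sum>f\<in>D. ev (g f) * ev f) = 1" using arg_cong[OF D(2), of ev] by (simp add: ev_sum ev_mult)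
  then obtain f where f: "f \<in> D" "ev f \<noteq> 0"
    by (metis (no_types, lifting) mult_zero_right sum.neutral zero_neq_one)
  have fc: "f \<in> chart_ring {k}" using f D by blast
  obtain b where b: "\<And>i. i < r \<Longrightarrow> b i \<in> rees d Fs k"
    and b_indep: "\<And>g. \<forall>i<r. g i \<in> chart_ring {k} \<Longrightarrow> (\<Sum>i<r. smul scl (g i) (b i)) = 0 \<Longrightarrow> \<forall>i<r. g i = 0"
    and b_span: "\<And>x. x \<in> rees d Fs k \<Longrightarrow> \<exists>N g. (\<forall>i<r. g i \<in> chart_ring {k}) \<and>
        smul scl (f ^ N) x = (\<Sum>i<r. smul scl (g i) (b i))"
    using bspec[OF loc f(1)] by blast
  obtain v a where v: "inj_on v {..<dim V}" "independent (v ` {..<dim V})" "span (v ` {..<dim V}) = V"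
    and e: "\<forall>l<dim V. Poly_Mapping.single (a l) (v l) \<in> rees d Fs k"
    and h: "\<forall>x\<in>rees d Fs k. \<exists>h. (\<forall>l<dim V. h l \<in> chart_ring {k}) \<and>
       x = (\<Sum>l<dim V. smul scl (h l) (Poly_Mapping.single (a l) (v l)))"
    using rees_free[of d k] .
  have "\<forall>l. \<exists>N G. l < dim V \<longrightarrow> (\<forall>i<r. G i \<in> chart_ring {k}) \<and>
      smul scl (f ^ N) (Poly_Mapping.single (a l) (v l)) = (\<Sum>i<r. smul scl (G i) (b i))"
    using b_span e by blast
  then obtain N G where NG: "\<forall>l. l < dim V \<longrightarrow> (\<forall>i<r. G l i \<in> chart_ring {k}) \<and>
      smul scl (f ^ N l) (Poly_Mapping.single (a l) (v l)) = (\<Sum>i<r. smul scl (G l i) (b i))"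
    unfolding choice_iff by blast
  define w where "w i = ev (b i)" for i
  have "V \<subseteq> span (w ` {..<r})"
  proof -
    have "v l \<in> span (w ` {..<r})" if "l < dim V" for l
    proof -
      have "scl (ev f ^ N l) (v l) = (\<Sum>i<r. scl (ev (G l i)) (w i))"
        using arg_cong[OF conjunct2[OF NG[rule_format, OF that]], of ev]
        by (simp add: ev_smul ev_sum ev_power w_def)
      then have "v l = scl (inverse (ev f ^ N l)) (\<Sum>i<r. scl (ev (G l i)) (w i))"
        using f(2) by (metis left_inverse power_eq_0_iff scale_one scale_scale)
      then show ?thesis by (auto intro!: span_scale span_sum intro: span_base)
    qed
    then have "span (v ` {..<dim V}) \<subseteq> span (w ` {..<r})" by (intro span_minimal) auto
    then show ?thesis using v(3) by simp
  qed
  then have "dim V \<le> r"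
    using dim_le_card[of V "w ` {..<r}"] card_image_le[of "{..<r}" w] by simp
  moreover have "\<forall>i<r. c i = 0" if c: "(\<Sum>i<r. scl (c i) (w i)) = 0" for c
  proof -
    \<comment> \<open>A linear relation between the values is lifted with constant coefficients to a
      section \<open>y\<close> that vanishes at the point. Its coordinates in the global basis
      vanish there too, hence so do the coordinates \<open>R\<close> of f^M y in the local basis.
      Uniqueness identifies R i with f^M times c i, and evaluation leaves c i = 0.\<close>
    define y where "y = (\<Sum>i<r. smul scl (Poly_Mapping.single 0 (c i)) (b i))"
    have const: "Poly_Mapping.single 0 z \<in> chart_ring {k}" for z by (intro chart_ring_single) auto
    have "y \<in> rees d Fs k" unfolding y_def by (intro rees_sum rees_smul const b) simp
    then obtain H where H: "\<forall>l<dim V. H l \<in> chart_ring {k}"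
      "y = (\<Sum>l<dim V. smul scl (H l) (Poly_Mapping.single (a l) (v l)))" using h by blast
    have "ev y = 0" using c by (simp add: y_def ev_sum ev_smul w_def)
    then have "(\<Sum>l<dim V. scl (ev (H l)) (v l)) = 0" by (simp add: H(2) ev_sum ev_smul)
    then have "(\<Sum>x\<in>v ` {..<dim V}. scl (ev (H (the_inv_into {..<dim V} v x))) x) = 0"
      using v(1) by (simp add: sum.reindex the_inv_into_f_f)
    from independentD[OF v(2) _ subset_refl this] have evH: "ev (H l) = 0" if "l < dim V" for l
      using that v(1) by (force simp: the_inv_into_f_f)
    \<comment> \<open>A common exponent that clears the denominators of all basis sections at
      once.\<close>
    define M where "M = (\<Sum>l<dim V. N l)"
    have NM: "f ^ M = f ^ (M - N l) * f ^ N l" if "l < dim V" for l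
    proof -
      have "N l \<le> M" unfolding M_def using that by (intro member_le_sum) auto
      then show ?thesis by (simp add: power_add[symmetric])
    qed
    define R where "R i = (\<Sum>l<dim V. H l * f ^ (M - N l) * G l i)" for i
    have "smul scl (f ^ M) y = (\<Sum>l<dim V. smul scl (H l * f ^ (M - N l)) (smul scl (f ^ N l) (Poly_Mapping.single (a l) (v l))))"
      unfolding H(2) smul_sum_right
    proof (intro sum.cong refl)
      fix l assume "l \<in> {..<dim V}"
      then show "smul scl (f ^ M) (smul scl (H l) (Poly_Mapping.single (a l) (v l))) =
          smul scl (H l * f ^ (M - N l)) (smul scl (f ^ N l) (Poly_Mapping.single (a l) (v l)))"
        using NM[of l] by (simp add: smul_assoc mult_ac)
    qed
    also have "\<dots> = (\<Sum>l<dim V. \<Sum>i<r. smul scl (H l * f ^ (M - N l) * G l i) (b i))"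
      using NG by (simp add: smul_sum_right smul_assoc)
    also have "\<dots> = (\<Sum>i<r. smul scl (R i) (b i))"
      unfolding R_def smul_sum_left by (rule sum.swap)
    finally have 1: "smul scl (f ^ M) y = (\<Sum>i<r. smul scl (R i) (b i))" .
    have "(\<Sum>i<r. smul scl (f ^ M * Poly_Mapping.single 0 (c i) - R i) (b i)) = smul scl (f ^ M) y - smul scl (f ^ M) y"
      unfolding smul_diff_left sum_subtractf 1[symmetric] by (simp add: y_def smul_sum_right smul_assoc)
    then have "\<forall>i<r. f ^ M * Poly_Mapping.single 0 (c i) - R i = 0"
      using H(1) NG fc const unfolding R_def
      by (intro b_indep) (auto intro!: chart_ring_diff chart_ring_mult chart_ring_sum chart_ring_power)
    then have "\<forall>i<r. ev (f ^ M * Poly_Mapping.single 0 (c i) - R i) = 0" by simp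
    moreover have "ev (R i) = 0" for i by (simp add: R_def ev_sum ev_mult evH)
    ultimately show ?thesis using f(2) by (simp add: ev_diff ev_mult ev_power)
  qed
  note fam = independent_family[OF this]
  have "w ` {..<r} \<subseteq> span (v ` {..<dim V})"
    unfolding v(3) w_def ev_def by (auto intro!: subspace_sum Fs(6) rees_lookup_V[OF b])
  then have "card (w ` {..<r}) \<le> card (v ` {..<dim V})"
    using independent_span_bound[OF _ fam(2)] by blast
  then have "r \<le> dim V" using fam(1) v(1) by (simp add: card_image)
  ultimately show ?thesis by simp
qed

lemma bundle_rank_rees: "bundle_rank scl (rees d Fs) = dim V"
  unfolding bundle_rank_def
proof (rule the_equality[where P = "\<lambda>r. vector_bundle scl r (rees d Fs)"])
  show "r = dim V" if "vector_bundle scl r (rees d Fs)" for r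
    using that locally_free_rees_rank[of r 0 d] unfolding vector_bundle_def by blast
qed (rule vector_bundle_rees)

end

section \<open>Numerical invariants and exact sequences\<close>

context complex_space
begin

definition gr_dim :: "(3 \<Rightarrow> int \<Rightarrow> 'v set) \<Rightarrow> 3 \<Rightarrow> int \<Rightarrow> int" where
  "gr_dim Fs i p = int (dim (Fs i p)) - int (dim (Fs i (p + 1)))"

text \<open>This is the dimension of the bigraded piece Gr_i^p Gr_j^q of the space. As a mixed
  second difference it is linear in dimensions of pairwise intersections, hence additive.\<close>

definition gr_dim2 :: "(3 \<Rightarrow> int \<Rightarrow> 'v set) \<Rightarrow> 3 \<Rightarrow> 3 \<Rightarrow> int \<Rightarrow> int \<Rightarrow> int" where
  "gr_dim2 Fs i j p q =
     (int (dim (Fs i p \<inter> Fs j q)) - int (dim (Fs i (p + 1) \<inter> Fs j q))) -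
     (int (dim (Fs i p \<inter> Fs j (q + 1))) - int (dim (Fs i (p + 1) \<inter> Fs j (q + 1))))"

text \<open>The first and the second power sum of the Chern roots of the Rees bundle; for a line with
  jumps \<open>a\<^sub>0, a\<^sub>1, a\<^sub>2\<close> they are \<open>s\<close> and \<open>s\<^sup>2\<close> with \<open>s = a\<^sub>0 + a\<^sub>1 + a\<^sub>2\<close>.\<close>

definition power_sum1 :: "int \<Rightarrow> (3 \<Rightarrow> int \<Rightarrow> 'v set) \<Rightarrow> int" where
  "power_sum1 K Fs = (\<Sum>i\<in>UNIV. \<Sum>p\<in>{-K..<K}. p * gr_dim Fs i p)"

definition power_sum2 :: "int \<Rightarrow> (3 \<Rightarrow> int \<Rightarrow> 'v set) \<Rightarrow> int" where
  "power_sum2 K Fs = (\<Sum>i\<in>UNIV. \<Sum>p\<in>{-K..<K}. p\<^sup>2 * gr_dim Fs i p) +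
     (\<Sum>i\<in>UNIV. \<Sum>j\<in>-{i}. \<Sum>p\<in>{-K..<K}. \<Sum>q\<in>{-K..<K}. p * q * gr_dim2 Fs i j p q)"

text \<open>The first map is an inclusion. Exactness is asked only for two distinct filtrations at a
  time, since no chart sees all three; a single filtration is the case in which the other step is
  the whole space.\<close>

definition tri_exact ::
    "('v \<Rightarrow> 'v) \<Rightarrow> (3 \<Rightarrow> int \<Rightarrow> 'v set) \<Rightarrow> (3 \<Rightarrow> int \<Rightarrow> 'v set) \<Rightarrow> (3 \<Rightarrow> int \<Rightarrow> 'v set) \<Rightarrow> bool" where
  "tri_exact g Fs' Fs Fs'' \<longleftrightarrow> Vector_Spaces.linear scl scl g \<and> (\<forall>i j p q. i \<noteq> j \<longrightarrow>
     Fs' i p \<inter> Fs' j q = {x \<in> Fs i p \<inter> Fs j q. g x = 0} \<and>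
     g ` (Fs i p \<inter> Fs j q) = Fs'' i p \<inter> Fs'' j q)"

end

lemma (in complex_space) tri_exact_power_sums:
  assumes "trifiltered_space scl K V' Fs'" "trifiltered_space scl K V Fs"
    "trifiltered_space scl K V'' Fs''" "tri_exact g Fs' Fs Fs''"
  shows "power_sum1 K Fs = power_sum1 K Fs' + power_sum1 K Fs''"
    and "power_sum2 K Fs = power_sum2 K Fs' + power_sum2 K Fs''"
proof -
  interpret A: trifiltered_space scl K V' Fs' by fact
  interpret B: trifiltered_space scl K V Fs by fact
  interpret C: trifiltered_space scl K V'' Fs'' by fact
  interpret complex_space_pair scl scl ..
  have g: "Vector_Spaces.linear scl scl g"
    and ex: "\<And>i j p q. i \<noteq> j \<Longrightarrow> Fs' i p \<inter> Fs' j q = {x \<in> Fs i p \<inter> Fs j q. g x = 0} \<and>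
     g ` (Fs i p \<inter> Fs j q) = Fs'' i p \<inter> Fs'' j q"
    using assms(4) unfolding tri_exact_def by auto
  have d2: "dim (Fs i p \<inter> Fs j q) = dim (Fs' i p \<inter> Fs' j q) + dim (Fs'' i p \<inter> Fs'' j q)"
    if "i \<noteq> j" for i j p q
  proof -
    have "fin_dim (Fs i p \<inter> Fs j q)" using B.fin_dim B.Fs(5)[of i p] by (auto intro: fin_dim_subset)
    then show ?thesis
      using rank_nullity_on[OF g _ subspace_inter[OF B.Fs(1) B.Fs(1)], of i p j q] ex[OF that] by simp
  qed
  \<comment> \<open>Step -K of another filtration is the whole space, so single steps are special
    pairwise intersections.\<close>
  have d1: "dim (Fs i p) = dim (Fs' i p) + dim (Fs'' i p)" for i p
  proof -
    obtain j k where "\<And>l. l \<noteq> i \<longleftrightarrow> l = j \<or> l = k" using other_charts[of i] by blast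
    then have "i \<noteq> j" by blast
    from d2[OF this, of p "-K"] show ?thesis
      using A.Fs(3)[of "-K" j] B.Fs(3)[of "-K" j] C.Fs(3)[of "-K" j]
        A.Fs(5)[of i p] B.Fs(5)[of i p] C.Fs(5)[of i p] by (simp add: Int_absorb2)
  qed
  have gr1: "gr_dim Fs i p = gr_dim Fs' i p + gr_dim Fs'' i p" for i p
    by (simp add: gr_dim_def d1)
  have gr2: "gr_dim2 Fs i j p q = gr_dim2 Fs' i j p q + gr_dim2 Fs'' i j p q" if "i \<noteq> j" for i j p q
    using d2[OF that] by (simp add: gr_dim2_def)
  show "power_sum1 K Fs = power_sum1 K Fs' + power_sum1 K Fs''"
    by (simp add: power_sum1_def gr1 distrib_left sum.distrib)
  have "(\<Sum>i\<in>UNIV. \<Sum>j\<in>-{i}. \<Sum>p\<in>{-K..<K}. \<Sum>q\<in>{-K..<K}. p * q * gr_dim2 Fs i j p q) =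
      (\<Sum>i\<in>UNIV. \<Sum>j\<in>-{i}. \<Sum>p\<in>{-K..<K}. \<Sum>q\<in>{-K..<K}.
         p * q * gr_dim2 Fs' i j p q + p * q * gr_dim2 Fs'' i j p q)"
    by (intro sum.cong refl) (simp add: gr2 distrib_left)
  then show "power_sum2 K Fs = power_sum2 K Fs' + power_sum2 K Fs''"
    by (simp add: power_sum2_def gr1 distrib_left sum.distrib)
qed

section \<open>Linear maps acting on the coefficients of sections\<close>

lemma lookup_map_zero:
  "f 0 = 0 \<Longrightarrow> Poly_Mapping.lookup (Poly_Mapping.map f x) a = f (Poly_Mapping.lookup x a)"
  by (simp add: Poly_Mapping.map.rep_eq when_def)

lemma (in vector_space_pair) linear_map_add:
  assumes "Vector_Spaces.linear s1 s2 g"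
  shows "Poly_Mapping.map g (x + y) = Poly_Mapping.map g x + Poly_Mapping.map g y"
proof -
  interpret g: Vector_Spaces.linear s1 s2 g by fact
  show ?thesis by (rule poly_mapping_eqI) (simp add: lookup_map_zero lookup_add g.add)
qed

lemma (in complex_space_pair) linear_map_smul:
  assumes "Vector_Spaces.linear s1 s2 g"
  shows "Poly_Mapping.map g (smul s1 f x) = smul s2 f (Poly_Mapping.map g x)"
proof -
  interpret g: Vector_Spaces.linear s1 s2 g by fact
  show ?thesis
  proof (induction f rule: poly_mapping_add_induct)
    case (single a u)
    show ?case
    proof (induction x rule: poly_mapping_add_induct)
      case (single b v)
      show ?case by (simp add: vs1.smul_single_single vs2.smul_single_single g.scale)
    qed (simp add: vs1.smul_add_right vs2.smul_add_right linear_map_add[OF assms])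
  qed (simp add: vs1.smul_add_left vs2.smul_add_left linear_map_add[OF assms])
qed

lemma (in complex_space_pair) bundle_hom_map:
  assumes "Vector_Spaces.linear s1 s2 g" "\<And>k. Poly_Mapping.map g ` E k \<subseteq> E' k"
  shows "bundle_hom s1 s2 E E' (Poly_Mapping.map g)"
  using assms by (simp add: bundle_hom_def linear_map_add linear_map_smul)

lemma rees_iff_pair:
  assumes "\<And>l. l \<noteq> k \<longleftrightarrow> l = i \<or> l = j"
  shows "x \<in> rees d Fs k \<longleftrightarrow> (\<forall>a\<in>Poly_Mapping.keys x. total_degree a = d \<and>
    Poly_Mapping.lookup x a \<in> Fs i (- (a $ i)) \<inter> Fs j (- (a $ j)))"
  unfolding rees_def using assms by auto

text \<open>The map acts on coefficients and keeps exponents, so exactness over a chart splits into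
  one condition per exponent \<open>a\<close>, which is \<open>tri_exact\<close> at the steps - a_i
  and - a_j.\<close>

lemma (in complex_space) short_exact_rees:
  assumes "trifiltered_space scl K V Fs" "tri_exact g Fs' Fs Fs''"
  shows "short_exact scl (rees d Fs') (rees d Fs) (rees d Fs'')"
proof -
  interpret complex_space_pair scl scl ..
  have lin: "Vector_Spaces.linear scl scl g"
    and ker: "\<And>i j p q. i \<noteq> j \<Longrightarrow> Fs' i p \<inter> Fs' j q = {x \<in> Fs i p \<inter> Fs j q. g x = 0}"
    and im: "\<And>i j p q. i \<noteq> j \<Longrightarrow> g ` (Fs i p \<inter> Fs j q) = Fs'' i p \<inter> Fs'' j q"
    using assms(2) unfolding tri_exact_def by auto
  interpret g: Vector_Spaces.linear scl scl g by fact
  have kernel: "rees d Fs' k = {x \<in> rees d Fs k. Poly_Mapping.map g x = 0}"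
    and image: "Poly_Mapping.map g ` rees d Fs k = rees d Fs'' k" for k
  proof -
    obtain i j where ij: "i \<noteq> j" and k: "\<And>l. l \<noteq> k \<longleftrightarrow> l = i \<or> l = j" using other_charts[of k] by blast
    have zero: "Poly_Mapping.map g x = 0 \<longleftrightarrow> (\<forall>a\<in>Poly_Mapping.keys x. g (Poly_Mapping.lookup x a) = 0)" for x
      by (rule map_eq_zero_iff)
    show "rees d Fs' k = {x \<in> rees d Fs k. Poly_Mapping.map g x = 0}"
      unfolding set_eq_iff mem_Collect_eq rees_iff_pair[OF k] zero ker[OF ij] by blast
    show "Poly_Mapping.map g ` rees d Fs k = rees d Fs'' k"
    proof (intro equalityI subsetI)
      fix y assume "y \<in> Poly_Mapping.map g ` rees d Fs k"
      then obtain x where x: "x \<in> rees d Fs k" "y = Poly_Mapping.map g x" by blast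
      have "Poly_Mapping.keys y \<subseteq> Poly_Mapping.keys x"
        by (auto simp: x(2) in_keys_iff lookup_map_zero)
      then show "y \<in> rees d Fs'' k"
        using x(1) unfolding rees_iff_pair[OF k] im[OF ij, symmetric] by (auto simp: x(2) lookup_map_zero)
    next
      fix y assume y: "y \<in> rees d Fs'' k"
      have "\<forall>a. \<exists>v. a \<in> Poly_Mapping.keys y \<longrightarrow>
          v \<in> Fs i (- (a $ i)) \<inter> Fs j (- (a $ j)) \<and> g v = Poly_Mapping.lookup y a"
        using y unfolding rees_iff_pair[OF k] im[OF ij, symmetric] by force
      then obtain h where h: "\<forall>a. a \<in> Poly_Mapping.keys y \<longrightarrow>
          h a \<in> Fs i (- (a $ i)) \<inter> Fs j (- (a $ j)) \<and> g (h a) = Poly_Mapping.lookup y a"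
        unfolding choice_iff by blast
      define x where "x = (\<Sum>a\<in>Poly_Mapping.keys y. Poly_Mapping.single a (h a))"
      have lx: "Poly_Mapping.lookup x a = (if a \<in> Poly_Mapping.keys y then h a else 0)" for a
        by (simp add: x_def lookup_sum lookup_single when_def)
      have "y = Poly_Mapping.map g x"
        using h by (intro poly_mapping_eqI) (auto simp: lookup_map_zero lx in_keys_iff)
      moreover have "x \<in> rees d Fs k"
        unfolding rees_iff_pair[OF k]
      proof
        fix a assume "a \<in> Poly_Mapping.keys x"
        then have a: "a \<in> Poly_Mapping.keys y" by (auto simp: in_keys_iff lx split: if_splits)
        then show "total_degree a = d \<and> Poly_Mapping.lookup x a \<in> Fs i (- (a $ i)) \<inter> Fs j (- (a $ j))"
          using h y by (simp add: lx rees_def)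
      qed
      ultimately show "y \<in> Poly_Mapping.map g ` rees d Fs k" by blast
    qed
  qed
  have "bundle_hom scl scl (rees d Fs') (rees d Fs) (\<lambda>x. x)"
    using kernel by (auto simp: bundle_hom_def)
  moreover have "bundle_hom scl scl (rees d Fs) (rees d Fs'') (Poly_Mapping.map g)"
    using image by (intro bundle_hom_map[OF lin]) auto
  ultimately show ?thesis
    unfolding short_exact_def using kernel image
    by (intro exI[of _ "\<lambda>x. x"] exI[of _ "Poly_Mapping.map g"]) auto
qed

section \<open>Chern classes of Rees bundles\<close>

lemma lookup_std_scale: "Poly_Mapping.lookup (std_scale z v) n = z * Poly_Mapping.lookup v n"
  by (simp add: std_scale_def lookup_map_zero)

interpretation std: complex_space std_scale
  by unfold_locales
    (auto intro!: poly_mapping_eqI simp: lookup_std_scale lookup_add algebra_simps)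

interpretation std_pair: complex_space_pair std_scale std_scale ..

text \<open>Finitely many vectors involve finitely many coordinates, so a further coordinate vector
  is free. It becomes the second summand in the fibre product.\<close>

lemma std_outside:
  assumes "std.fin_dim V"
  obtains e where "e \<notin> V"
proof -
  obtain S where S: "finite S" "V \<subseteq> std.span S" using assms unfolding std.fin_dim_def by blast
  have "finite (\<Union>s\<in>S. Poly_Mapping.keys s)" using S by auto
  then obtain n where n: "n \<notin> (\<Union>s\<in>S. Poly_Mapping.keys s)" using ex_new_if_finite infinite_UNIV_nat by blast
  have "std.subspace {v. Poly_Mapping.lookup v n = 0}"
    by (simp add: std.subspace_def lookup_add lookup_std_scale)
  then have "std.span S \<subseteq> {v. Poly_Mapping.lookup v n = 0}"
    using n by (intro std.span_minimal) (auto simp: in_keys_iff)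
  then have "Poly_Mapping.single n 1 \<notin> V" using S by auto
  then show ?thesis using that by blast
qed

lemma rees_zero: "rees d (\<lambda>i p. {0}) = (\<lambda>k. {0})"
proof
  fix k :: 3
  obtain i j where "\<And>l. l \<noteq> k \<longleftrightarrow> l = i \<or> l = j" using other_charts[of k] by blast
  then have i: "i \<noteq> k" by blast
  have "x = 0" if "x \<in> rees d (\<lambda>i p. {0}) k" for x
  proof -
    have "Poly_Mapping.lookup x a = 0" for a
      using that i by (cases "a \<in> Poly_Mapping.keys x") (auto simp: rees_def in_keys_iff)
    then show ?thesis by (intro poly_mapping_eqI) simp
  qed
  then show "rees d (\<lambda>i p. {0}) k = {0}"
    by (auto simp: rees_def)
qed

lemma vector_bundle_zero: "vector_bundle std_scale 0 (\<lambda>k. {0})"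
proof -
  interpret Z: trifiltered_space std_scale 0 "{0}" "\<lambda>i p. {0}"
    by unfold_locales (auto simp: std.filt_def std.fin_dim_def std.subspace_0)
  show ?thesis using Z.vector_bundle_rees[of 0] by (simp add: rees_zero)
qed

section \<open>Consequences of the axioms for the total Chern class\<close>

locale chern =
  fixes c :: "std chart_modules \<Rightarrow> int poly"
  assumes c: "total_chern_class c"
begin

lemma c_vector_bundle:
  assumes "vector_bundle std_scale r E"
  shows "degree (c E) \<le> 2" "coeff (c E) 0 = 1"
  using c assms unfolding total_chern_class_def by blast+

lemma c_line_bundle: "c (line_bundle d) = [:1, d:]"
  using c unfolding total_chern_class_def by blast

lemma whitney:
  assumes "vector_bundle std_scale r' E'" "vector_bundle std_scale r E" "vector_bundle std_scale r'' E''"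
    and "short_exact std_scale E' E E''"
  shows "c E = poly_cutoff 3 (c E' * c E'')"
  using c assms unfolding total_chern_class_def by blast

definition p1 :: "std chart_modules \<Rightarrow> int" where
  "p1 E = coeff (c E) 1"

text \<open>Newton's identity: the sum of the squares of the Chern roots. In contrast to the second
  Chern class it is additive.\<close>

definition p2 :: "std chart_modules \<Rightarrow> int" where
  "p2 E = (coeff (c E) 1)\<^sup>2 - 2 * coeff (c E) 2"

lemma p_additive:
  assumes "vector_bundle std_scale r' E'" "vector_bundle std_scale r E" "vector_bundle std_scale r'' E''"
    and "short_exact std_scale E' E E''"
  shows "p1 E = p1 E' + p1 E''" "p2 E = p2 E' + p2 E''"
proof -
  note W = whitney[OF assms] and c0 = c_vector_bundle(2)[OF assms(1)] c_vector_bundle(2)[OF assms(3)]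
  have c1: "coeff (c E) 1 = coeff (c E') 1 + coeff (c E'') 1"
    using c0 by (simp add: W coeff_poly_cutoff coeff_mult atMost_Suc)
  have c2: "coeff (c E) 2 = coeff (c E') 2 + coeff (c E') 1 * coeff (c E'') 1 + coeff (c E'') 2"
    using c0 by (simp add: W coeff_poly_cutoff coeff_mult atMost_Suc numeral_2_eq_2)
  show "p1 E = p1 E' + p1 E''" "p2 E = p2 E' + p2 E''"
    unfolding p1_def p2_def c1 c2 by (simp_all add: power2_eq_square algebra_simps)
qed

text \<open>The exact sequence of zero bundles makes the class equal to its own truncated square;
  with constant term 1 this forces the coefficients in degrees 1 and 2 to vanish.\<close>

lemma c_zero: "c (\<lambda>k. {0}) = 1"
proof -
  let ?Z = "\<lambda>k::3. {0 :: std sections}"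
  have hom: "bundle_hom std_scale std_scale ?Z ?Z (\<lambda>x. x)" by (simp add: bundle_hom_def)
  have "short_exact std_scale ?Z ?Z ?Z"
    unfolding short_exact_def by (intro exI[of _ "\<lambda>x. x"]) (use hom in auto)
  note W = whitney[OF vector_bundle_zero vector_bundle_zero vector_bundle_zero this]
  note c0 = c_vector_bundle[OF vector_bundle_zero]
  have c1: "coeff (c ?Z) 1 = 0"
    using arg_cong[OF W, of "\<lambda>p. coeff p 1"] c0 by (simp add: coeff_poly_cutoff coeff_mult atMost_Suc)
  have c2: "coeff (c ?Z) 2 = 0"
    using arg_cong[OF W, of "\<lambda>p. coeff p 2"] c0 c1
    by (simp add: coeff_poly_cutoff coeff_mult atMost_Suc numeral_2_eq_2)
  show ?thesis
  proof (rule poly_eqI)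
    fix n :: nat
    consider "n = 0" | "n = 1" | "n = 2" | "n > 2" by linarith
    then show "coeff (c ?Z) n = coeff 1 n"
      using c0 c1 c2 by cases (auto simp: coeff_eq_0)
  qed
qed

text \<open>An isomorphism is a short exact sequence with zero kernel, to which the Whitney formula
  applies.\<close>

lemma c_isomorphic:
  assumes E: "vector_bundle std_scale r E" and E': "vector_bundle std_scale r' E'"
    and hom: "bundle_hom std_scale std_scale E E' \<psi>" and bij: "\<And>k. bij_betw \<psi> (E k) (E' k)"
  shows "c E = c E'"
proof -
  have 0: "0 \<in> E k" for k using E by (auto simp: vector_bundle_def chart_submodule_def)
  have "0 \<in> torus_sections std_scale E"
    unfolding torus_sections_def chart_span_def by (auto intro: exI[of _ "0::nat"])
  \<comment> \<open>A morphism is additive on torus sections only, hence the preceding membership of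
    0.\<close>
  then have "\<psi> (0 + 0) = \<psi> 0 + \<psi> 0" using hom unfolding bundle_hom_def by blast
  then have \<psi>0: "\<psi> 0 = 0" by simp
  have "{x \<in> E k. \<psi> x = 0} = {0}" for k
    using bij[of k] 0[of k] \<psi>0 by (auto simp: bij_betw_def inj_on_def)
  moreover have "bundle_hom std_scale std_scale (\<lambda>k. {0}) E (\<lambda>x. x)"
    using 0 by (simp add: bundle_hom_def)
  ultimately have "short_exact std_scale (\<lambda>k. {0}) E E'"
    unfolding short_exact_def using hom bij
    by (intro exI[of _ "\<lambda>x. x"] exI[of _ \<psi>]) (auto simp: bij_betw_def)
  from whitney[OF vector_bundle_zero E E' this] have "c E = poly_cutoff 3 (c E')"
    by (simp add: c_zero)
  also have "\<dots> = c E'"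
    using c_vector_bundle(1)[OF E'] by (intro poly_eqI) (auto simp: coeff_poly_cutoff coeff_eq_0)
  finally show ?thesis .
qed

definition chern_formula :: "int \<Rightarrow> (3 \<Rightarrow> int \<Rightarrow> std set) \<Rightarrow> bool" where
  "chern_formula K Fs \<longleftrightarrow>
     p1 (rees 0 Fs) = std.power_sum1 K Fs \<and> p2 (rees 0 Fs) = std.power_sum2 K Fs"

text \<open>Both sides of the formula are additive, so two terms of a sequence determine the third.
  One form climbs to the middle term, the other descends to the quotient.\<close>

lemma chern_formula_exact:
  assumes "trifiltered_space std_scale K V' Fs'" "trifiltered_space std_scale K V Fs"
    "trifiltered_space std_scale K V'' Fs''" "std.tri_exact g Fs' Fs Fs''"
  shows "chern_formula K Fs' \<Longrightarrow> chern_formula K Fs'' \<Longrightarrow> chern_formula K Fs"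
    and "chern_formula K Fs' \<Longrightarrow> chern_formula K Fs \<Longrightarrow> chern_formula K Fs''"
proof -
  interpret A: trifiltered_space std_scale K V' Fs' by fact
  interpret B: trifiltered_space std_scale K V Fs by fact
  interpret C: trifiltered_space std_scale K V'' Fs'' by fact
  have "short_exact std_scale (rees 0 Fs') (rees 0 Fs) (rees 0 Fs'')"
    using std.short_exact_rees assms by blast
  note p = p_additive[OF A.vector_bundle_rees B.vector_bundle_rees C.vector_bundle_rees this]
    and n = std.tri_exact_power_sums[OF assms]
  show "chern_formula K Fs' \<Longrightarrow> chern_formula K Fs'' \<Longrightarrow> chern_formula K Fs"
    and "chern_formula K Fs' \<Longrightarrow> chern_formula K Fs \<Longrightarrow> chern_formula K Fs''"
    using p n by (auto simp: chern_formula_def)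
qed

end

lemma (in complex_space) lookup_smul_monomial:
  "Poly_Mapping.lookup (smul scl (Poly_Mapping.single m 1) x) b = Poly_Mapping.lookup x (b - m)"
proof (induction x rule: poly_mapping_add_induct)
  case (single c v)
  have "m + c = b \<longleftrightarrow> c = b - m" by (auto simp: algebra_simps)
  then show ?case by (simp add: smul_single_single lookup_single when_def)
qed (simp add: smul_add_right lookup_add)

section \<open>Lines and trifiltered spaces with a common adapted basis\<close>

context complex_space
begin

definition line_filt :: "'v \<Rightarrow> (3 \<Rightarrow> int) \<Rightarrow> 3 \<Rightarrow> int \<Rightarrow> 'v set" where
  "line_filt v a i p = (if p \<le> a i then span {v} else {0})"

lemma trifiltered_line:
  assumes "\<And>i. a i \<in> {-K..<K}"
  shows "trifiltered_space scl K (span {v}) (line_filt v a)"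
proof unfold_locales
  fix i
  have "- K \<le> a i" "a i < K" using assms[of i] by auto
  then show "filt K (span {v}) (line_filt v a i)"
    by (auto simp: filt_def line_filt_def span_zero)
qed (simp add: fin_dim_span)

lemma line_gr_dim: "v \<noteq> 0 \<Longrightarrow> gr_dim (line_filt v a) i p = (if p = a i then 1 else 0)"
  by (auto simp: gr_dim_def line_filt_def dim_singleton)

lemma line_gr_dim2:
  assumes "v \<noteq> 0"
  shows "gr_dim2 (line_filt v a) i j p q = (if p = a i then if q = a j then 1 else 0 else 0)"
proof -
  have "line_filt v a i p \<inter> line_filt v a j q = (if p \<le> a i \<and> q \<le> a j then span {v} else {0})" for p q
    by (auto simp: line_filt_def span_zero)
  then show ?thesis using assms by (auto simp: gr_dim2_def dim_singleton)
qed

text \<open>Splitting the square of the sum of the jumps into squares and mixed products explains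
  the shape of \<open>power_sum2\<close>: on a line \<open>gr_dim\<close> and \<open>gr_dim2\<close>
  merely pick out the jumps.\<close>

lemma line_power_sums:
  assumes "v \<noteq> 0" and a: "\<And>i. a i \<in> {-K..<K}"
  shows "power_sum1 K (line_filt v a) = (\<Sum>i\<in>UNIV. a i)"
    and "power_sum2 K (line_filt v a) = (\<Sum>i\<in>UNIV. a i)\<^sup>2"
proof -
  have gr: "(\<Sum>p\<in>{-K..<K}. f p * gr_dim (line_filt v a) i p) = f (a i)" for f i
    using a[of i] by (simp add: line_gr_dim[OF assms(1)] if_distrib cong: if_cong)
  have "(\<Sum>q\<in>{-K..<K}. p * q * gr_dim2 (line_filt v a) i j p q) =
      (if p = a i then p * a j else 0)" for p i j
  proof -
    have "(\<Sum>q\<in>{-K..<K}. p * q * gr_dim2 (line_filt v a) i j p q) =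
        (\<Sum>q\<in>{-K..<K}. if q = a j then if p = a i then p * a j else 0 else 0)"
      by (intro sum.cong) (auto simp: line_gr_dim2[OF assms(1)])
    then show ?thesis using a[of j] by simp
  qed
  then have gr2: "(\<Sum>p\<in>{-K..<K}. \<Sum>q\<in>{-K..<K}. p * q * gr_dim2 (line_filt v a) i j p q) = a i * a j" for i j
    using a[of i] by simp
  show "power_sum1 K (line_filt v a) = (\<Sum>i\<in>UNIV. a i)"
    unfolding power_sum1_def by (simp add: gr[of "\<lambda>p. p"])
  have "(\<Sum>i\<in>UNIV. a i)\<^sup>2 = (\<Sum>i\<in>UNIV. \<Sum>j\<in>UNIV. a i * a j)"
    by (simp add: power2_eq_square sum_product)
  also have "\<dots> = (\<Sum>i\<in>UNIV. (a i)\<^sup>2 + (\<Sum>j\<in>-{i}. a i * a j))"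
  proof (intro sum.cong refl)
    show "(\<Sum>j\<in>UNIV. a i * a j) = (a i)\<^sup>2 + (\<Sum>j\<in>-{i}. a i * a j)" for i
      using sum.remove[of UNIV i "\<lambda>j. a i * a j"] by (simp add: power2_eq_square Compl_eq_Diff_UNIV)
  qed
  finally show "power_sum2 K (line_filt v a) = (\<Sum>i\<in>UNIV. a i)\<^sup>2"
    unfolding power_sum2_def by (simp add: gr[of "\<lambda>p. p\<^sup>2"] gr2 sum.distrib)
qed

text \<open>All three filtrations are adapted to one basis, and the Rees bundle is a direct sum of
  line bundles.\<close>

definition basis_filt :: "'v set \<Rightarrow> ('v \<Rightarrow> 3 \<Rightarrow> int) \<Rightarrow> 3 \<Rightarrow> int \<Rightarrow> 'v set" where
  "basis_filt B A i p = span {v \<in> B. p \<le> A v i}"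

lemma trifiltered_basis:
  assumes "finite B" "\<And>v i. v \<in> B \<Longrightarrow> A v i \<in> {-K..<K}"
  shows "trifiltered_space scl K (span B) (basis_filt B A)"
proof unfold_locales
  fix i
  have A: "- K \<le> A v i" "A v i < K" if "v \<in> B" for v using assms(2)[OF that, of i] by auto
  have "basis_filt B A i q \<subseteq> basis_filt B A i p" if "p \<le> q" for p q
    unfolding basis_filt_def using that by (intro span_mono) auto
  moreover have "basis_filt B A i p = span B" if "p \<le> - K" for p
    unfolding basis_filt_def using A(1) that by (intro arg_cong[of _ _ span]) force
  moreover have "basis_filt B A i p = {0}" if "K \<le> p" for p
  proof -
    have "{v \<in> B. p \<le> A v i} = {}" using A(2) that by force
    then show ?thesis by (simp only: basis_filt_def span_empty)
  qed
  ultimately show "filt K (span B) (basis_filt B A i)"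
    by (auto simp: filt_def basis_filt_def)
qed (use assms in \<open>simp add: fin_dim_span\<close>)

lemma basis_filt_Int:
  "independent B \<Longrightarrow> basis_filt B A i p \<inter> basis_filt B A j q = span {v \<in> B. p \<le> A v i \<and> q \<le> A v j}"
  unfolding basis_filt_def by (subst span_Int_independent[of B]) (auto simp: Int_def conj_ac)

lemma basis_filt_singleton: "basis_filt {v} A = line_filt v (A v)"
proof (intro ext)
  fix i p
  have "{w \<in> {v}. p \<le> A w i} = (if p \<le> A v i then {v} else {})" by auto
  then show "basis_filt {v} A i p = line_filt v (A v) i p" by (simp add: basis_filt_def line_filt_def)
qed

text \<open>The projection that kills \<open>v\<close> and fixes \<open>B\<close> is compatible with
  all intersections, because each of them is spanned by part of the basis.\<close>

lemma basis_filt_split: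
  assumes "independent (insert v B)" "v \<notin> B"
  obtains g where "tri_exact g (line_filt v (A v)) (basis_filt (insert v B) A) (basis_filt B A)"
proof -
  interpret complex_space_pair scl scl ..
  obtain g where g: "Vector_Spaces.linear scl scl g"
    "\<forall>w\<in>insert v B. g w = (if w = v then 0 else w)"
    using linear_independent_extend[OF assms(1), of "\<lambda>w. if w = v then 0 else w"] by blast
  interpret g: Vector_Spaces.linear scl scl g by (rule g(1))
  have gv: "g v = 0" and gB: "\<And>w. w \<in> B \<Longrightarrow> g w = w" using g(2) assms(2) by auto
  have gspan: "g x = x" if "x \<in> span B" for x
    using linear_eq_on[OF g(1) linear_id that] gB by (simp add: id_def)
  have B: "independent B" and v: "independent {v}" using assms independent_mono by blast+
  have "tri_exact g (basis_filt {v} A) (basis_filt (insert v B) A) (basis_filt B A)"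
    unfolding tri_exact_def
  proof (intro conjI allI impI g(1))
    fix i j :: 3 and p q :: int
    define S where "S = {w \<in> B. p \<le> A w i \<and> q \<le> A w j}"
    have S: "S \<subseteq> B" by (auto simp: S_def)
    have ins: "{w \<in> insert v B. p \<le> A w i \<and> q \<le> A w j} = (if p \<le> A v i \<and> q \<le> A v j then insert v S else S)"
      and sing: "{w \<in> {v}. p \<le> A w i \<and> q \<le> A w j} = (if p \<le> A v i \<and> q \<le> A v j then {v} else {})"
      by (auto simp: S_def)
    have "g ` S = (\<lambda>x. x) ` S" using gB S by (intro image_cong) auto
    then have gS: "g ` S = S" by simp
    show "g ` (basis_filt (insert v B) A i p \<inter> basis_filt (insert v B) A j q) =
        basis_filt B A i p \<inter> basis_filt B A j q"
      unfolding basis_filt_Int[OF assms(1)] basis_filt_Int[OF B] ins S_def[symmetric]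
      by (auto simp: g.span_image[symmetric] gS gv simp del: image_iff)
    have "x \<in> span {v}" if x: "x \<in> span (insert v S)" "g x = 0" for x
    proof -
      obtain k where k: "x - scl k v \<in> span S" using x(1) by (auto simp: span_insert)
      then have "x - scl k v \<in> span B" using span_mono[OF S] by blast
      from gspan[OF this] have "x = scl k v" using x(2) by (simp add: g.diff g.scale gv)
      then show ?thesis by (simp add: span_scale span_base)
    qed
    moreover have "x = 0" if "x \<in> span S" "g x = 0" for x
      using gspan[of x] that span_mono[OF S] by auto
    moreover have "x \<in> span (insert v S) \<and> g x = 0" if "x \<in> span {v}" for x
      using that span_mono[of "{v}" "insert v S"] by (auto simp: span_singleton g.scale gv)
    ultimately show "basis_filt {v} A i p \<inter> basis_filt {v} A j q =
        {x \<in> basis_filt (insert v B) A i p \<inter> basis_filt (insert v B) A j q. g x = 0}"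
      unfolding basis_filt_Int[OF assms(1)] basis_filt_Int[OF v] ins sing
      by (auto simp: span_zero)
  qed
  then show ?thesis using that by (simp add: basis_filt_singleton)
qed

end

section \<open>Chern classes of line bundles, split bundles and elementary modifications\<close>

context chern
begin

text \<open>Multiplication by the monomial with exponents a_i moves all jumps to 0 and the degree
  from 0 to the sum of the a_i, so the bundle is O(d) for that sum.\<close>

lemma c_line:
  assumes v: "v \<noteq> 0" and a: "\<And>i. a i \<in> {-K..<K}"
  shows "c (rees 0 (std.line_filt v a)) = [:1, \<Sum>i\<in>UNIV. a i:]"
proof -
  \<comment> \<open>\<open>line_bundle\<close> uses the coordinate 0 of \<open>std\<close>, so the
    line has to be carried there before the monomial can act.\<close>
  define e :: std where "e = Poly_Mapping.single 0 1"
  have e: "e \<noteq> 0" by (simp add: e_def)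
  have span_e: "std.span {e} = {w. Poly_Mapping.keys w \<subseteq> {0}}"
  proof (intro equalityI subsetI)
    fix w assume "w \<in> std.span {e}"
    then show "w \<in> {w. Poly_Mapping.keys w \<subseteq> {0}}"
      by (auto simp: std.span_singleton in_keys_iff lookup_std_scale e_def lookup_one when_def split: if_splits)
  next
    fix w :: std assume "w \<in> {w. Poly_Mapping.keys w \<subseteq> {0}}"
    then have "w = std_scale (Poly_Mapping.lookup w 0) e"
      by (intro poly_mapping_eqI) (auto simp: lookup_std_scale e_def lookup_one when_def in_keys_iff)
    then show "w \<in> std.span {e}" unfolding std.span_singleton by blast
  qed
  let ?L = "std.line_filt e (\<lambda>i. 0)"
  interpret L: trifiltered_space std_scale 1 "std.span {e}" ?L
    by (rule std.trifiltered_line) simp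
  interpret M: trifiltered_space std_scale K "std.span {v}" "std.line_filt v a"
    by (rule std.trifiltered_line) (rule a)
  obtain g where g: "Vector_Spaces.linear std_scale std_scale g" "g v = e"
    using std_pair.linear_independent_extend[of "{v}" "\<lambda>_. e"] v by auto
  obtain g' where g': "Vector_Spaces.linear std_scale std_scale g'" "g' e = v"
    using std_pair.linear_independent_extend[of "{e}" "\<lambda>_. v"] e by auto
  interpret g: Vector_Spaces.linear std_scale std_scale g by (rule g)
  interpret g': Vector_Spaces.linear std_scale std_scale g' by (rule g')
  define d where "d = (\<Sum>i\<in>UNIV. a i)"
  define m :: "int ^ 3" where "m = (\<chi> i. a i)"
  have m: "total_degree m = d" by (simp add: m_def d_def total_degree_def)
  have line: "line_bundle d = rees d ?L"
  proof
    fix k :: 3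
    obtain i where i: "i \<noteq> k" using other_charts[of k] by metis
    have eq: "Poly_Mapping.lookup x b \<in> ?L l (- (b $ l)) \<longleftrightarrow>
        0 \<le> b $ l \<and> Poly_Mapping.keys (Poly_Mapping.lookup x b) \<subseteq> {0}"
      if "b \<in> Poly_Mapping.keys x" for x :: "std sections" and b l
      using that by (auto simp: std.line_filt_def span_e in_keys_iff)
    show "line_bundle d k = rees d ?L k"
      unfolding line_bundle_def rees_def
    proof (rule Collect_cong, rule ball_cong[OF refl])
      fix x :: "std sections" and b assume b: "b \<in> Poly_Mapping.keys x"
      show "total_degree b = d \<and> (\<forall>i. i \<noteq> k \<longrightarrow> 0 \<le> b $ i) \<and> Poly_Mapping.keys (Poly_Mapping.lookup x b) \<subseteq> {0} \<longleftrightarrow>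
          total_degree b = d \<and> (\<forall>i. i \<noteq> k \<longrightarrow> Poly_Mapping.lookup x b \<in> ?L i (- (b $ i)))"
        unfolding eq[OF b] using i by blast
    qed
  qed
  define \<psi> where "\<psi> x = smul std_scale (Poly_Mapping.single m 1) (Poly_Mapping.map g x)" for x
  define \<psi>' where "\<psi>' x = smul std_scale (Poly_Mapping.single (- m) 1) (Poly_Mapping.map g' x)" for x
  have lookup_\<psi>: "Poly_Mapping.lookup (\<psi> x) b = g (Poly_Mapping.lookup x (b - m))" for x b
    by (simp add: \<psi>_def std.lookup_smul_monomial lookup_map_zero)
  have lookup_\<psi>': "Poly_Mapping.lookup (\<psi>' x) b = g' (Poly_Mapping.lookup x (b + m))" for x b
    by (simp add: \<psi>'_def std.lookup_smul_monomial lookup_map_zero)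
  have gg': "g' (g x) = x" if "x \<in> std.span {v}" for x
    using that by (auto simp: std.span_singleton g.scale g'.scale g g')
  have g'g: "g (g' x) = x" if "x \<in> std.span {e}" for x
    using that by (auto simp: std.span_singleton g.scale g'.scale g g')
  have gL: "g x \<in> ?L i (- (b $ i))" if "x \<in> std.line_filt v a i (- ((b - m) $ i))" for x b i
    using that by (auto simp: std.line_filt_def m_def std.span_singleton g.scale g split: if_splits)
  have g'L: "g' x \<in> std.line_filt v a i (- (b $ i))" if "x \<in> ?L i (- ((b + m) $ i))" for x b i
    using that by (auto simp: std.line_filt_def m_def std.span_singleton g'.scale g' split: if_splits)
  have \<psi>_mem: "\<psi> x \<in> rees d ?L k" if x: "x \<in> rees 0 (std.line_filt v a) k" for x k
    unfolding rees_def
  proof (intro CollectI ballI)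
    fix b assume "b \<in> Poly_Mapping.keys (\<psi> x)"
    then have "b - m \<in> Poly_Mapping.keys x" by (auto simp: in_keys_iff lookup_\<psi>)
    with x have "total_degree (b - m) = 0"
      "\<forall>i. i \<noteq> k \<longrightarrow> Poly_Mapping.lookup x (b - m) \<in> std.line_filt v a i (- ((b - m) $ i))"
      unfolding rees_def by blast+
    then show "total_degree b = d \<and> (\<forall>i. i \<noteq> k \<longrightarrow> Poly_Mapping.lookup (\<psi> x) b \<in> ?L i (- (b $ i)))"
      using gL m by (auto simp: lookup_\<psi> total_degree_diff)
  qed
  have \<psi>'_mem: "\<psi>' x \<in> rees 0 (std.line_filt v a) k" if x: "x \<in> rees d ?L k" for x k
    unfolding rees_def
  proof (intro CollectI ballI)
    fix b assume "b \<in> Poly_Mapping.keys (\<psi>' x)"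
    then have "b + m \<in> Poly_Mapping.keys x" by (auto simp: in_keys_iff lookup_\<psi>')
    with x have "total_degree (b + m) = d"
      "\<forall>i. i \<noteq> k \<longrightarrow> Poly_Mapping.lookup x (b + m) \<in> ?L i (- ((b + m) $ i))"
      unfolding rees_def by blast+
    then show "total_degree b = 0 \<and>
        (\<forall>i. i \<noteq> k \<longrightarrow> Poly_Mapping.lookup (\<psi>' x) b \<in> std.line_filt v a i (- (b $ i)))"
      using g'L m by (auto simp: lookup_\<psi>' total_degree_add)
  qed
  have bij: "bij_betw \<psi> (rees 0 (std.line_filt v a) k) (rees d ?L k)" for k
  proof (rule bij_betw_byWitness[of _ \<psi>'])
    show "\<forall>x\<in>rees 0 (std.line_filt v a) k. \<psi>' (\<psi> x) = x"
    proof
      fix x assume "x \<in> rees 0 (std.line_filt v a) k"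
      then show "\<psi>' (\<psi> x) = x"
        by (intro poly_mapping_eqI) (simp add: lookup_\<psi> lookup_\<psi>' gg' M.rees_lookup_V)
    qed
    show "\<forall>x\<in>rees d ?L k. \<psi> (\<psi>' x) = x"
    proof
      fix x assume "x \<in> rees d ?L k"
      then show "\<psi> (\<psi>' x) = x"
        by (intro poly_mapping_eqI) (simp add: lookup_\<psi> lookup_\<psi>' g'g L.rees_lookup_V)
    qed
  qed (use \<psi>_mem \<psi>'_mem in auto)
  have hom: "bundle_hom std_scale std_scale (rees 0 (std.line_filt v a)) (rees d ?L) \<psi>"
    using \<psi>_mem
    by (auto simp: bundle_hom_def \<psi>_def std_pair.linear_map_add[OF g(1)] std_pair.linear_map_smul[OF g(1)]
        std.smul_add_right std.smul_assoc mult.commute)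
  have "c (rees 0 (std.line_filt v a)) = c (rees d ?L)"
    by (rule c_isomorphic[OF M.vector_bundle_rees L.vector_bundle_rees hom bij])
  then show ?thesis unfolding line[symmetric] c_line_bundle by (simp add: d_def)
qed

lemma chern_formula_line:
  assumes "v \<noteq> 0" "\<And>i. a i \<in> {-K..<K}"
  shows "chern_formula K (std.line_filt v a)"
  unfolding chern_formula_def p1_def p2_def c_line[OF assms]
  using std.line_power_sums[OF assms] by (simp add: numeral_2_eq_2)

lemma chern_formula_basis:
  assumes "finite B" "std.independent B" "\<And>v i. v \<in> B \<Longrightarrow> A v i \<in> {-K..<K}"
  shows "chern_formula K (std.basis_filt B A)"
  using assms
proof (induction B)
  case empty
  have "std.basis_filt {} A = (\<lambda>i p. {0})" by (intro ext) (simp add: std.basis_filt_def)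
  moreover have "rees 0 (\<lambda>i p. {0}) = (\<lambda>k. {0 :: std sections})"
    by (rule rees_zero)
  ultimately show ?case
    by (simp add: chern_formula_def p1_def p2_def c_zero std.power_sum1_def std.power_sum2_def
        std.gr_dim_def std.gr_dim2_def)
next
  case (insert v B)
  obtain g where g: "std.tri_exact g (std.line_filt v (A v)) (std.basis_filt (insert v B) A) (std.basis_filt B A)"
    using std.basis_filt_split[OF insert.prems(1) insert.hyps(2)] .
  have A: "A v i \<in> {-K..<K}" for i using insert.prems(2) by blast
  have B: "std.independent B" using insert.prems(1) std.independent_mono by blast
  have AB: "w \<in> B \<Longrightarrow> A w i \<in> {-K..<K}" for w i using insert.prems(2) by blast
  have v: "v \<noteq> 0" using insert.prems(1) std.dependent_zero by blast
  show ?case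
    by (rule chern_formula_exact(1)[OF std.trifiltered_line std.trifiltered_basis
          std.trifiltered_basis g chern_formula_line insert.IH])
      (use A AB B v insert in \<open>simp_all del: atLeastLessThan_iff\<close>)
qed

text \<open>Here F_0^m is shrunk to the kernel of \<open>l\<close>, and \<open>l\<close> identifies
  the quotient with a line. The fibre product \<open>P\<close> maps onto the given space with kernel
  a line, and onto a line with kernel the shrunken space; so the formula passes from the shrunken
  space to \<open>P\<close> and from there to the given one.\<close>

lemma chern_formula_step:
  assumes F: "trifiltered_space std_scale K V Fs"
    and m: "- K < m" "m < K" "Fs 0 m \<noteq> {0}" "\<And>p. m < p \<Longrightarrow> Fs 0 p = {0}"
    and l: "Vector_Spaces.linear std_scale (*) l" and w: "w \<in> Fs 0 m" "l w = 1"
    and F': "trifiltered_space std_scale K V (Fs(0 := (Fs 0)(m := {x \<in> Fs 0 m. l x = 0})))"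
      "chern_formula K (Fs(0 := (Fs 0)(m := {x \<in> Fs 0 m. l x = 0})))"
  shows "chern_formula K Fs"
proof -
  interpret F: trifiltered_space std_scale K V Fs by fact
  interpret l: Vector_Spaces.linear std_scale "(*)" l by (rule l)
  let ?S = "Fs 0 m"
  \<comment> \<open>The sum of \<open>V\<close> and the line through \<open>e\<close> holds pairs
    (x, z): below, \<open>\<pi>\<close> is the component x, \<open>\<epsilon>\<close> the scalar z,
    and \<open>\<rho>\<close> the vector z e.\<close>
  obtain e where e: "e \<notin> V" using std_outside[OF F.fin_dim] .
  obtain \<epsilon> where \<epsilon>: "Vector_Spaces.linear std_scale (*) \<epsilon>" "\<epsilon> e = 1" and \<epsilon>V: "\<And>x. x \<in> V \<Longrightarrow> \<epsilon> x = 0"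
    using std.separating_functional[OF F.Fs(6) e] by blast
  interpret \<epsilon>: Vector_Spaces.linear std_scale "(*)" \<epsilon> by (rule \<epsilon>(1))
  define \<rho> where "\<rho> y = std_scale (\<epsilon> y) e" for y
  define \<pi> where "\<pi> y = y - \<rho> y" for y
  have \<rho>: "Vector_Spaces.linear std_scale std_scale \<rho>"
    by unfold_locales (simp_all add: \<rho>_def \<epsilon>.add \<epsilon>.scale std.scale_left_distrib)
  have \<pi>: "Vector_Spaces.linear std_scale std_scale \<pi>"
    by unfold_locales
      (simp_all add: \<pi>_def \<rho>_def \<epsilon>.add \<epsilon>.scale std.scale_left_distrib std.scale_right_diff_distrib)
  interpret \<rho>: Vector_Spaces.linear std_scale std_scale \<rho> by (rule \<rho>)
  interpret \<pi>: Vector_Spaces.linear std_scale std_scale \<pi> by (rule \<pi>)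
  have e0: "e \<noteq> 0" using \<epsilon>(2) by auto
  have \<pi>V: "\<pi> x = x" if "x \<in> V" for x by (simp add: \<pi>_def \<rho>_def \<epsilon>V that)
  have \<pi>e: "\<pi> (std_scale z e) = 0" for z by (simp add: \<pi>_def \<rho>_def \<epsilon>.scale \<epsilon>(2))
  have \<epsilon>e: "\<epsilon> (std_scale z e) = z" for z by (simp add: \<epsilon>.scale \<epsilon>(2))
  have \<pi>0: "\<pi> y = 0 \<longleftrightarrow> y \<in> std.span {e}" for y
  proof
    assume "\<pi> y = 0"
    then have "y = std_scale (\<epsilon> y) e" by (simp add: \<pi>_def \<rho>_def)
    then show "y \<in> std.span {e}" unfolding std.span_singleton by blast
  qed (auto simp: std.span_singleton \<pi>e)
  have \<epsilon>0: "\<pi> y = y" if "\<epsilon> y = 0" for y using that by (simp add: \<pi>_def \<rho>_def)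
  have eq0: "y = 0" if "\<pi> y = 0" "\<epsilon> y = 0" for y using that \<epsilon>0 by simp

  \<comment> \<open>For i different from 0 the number found is the jump of the filtration that F_i
    induces on the quotient of F_0^m by the kernel of \<open>l\<close>: the last step on which
    \<open>l\<close> is still nonzero.\<close>
  have "\<exists>a. \<forall>i. a i \<in> {-K..<K} \<and> (i \<noteq> 0 \<longrightarrow> (\<forall>p. (\<exists>x\<in>Fs i p \<inter> ?S. l x \<noteq> 0) \<longleftrightarrow> p \<le> a i))"
  proof -
    have "\<exists>b. b \<in> {-K..<K} \<and> (i \<noteq> 0 \<longrightarrow> (\<forall>p. (\<exists>x\<in>Fs i p \<inter> ?S. l x \<noteq> 0) \<longleftrightarrow> p \<le> b))" for i
    proof (rule int_threshold[of "\<lambda>p. \<exists>x\<in>Fs i p \<inter> ?S. l x \<noteq> 0" "-K" K])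
      show "\<exists>x\<in>Fs i p \<inter> ?S. l x \<noteq> 0" if "p \<le> q" "\<exists>x\<in>Fs i q \<inter> ?S. l x \<noteq> 0" for p q
        using F.Fs(2)[OF that(1), of i] that(2) by blast
      show "\<exists>x\<in>Fs i (- K) \<inter> ?S. l x \<noteq> 0"
        using F.Fs(3)[of "-K" i] F.Fs(5)[of 0 m] w by (intro bexI[of _ w]) auto
      show "\<not> (\<exists>x\<in>Fs i K \<inter> ?S. l x \<noteq> 0)" using F.Fs(4)[of K i] by auto
    qed auto
    then show ?thesis by metis
  qed
  then obtain a0 where a0: "\<And>i. a0 i \<in> {-K..<K}"
    "\<And>i p. i \<noteq> 0 \<Longrightarrow> (\<exists>x\<in>Fs i p \<inter> ?S. l x \<noteq> 0) \<longleftrightarrow> p \<le> a0 i" by blast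
  \<comment> \<open>Jumps of the line bundle that maps onto the quotient sheaf (\<open>a\<close>)
    and of its kernel, its twist by -1 (\<open>a'\<close>). The assumption -K < m keeps m - 1 in
    range.\<close>
  define a where "a = a0(0 := m)"
  define a' where "a' = a0(0 := m - 1)"
  have a: "a i \<in> {-K..<K}" "a' i \<in> {-K..<K}" for i using a0(1) m by (auto simp: a_def a'_def)

  \<comment> \<open>The fibre product. Below step \<open>m\<close> of F_0 the scalar is free, at
    \<open>m\<close> it has to agree with \<open>l\<close> on the first component, and above
    \<open>m\<close> everything vanishes. For the other filtrations the scalar carries the jump a0
    i.\<close>
  define P where "P i p = (if i = 0
      then {y. \<pi> y \<in> Fs 0 p \<and> (p = m \<longrightarrow> \<epsilon> y = l (\<pi> y)) \<and> (m < p \<longrightarrow> \<epsilon> y = 0)}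
      else {y. \<pi> y \<in> Fs i p \<and> (p \<le> a0 i \<or> \<epsilon> y = 0)})" for i p
  have line: "y \<in> std.line_filt e b i p \<longleftrightarrow> \<pi> y = 0 \<and> (p \<le> b i \<or> \<epsilon> y = 0)" for y b i p
    using eq0[of y] \<pi>0[of y] \<pi>0[of 0] by (auto simp: std.line_filt_def)
  have Fs0: "0 \<in> Fs i p" for i p using std.subspace_0[OF F.Fs(1)] .

  interpret P: trifiltered_space std_scale K "{y. \<pi> y \<in> V}" P
  proof unfold_locales
    fix i
    have "std.subspace (P i p)" for p
    proof (rule std.subspaceI)
      show "0 \<in> P i p" using Fs0 by (simp add: P_def)
      show "x + y \<in> P i p" if "x \<in> P i p" "y \<in> P i p" for x y
        using that by (auto simp: P_def \<pi>.add \<epsilon>.add l.add intro: std.subspace_add F.Fs(1) split: if_splits)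
      show "std_scale z x \<in> P i p" if "x \<in> P i p" for z x
        using that by (auto simp: P_def \<pi>.scale \<epsilon>.scale l.scale intro: std.subspace_scale F.Fs(1) split: if_splits)
    qed
    moreover have "P i q \<subseteq> P i p" if pq: "p \<le> q" for p q
    proof
      fix y assume y: "y \<in> P i q"
      show "y \<in> P i p"
      \<comment> \<open>The critical inclusion: the condition on the scalar changes at
        \<open>m\<close>, but beyond \<open>m\<close> both components are zero.\<close>
      proof (cases "i = 0 \<and> p = m \<and> m < q")
        case True
        then have "\<pi> y = 0" "\<epsilon> y = 0" using y m(4)[of q] by (auto simp: P_def)
        then show ?thesis using True Fs0 by (simp add: P_def)
      next
        case False
        have "Fs i q \<subseteq> Fs i p" by (rule F.Fs(2)[OF pq])
        then show ?thesis using False y pq by (auto simp: P_def split: if_splits)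
      qed
    qed
    moreover have "P i p = {y. \<pi> y \<in> V}" if "p \<le> - K" for p
      using that m(1) a0(1)[of i] F.Fs(3)[OF that] by (auto simp: P_def)
    moreover have "P i p = {0}" if "K \<le> p" for p
      using that m(2) a0(1)[of i] F.Fs(4)[OF that] by (auto simp: P_def intro: eq0)
    ultimately show "std.filt K {y. \<pi> y \<in> V} (P i)" unfolding std.filt_def by blast
  next
    obtain T where T: "finite T" "V \<subseteq> std.span T" using F.fin_dim unfolding std.fin_dim_def by blast
    have "y \<in> std.span (insert e T)" if "\<pi> y \<in> V" for y
      using that T(2) by (auto simp: std.span_insert \<pi>_def \<rho>_def)
    then show "std.fin_dim {y. \<pi> y \<in> V}"
      using T(1) unfolding std.fin_dim_def by (intro exI[of _ "insert e T"]) auto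
  qed

  \<comment> \<open>Surjectivity onto the given space: \<open>x\<close> needs a scalar that suits
    both filtrations. Step \<open>m\<close> of F_0 forces z = l x, and the other filtration admits
    it by the choice of \<open>a0\<close>; in all other cases z = 0 works.\<close>
  have lift: "\<exists>z. (i = 0 \<longrightarrow> (p = m \<longrightarrow> z = l x) \<and> (m < p \<longrightarrow> z = 0)) \<and> (i \<noteq> 0 \<longrightarrow> p \<le> a0 i \<or> z = 0) \<and>
      (j = 0 \<longrightarrow> (q = m \<longrightarrow> z = l x) \<and> (m < q \<longrightarrow> z = 0)) \<and> (j \<noteq> 0 \<longrightarrow> q \<le> a0 j \<or> z = 0)"
    if "i \<noteq> j" "x \<in> Fs i p" "x \<in> Fs j q" for i j p q x
  proof (cases "(i = 0 \<and> p = m) \<or> (j = 0 \<and> q = m)")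
    case True
    have "q \<le> a0 j" if "i = 0" "p = m" "l x \<noteq> 0"
      using a0(2)[of j q] that \<open>i \<noteq> j\<close> \<open>x \<in> Fs i p\<close> \<open>x \<in> Fs j q\<close> by blast
    moreover have "p \<le> a0 i" if "j = 0" "q = m" "l x \<noteq> 0"
      using a0(2)[of i p] that \<open>i \<noteq> j\<close> \<open>x \<in> Fs i p\<close> \<open>x \<in> Fs j q\<close> by blast
    ultimately show ?thesis using True \<open>i \<noteq> j\<close> by (intro exI[of _ "l x"]) auto
  next
    case False
    then show ?thesis by (intro exI[of _ 0]) auto
  qed
  have exact_Fs: "std.tri_exact \<pi> (std.line_filt e a') P Fs"
    unfolding std.tri_exact_def
  proof (intro conjI allI impI \<pi>)
    fix i j :: 3 and p q :: int assume ij: "i \<noteq> j"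
    have "y \<in> std.line_filt e a' i p \<longleftrightarrow> y \<in> P i p \<and> \<pi> y = 0" for y i p
      unfolding line using Fs0[of i p] by (auto simp: P_def a'_def)
    then show "std.line_filt e a' i p \<inter> std.line_filt e a' j q = {x \<in> P i p \<inter> P j q. \<pi> x = 0}"
      by blast
    show "\<pi> ` (P i p \<inter> P j q) = Fs i p \<inter> Fs j q"
    proof (intro equalityI subsetI)
      fix x assume x: "x \<in> Fs i p \<inter> Fs j q"
      then have xV: "x \<in> V" using F.Fs(5) by blast
      obtain z where z: "(i = 0 \<longrightarrow> (p = m \<longrightarrow> z = l x) \<and> (m < p \<longrightarrow> z = 0)) \<and> (i \<noteq> 0 \<longrightarrow> p \<le> a0 i \<or> z = 0) \<and>
        (j = 0 \<longrightarrow> (q = m \<longrightarrow> z = l x) \<and> (m < q \<longrightarrow> z = 0)) \<and> (j \<noteq> 0 \<longrightarrow> q \<le> a0 j \<or> z = 0)"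
        using lift[OF ij, of x p q] x by blast
      define y where "y = x + std_scale z e"
      have y: "\<pi> y = x" "\<epsilon> y = z" by (simp_all add: y_def \<pi>.add \<epsilon>.add \<pi>V[OF xV] \<epsilon>V[OF xV] \<pi>e \<epsilon>e)
      have "y \<in> P i p \<inter> P j q" using x z y by (auto simp: P_def)
      then show "x \<in> \<pi> ` (P i p \<inter> P j q)" using y(1) by blast
    qed (auto simp: P_def split: if_splits)
  qed
  let ?F' = "Fs(0 := (Fs 0)(m := {x \<in> Fs 0 m. l x = 0}))"
  have exact_line: "std.tri_exact \<rho> ?F' P (std.line_filt e a)"
    unfolding std.tri_exact_def
  proof (intro conjI allI impI \<rho>)
    fix i j :: 3 and p q :: int assume ij: "i \<noteq> j"
    have \<rho>0: "\<rho> y = 0 \<longleftrightarrow> \<epsilon> y = 0" for y by (simp add: \<rho>_def e0)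
    have "y \<in> ?F' i p \<longleftrightarrow> y \<in> P i p \<and> \<rho> y = 0" for y i p
    proof
      assume y: "y \<in> ?F' i p"
      then have "y \<in> Fs i p" by (auto split: if_splits)
      then have "\<pi> y = y" "\<epsilon> y = 0" using F.Fs(5)[of i p] \<pi>V \<epsilon>V by auto
      then show "y \<in> P i p \<and> \<rho> y = 0" using y by (auto simp: P_def \<rho>0 split: if_splits)
    next
      assume y: "y \<in> P i p \<and> \<rho> y = 0"
      then have "\<epsilon> y = 0" "\<pi> y = y" using \<epsilon>0 by (auto simp: \<rho>0)
      then show "y \<in> ?F' i p" using y by (auto simp: P_def split: if_splits)
    qed
    then show "?F' i p \<inter> ?F' j q = {x \<in> P i p \<inter> P j q. \<rho> x = 0}" by blast
    have \<pi>\<rho>: "\<pi> (\<rho> y) = 0" "\<epsilon> (\<rho> y) = \<epsilon> y" for y by (simp_all add: \<rho>_def \<pi>e \<epsilon>e)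
    have lineP: "\<rho> y \<in> std.line_filt e a i p" if "y \<in> P i p" for y i p
      using that by (auto simp: P_def line a_def \<pi>\<rho> split: if_splits)
    \<comment> \<open>At step \<open>m\<close> of F_0 the scalar z must be a value of
      \<open>l\<close> on F_0^m intersected with F_j^q. The choice of \<open>a0\<close> gives a
      vector there with nonzero value, and it is rescaled. Elsewhere z e itself will do. The case j
      = 0 is obtained later by exchanging the indices.\<close>
    have surj: "\<exists>y. y \<in> P i p \<inter> P j q \<and> \<epsilon> y = z"
      if le: "i \<noteq> j" "p \<le> a i" "q \<le> a j" "j \<noteq> 0" for i j p q z
    proof (cases "i = 0 \<and> p = m")
      case True
      obtain x where x: "x \<in> Fs j q" "x \<in> ?S" "l x \<noteq> 0" using a0(2)[of j q] le by (auto simp: a_def)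
      define x' where "x' = std_scale (z / l x) x"
      have x': "x' \<in> Fs j q" "x' \<in> ?S" "l x' = z"
        using x by (auto simp: x'_def l.scale intro: std.subspace_scale F.Fs(1))
      then have xV: "x' \<in> V" using F.Fs(5) by blast
      define y where "y = x' + std_scale z e"
      have y: "\<pi> y = x'" "\<epsilon> y = z" by (simp_all add: y_def \<pi>.add \<epsilon>.add \<pi>V[OF xV] \<epsilon>V[OF xV] \<pi>e \<epsilon>e)
      have "y \<in> P i p \<inter> P j q" using x' y True that by (auto simp: P_def a_def)
      then show ?thesis using y by blast
    next
      case False
      then have "std_scale z e \<in> P i p \<inter> P j q"
        using le Fs0 by (auto simp: P_def a_def \<pi>e \<epsilon>e split: if_splits)
      then show ?thesis using \<epsilon>e by blast
    qed
    show "\<rho> ` (P i p \<inter> P j q) = std.line_filt e a i p \<inter> std.line_filt e a j q"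
    proof (intro equalityI subsetI)
      fix x assume x: "x \<in> std.line_filt e a i p \<inter> std.line_filt e a j q"
      then have x0: "\<pi> x = 0" by (simp add: line)
      then have x\<rho>: "x = \<rho> x" by (simp add: \<pi>_def)
      show "x \<in> \<rho> ` (P i p \<inter> P j q)"
      proof (cases "\<epsilon> x = 0")
        case True
        then have "x = 0" using x0 eq0 by blast
        then show ?thesis
          using std.subspace_0[OF P.Fs(1)] by (intro image_eqI[of _ _ 0]) (auto simp: \<rho>0)
      next
        case False
        then have "p \<le> a i" "q \<le> a j" using x by (auto simp: line)
        then obtain y where "y \<in> P i p \<inter> P j q" "\<epsilon> y = \<epsilon> x"
          using surj[of i j p q "\<epsilon> x"] surj[of j i q p "\<epsilon> x"] ij by (cases "j = 0") auto
        then show ?thesis using x\<rho> by (intro image_eqI[of _ _ y]) (auto simp: \<rho>_def)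
      qed
    qed (use lineP in blast)
  qed
  have "chern_formula K P"
    using chern_formula_exact(1)[OF F'(1) P.trifiltered_space_axioms std.trifiltered_line exact_line F'(2)
        chern_formula_line[OF e0]] a(1) by blast
  then show ?thesis
    using chern_formula_exact(2)[OF std.trifiltered_line P.trifiltered_space_axioms F exact_Fs
        chern_formula_line[OF e0]] a(2) by blast
qed

end

section \<open>The formula for every trifiltered subspace of finite dimension in the standard
  space\<close>

context chern
begin

text \<open>The measure leaves out the index -K, where F_0 is always all of \<open>V\<close>. Any
  nonzero step beyond -K can be shrunk, so the descent ends at a filtration whose only possible jump
  is -K.\<close>

theorem chern_formula:
  assumes "trifiltered_space std_scale K V Fs"
  shows "chern_formula K Fs"
  using assms
proof (induction "\<Sum>p\<in>{-K<..<K}. std.dim (Fs 0 p)" arbitrary: Fs rule: less_induct)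
  case less
  interpret F: trifiltered_space std_scale K V Fs by fact
  show ?case
  proof (cases "Fs 0 (- K + 1) = {0}")
    case True
    \<comment> \<open>As F_0 drops from \<open>V\<close> to 0 in one go, a basis adapted to the
      other two filtrations is adapted to all three.\<close>
    obtain i j :: 3 where ij: "i \<noteq> j" "\<And>l. l \<noteq> 0 \<longleftrightarrow> l = i \<or> l = j" using other_charts[of 0] by blast
    then have i0: "i \<noteq> 0" "j \<noteq> 0" by blast+
    obtain B P Q where B: "finite B" "std.independent B"
      "\<And>a b. Fs i a \<inter> Fs j b = std.span {v \<in> B. a \<le> P v \<and> b \<le> Q v}"
      "\<forall>v\<in>B. P v \<in> {-K..<K} \<and> Q v \<in> {-K..<K}"
      using std.adapted_basis[OF F.filt F.filt F.fin_dim, of i j] by blast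
    define A where "A v l = (if l = 0 then - K else if l = i then P v else Q v)" for v l
    have A: "A v l \<in> {-K..<K}" if "v \<in> B" for v l
      using B(4) that by (auto simp: A_def)
    have PQ: "- K \<le> P v" "- K \<le> Q v" if "v \<in> B" for v using B(4) that by auto
    have "Fs l p = std.basis_filt B A l p" for l p
    proof -
      consider "l = 0" "p \<le> - K" | "l = 0" "p > - K" | "l = i" | "l = j" using ij(2)[of l] by force
      then show ?thesis
      proof cases
        case 1
        have "{v \<in> B. - K \<le> P v \<and> - K \<le> Q v} = {v \<in> B. p \<le> A v l}"
          using PQ 1 by (auto simp: A_def)
        then show ?thesis using B(3)[of "-K" "-K"] 1 F.Fs(3)[of "-K"] F.Fs(3)[of p] by (simp add: std.basis_filt_def)
      next
        case 2
        have "Fs 0 p \<subseteq> Fs 0 (- K + 1)" using 2 by (intro F.Fs(2)) simp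
        then have "Fs 0 p = {0}" using True std.subspace_0[OF F.Fs(1), of 0 p] by auto
        moreover have "{v \<in> B. p \<le> A v 0} = {}" using 2 by (auto simp: A_def)
        ultimately show ?thesis using 2(1) by (simp only: std.basis_filt_def std.span_empty)
      next
        case 3
        have "{v \<in> B. p \<le> P v \<and> - K \<le> Q v} = {v \<in> B. p \<le> A v l}"
          using PQ 3 i0 by (auto simp: A_def)
        then show ?thesis using B(3)[of p "-K"] 3 F.Fs(3)[of "-K" j] F.Fs(5)[of i p]
          by (simp add: std.basis_filt_def Int_absorb2)
      next
        case 4
        have "{v \<in> B. - K \<le> P v \<and> p \<le> Q v} = {v \<in> B. p \<le> A v l}"
          using PQ 4 i0 ij(1) by (auto simp: A_def)
        then show ?thesis using B(3)[of "-K" p] 4 F.Fs(3)[of "-K" i] F.Fs(5)[of j p]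
          by (simp add: std.basis_filt_def Int_absorb1)
      qed
    qed
    then have "Fs = std.basis_filt B A" by (intro ext)
    then show ?thesis using chern_formula_basis[OF B(1,2) A] by simp
  next
    case False
    obtain m where m: "- K + 1 \<le> m" "m < K" "\<And>p. Fs 0 p \<noteq> {0} \<longleftrightarrow> p \<le> m"
    proof (rule int_threshold[of "\<lambda>p. Fs 0 p \<noteq> {0}" "- K + 1" K])
      show "Fs 0 p \<noteq> {0}" if "p \<le> q" "Fs 0 q \<noteq> {0}" for p q
        using F.Fs(2)[OF that(1), of 0] that(2) std.subspace_0[OF F.Fs(1), of 0 q] by auto
    qed (use False F.Fs(4)[of K 0] in auto)
    have Sm: "Fs 0 m \<noteq> {0}" using m(3) by blast
    then obtain w where w: "w \<in> Fs 0 m" "w \<notin> {0}" using std.subspace_0[OF F.Fs(1), of 0 m] by blast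
    obtain l where l: "Vector_Spaces.linear std_scale (*) l" "l w = 1"
      using std.separating_functional[OF std.subspace_single_0 w(2)] by blast
    interpret l: Vector_Spaces.linear std_scale "(*)" l by (rule l(1))
    define U where "U = {x \<in> Fs 0 m. l x = 0}"
    let ?F' = "Fs(0 := (Fs 0)(m := U))"
    have U: "std.subspace U"
      using std.subspace_inter[OF F.Fs(1) l.subspace_kernel, of 0 m] by (simp add: U_def Int_def)
    have "w \<notin> U" using l(2) by (simp add: U_def)
    then have US: "U \<subset> Fs 0 m" using w(1) unfolding U_def by blast
    have F': "trifiltered_space std_scale K V ?F'"
    proof unfold_locales
      fix i
      show "std.filt K V (?F' i)"
      proof (cases "i = 0")
        case True
        have mono: "((Fs 0)(m := U)) q \<subseteq> ((Fs 0)(m := U)) p" if pq: "p \<le> q" for p q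
        proof (cases "p = m \<and> q \<noteq> m")
          case True
          then have "Fs 0 q = {0}" using m(3)[of q] pq by auto
          then show ?thesis using True std.subspace_0[OF U] by simp
        next
          case False
          then show ?thesis using US F.Fs(2)[OF pq, of 0] by auto
        qed
        show ?thesis
          unfolding std.filt_def using True mono U F.Fs(1) F.Fs(3)[of _ 0] F.Fs(4)[of _ 0] m(1,2) by auto
      qed (simp add: F.filt)
    qed (rule F.fin_dim)
    have "(\<Sum>p\<in>{-K<..<K}. std.dim (?F' 0 p)) < (\<Sum>p\<in>{-K<..<K}. std.dim (Fs 0 p))"
    proof (rule sum_strict_mono_ex1)
      have "std.dim U < std.dim (Fs 0 m)"
        using std.dim_less_fin_dim[OF std.fin_dim_subset[OF F.fin_dim F.Fs(5)] F.Fs(1) U US] .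
      then show "\<forall>p\<in>{-K<..<K}. std.dim (?F' 0 p) \<le> std.dim (Fs 0 p)"
        "\<exists>p\<in>{-K<..<K}. std.dim (?F' 0 p) < std.dim (Fs 0 p)"
        using m(1,2) by (auto intro!: bexI[of _ m])
    qed simp
    then have IH: "chern_formula K ?F'" using less.hyps F' by blast
    have Km: "- K < m" using m(1) by simp
    have top: "Fs 0 p = {0}" if "m < p" for p using m(3)[of p] that by simp
    show ?thesis
      by (rule chern_formula_step[OF F.trifiltered_space_axioms Km m(2) Sm top l(1) w(1) l(2)])
        (use F' IH in \<open>simp_all add: U_def\<close>)
  qed
qed

end

section \<open>Transport to the standard coefficient space\<close>

context complex_space
begin

lemma std_embedding:
  assumes "finite B" "independent B" "span B = UNIV"
  obtains J J' where "Vector_Spaces.linear scl std_scale J" "Vector_Spaces.linear std_scale scl J'"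
    "\<And>x. J' (J x) = x"
proof -
  interpret J: complex_space_pair scl std_scale ..
  interpret J': complex_space_pair std_scale scl ..
  interpret complex_space_pair scl scl ..
  obtain h :: "nat \<Rightarrow> 'v" where h: "bij_betw h {..<card B} B"
    using ex_bij_betw_nat_finite[OF assms(1)] unfolding atLeast0LessThan by blast
  define n where "n b = the_inv_into {..<card B} h b" for b
  have n: "inj_on n B" unfolding n_def using h bij_betw_the_inv_into bij_betw_imp_inj_on by blast
  obtain J where J: "Vector_Spaces.linear scl std_scale J" "\<forall>b\<in>B. J b = Poly_Mapping.single (n b) 1"
    using J.linear_independent_extend[OF assms(2), of "\<lambda>b. Poly_Mapping.single (n b) 1"] by blast
  define J' where "J' v = (\<Sum>b\<in>B. scl (Poly_Mapping.lookup v (n b)) b)" for v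
  have J': "Vector_Spaces.linear std_scale scl J'"
    by unfold_locales
      (simp_all add: J'_def lookup_add lookup_std_scale scale_left_distrib sum.distrib scale_sum_right)
  have "J' (J b) = b" if "b \<in> B" for b
  proof -
    have "J' (J b) = (\<Sum>b'\<in>B. if b' = b then b else 0)"
      unfolding J'_def using J(2) that n
      by (intro sum.cong) (auto simp: lookup_single when_def inj_on_def)
    then show ?thesis using that assms(1) by simp
  qed
  then have "(J' \<circ> J) x = id x" for x
    using linear_eq_on[OF Vector_Spaces.linear_compose[OF J(1) J'] linear_id, of x B] assms(3) by simp
  then show ?thesis using that J(1) J' by simp
qed

end

context complex_space_pair
begin

lemma dim_image:
  assumes "Vector_Spaces.linear s1 s2 g" "inj g" "vs1.fin_dim S" "vs1.subspace S"
  shows "vs2.dim (g ` S) = vs1.dim S"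
proof -
  interpret g: Vector_Spaces.linear s1 s2 g by fact
  have "{x \<in> S. g x = 0} = {0}"
    using assms(2) vs1.subspace_0[OF assms(4)] g.inj_iff_eq_0 by auto
  then show ?thesis using rank_nullity_on[OF assms(1,3,4)] by simp
qed

lemma trifiltered_image:
  assumes "trifiltered_space s1 K V Fs" "Vector_Spaces.linear s1 s2 g"
  shows "trifiltered_space s2 K (g ` V) (\<lambda>i p. g ` Fs i p)"
proof -
  interpret F: trifiltered_space s1 K V Fs by fact
  interpret g: Vector_Spaces.linear s1 s2 g by fact
  show ?thesis
  proof unfold_locales
    fix i
    have "g ` Fs i q \<subseteq> g ` Fs i p" if "p \<le> q" for p q
      using F.Fs(2)[OF that] by (rule image_mono)
    then show "vs2.filt K (g ` V) (\<lambda>p. g ` Fs i p)"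
      unfolding vs2.filt_def
      using F.Fs(1)[of i] F.Fs(3)[of _ i] F.Fs(4)[of _ i] by (simp add: g.subspace_image)
  next
    obtain S where "finite S" "V \<subseteq> vs1.span S" using F.fin_dim unfolding vs1.fin_dim_def by blast
    then show "vs2.fin_dim (g ` V)"
      unfolding vs2.fin_dim_def by (intro exI[of _ "g ` S"]) (auto simp: g.span_image)
  qed
qed

lemma power_sums_image:
  assumes F: "trifiltered_space s1 K V Fs" and g: "Vector_Spaces.linear s1 s2 g" "inj g"
  shows "vs2.power_sum1 K (\<lambda>i p. g ` Fs i p) = vs1.power_sum1 K Fs"
    and "vs2.power_sum2 K (\<lambda>i p. g ` Fs i p) = vs1.power_sum2 K Fs"
proof -
  interpret F: trifiltered_space s1 K V Fs by fact
  have fd: "vs1.fin_dim (Fs i p)" for i p using vs1.fin_dim_subset[OF F.fin_dim F.Fs(5)] .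
  have d1: "vs2.dim (g ` Fs i p) = vs1.dim (Fs i p)" for i p
    by (rule dim_image[OF g fd F.Fs(1)])
  have d2: "vs2.dim (g ` Fs i p \<inter> g ` Fs j q) = vs1.dim (Fs i p \<inter> Fs j q)" for i j p q
    unfolding image_Int[OF g(2), symmetric]
    by (rule dim_image[OF g vs1.fin_dim_subset[OF fd] vs1.subspace_inter[OF F.Fs(1) F.Fs(1)]]) auto
  show "vs2.power_sum1 K (\<lambda>i p. g ` Fs i p) = vs1.power_sum1 K Fs"
    by (simp only: vs2.power_sum1_def vs1.power_sum1_def vs2.gr_dim_def vs1.gr_dim_def d1)
  show "vs2.power_sum2 K (\<lambda>i p. g ` Fs i p) = vs1.power_sum2 K Fs"
    by (simp only: vs2.power_sum2_def vs1.power_sum2_def vs2.gr_dim_def vs1.gr_dim_def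
        vs2.gr_dim2_def vs1.gr_dim2_def d1 d2)
qed

lemma bij_betw_rees_map:
  assumes "Vector_Spaces.linear s1 s2 g" "Vector_Spaces.linear s2 s1 g'" "\<And>x. g' (g x) = x"
  shows "bij_betw (Poly_Mapping.map g) (rees d Fs k) (rees d (\<lambda>i p. g ` Fs i p) k)"
    and "bij_betw (Poly_Mapping.map g') (rees d (\<lambda>i p. g ` Fs i p) k) (rees d Fs k)"
proof -
  interpret g: Vector_Spaces.linear s1 s2 g by fact
  interpret g': Vector_Spaces.linear s2 s1 g' by fact
  obtain i j :: 3 where "\<And>l. l \<noteq> k \<longleftrightarrow> l = i \<or> l = j" using other_charts[of k] by blast
  then have i: "i \<noteq> k" by blast
  have 1: "Poly_Mapping.map g x \<in> rees d (\<lambda>i p. g ` Fs i p) k" if x: "x \<in> rees d Fs k" for x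
  proof -
    have "Poly_Mapping.keys (Poly_Mapping.map g x) \<subseteq> Poly_Mapping.keys x"
      by (auto simp: in_keys_iff lookup_map_zero)
    then show ?thesis using x by (auto simp: rees_def lookup_map_zero)
  qed
  have gg': "g (g' (Poly_Mapping.lookup y a)) = Poly_Mapping.lookup y a"
    if "y \<in> rees d (\<lambda>i p. g ` Fs i p) k" for y a
  proof (cases "a \<in> Poly_Mapping.keys y")
    case True
    then have "Poly_Mapping.lookup y a \<in> g ` Fs i (- (a $ i))" using that i by (simp add: rees_def)
    then show ?thesis using assms(3) by auto
  qed (simp add: in_keys_iff)
  have 2: "Poly_Mapping.map g' y \<in> rees d Fs k" if y: "y \<in> rees d (\<lambda>i p. g ` Fs i p) k" for y
  proof -
    have "Poly_Mapping.keys (Poly_Mapping.map g' y) \<subseteq> Poly_Mapping.keys y"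
      by (auto simp: in_keys_iff lookup_map_zero)
    moreover have "g' v \<in> Fs i p" if "v \<in> g ` Fs i p" for v i p using that assms(3) by auto
    ultimately show ?thesis using y unfolding rees_def by (auto simp: lookup_map_zero)
  qed
  have 3: "\<forall>x\<in>rees d Fs k. Poly_Mapping.map g' (Poly_Mapping.map g x) = x"
    by (auto intro!: poly_mapping_eqI simp: lookup_map_zero assms(3))
  have 4: "\<forall>y\<in>rees d (\<lambda>i p. g ` Fs i p) k. Poly_Mapping.map g (Poly_Mapping.map g' y) = y"
    by (auto intro!: poly_mapping_eqI simp: lookup_map_zero gg')
  show "bij_betw (Poly_Mapping.map g) (rees d Fs k) (rees d (\<lambda>i p. g ` Fs i p) k)"
    by (rule bij_betw_byWitness[OF 3 4]) (use 1 2 in auto)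
  show "bij_betw (Poly_Mapping.map g') (rees d (\<lambda>i p. g ` Fs i p) k) (rees d Fs k)"
    by (rule bij_betw_byWitness[OF 4 3]) (use 1 2 in auto)
qed

text \<open>Morphisms are linear on torus sections only, so composing one with a coefficient map
  requires that the latter preserves them.\<close>

lemma torus_sections_map:
  assumes "Vector_Spaces.linear s1 s2 g" "Poly_Mapping.map g ` E 0 \<subseteq> E' 0"
    and "x \<in> torus_sections s1 E"
  shows "Poly_Mapping.map g x \<in> torus_sections s2 E'"
proof -
  interpret g: Vector_Spaces.linear s1 s2 g by fact
  obtain n f y where fy: "\<And>i. i < (n::nat) \<Longrightarrow> f i \<in> chart_ring UNIV \<and> y i \<in> E 0"
    and x: "x = (\<Sum>i<n. smul s1 (f i) (y i))"
    using assms(3) unfolding torus_sections_def chart_span_def by blast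
  have "Poly_Mapping.map g (sum h A) = (\<Sum>i\<in>A. Poly_Mapping.map g (h i))" for h :: "nat \<Rightarrow> 'v sections" and A
    by (rule poly_mapping_eqI) (simp add: lookup_map_zero lookup_sum g.sum)
  then have "Poly_Mapping.map g x = (\<Sum>i<n. smul s2 (f i) (Poly_Mapping.map g (y i)))"
    by (simp add: x linear_map_smul[OF assms(1)])
  then show ?thesis
    using fy assms(2) unfolding torus_sections_def chart_span_def
    by (intro CollectI exI[of _ n] exI[of _ f] exI[of _ "\<lambda>i. Poly_Mapping.map g (y i)"]) auto
qed

end

text \<open>The model is an arbitrary choice, but it is isomorphic to the image of the bundle under
  an embedding into \<open>std\<close>; there the formula holds, and dimensions are
  unchanged.\<close>

lemma (in chern) power_sums_std_model:
  assumes "trifiltered_space scl K UNIV Fs"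
  shows "p1 (std_model scl (rees 0 Fs)) = complex_space.power_sum1 scl K Fs"
    and "p2 (std_model scl (rees 0 Fs)) = complex_space.power_sum2 scl K Fs"
proof -
  interpret F: trifiltered_space scl K UNIV Fs by fact
  interpret J: complex_space_pair scl std_scale ..
  interpret J': complex_space_pair std_scale scl ..
  obtain B where "finite B" "F.independent B" "F.span B = UNIV"
    using F.fin_dim_basis[OF F.fin_dim F.subspace_UNIV] by blast
  then obtain J J' where J: "Vector_Spaces.linear scl std_scale J"
    and J': "Vector_Spaces.linear std_scale scl J'" and JJ': "\<And>x. J' (J x) = x"
    using F.std_embedding[of B] by blast
  let ?E = "rees 0 Fs" and ?G = "\<lambda>i p. J ` Fs i p"
  have inj: "inj J" using JJ' by (metis injI)
  interpret G: trifiltered_space std_scale K "J ` UNIV" ?G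
    by (rule J.trifiltered_image[OF assms J])
  note bij = J.bij_betw_rees_map[OF J J' JJ', of 0 Fs]
  have hom: "bundle_hom scl std_scale ?E (rees 0 ?G) (Poly_Mapping.map J)"
    using bij(1) by (intro J.bundle_hom_map[OF J]) (simp add: bij_betw_def)
  let ?M = "std_model scl ?E"
  have "(\<exists>r. vector_bundle std_scale r ?M) \<and> bundle_isomorphic scl std_scale ?E ?M"
    unfolding std_model_def
    by (rule someI[of _ "rees 0 ?G"])
      (use G.vector_bundle_rees hom bij(1) in \<open>auto simp: bundle_isomorphic_def\<close>)
  then obtain r \<phi> where M: "vector_bundle std_scale r ?M"
    and \<phi>: "bundle_hom scl std_scale ?E ?M \<phi>" "\<And>k. bij_betw \<phi> (?E k) (?M k)"
    unfolding bundle_isomorphic_def by blast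
  have tor: "Poly_Mapping.map J' x \<in> torus_sections scl ?E" if "x \<in> torus_sections std_scale (rees 0 ?G)" for x
    by (rule J'.torus_sections_map[OF J' _ that]) (use bij(2) in \<open>simp add: bij_betw_def\<close>)
  \<comment> \<open>The way back through the original bundle compares the image bundle with the
    chosen model, now both over \<open>std\<close>, where isomorphism invariance is
    available.\<close>
  have bij': "bij_betw (\<phi> \<circ> Poly_Mapping.map J') (rees 0 ?G k) (?M k)" for k
    by (rule bij_betw_trans[OF bij(2) \<phi>(2)])
  have "bundle_hom std_scale std_scale (rees 0 ?G) ?M (\<phi> \<circ> Poly_Mapping.map J')"
    using \<phi>(1) tor bij' unfolding bundle_hom_def bij_betw_def
    by (simp add: J'.linear_map_add[OF J'] J'.linear_map_smul[OF J'])
  from c_isomorphic[OF G.vector_bundle_rees M this bij'] have "c ?M = c (rees 0 ?G)" by simp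
  then have "p1 ?M = p1 (rees 0 ?G)" "p2 ?M = p2 (rees 0 ?G)" by (simp_all add: p1_def p2_def)
  moreover have "chern_formula K ?G" by (rule chern_formula[OF G.trifiltered_space_axioms])
  ultimately show "p1 ?M = complex_space.power_sum1 scl K Fs" "p2 ?M = complex_space.power_sum2 scl K Fs"
    using J.power_sums_image[OF assms J inj] by (simp_all add: chern_formula_def)
qed

section \<open>Mixed Hodge structures\<close>

lemma sum_telescope_int:
  fixes f :: "int \<Rightarrow> int"
  assumes "a \<le> b"
  shows "(\<Sum>p\<in>{a..<b}. f p - f (p + 1)) = f a - f b"
  using assms
proof (induction b rule: int_ge_induct)
  case (step b)
  have "{a..<b + 1} = insert b {a..<b}" using step.hyps by auto
  then show ?case using step.IH by simp
qed simp

context trifiltered_space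
begin

lemma gr_dim2_commute: "gr_dim2 Fs i j p q = gr_dim2 Fs j i q p"
  by (simp add: gr_dim2_def Int_commute)

lemma gr_dim2_outside:
  assumes "i \<noteq> j" "p \<notin> {-K..<K}"
  shows "gr_dim2 Fs i j p q = 0"
proof -
  have "Fs i p = Fs i (p + 1)" using assms(2) Fs(3,4)[of _ i] by (cases "p < -K") auto
  then show ?thesis by (simp add: gr_dim2_def)
qed

text \<open>The sum telescopes from step -K of the second filtration, the whole space, down to step
  \<open>K\<close>, which is zero.\<close>

lemma sum_gr_dim2:
  assumes "0 \<le> K"
  shows "(\<Sum>q\<in>{-K..<K}. gr_dim2 Fs i j p q) = gr_dim Fs i p"
proof -
  have "(\<Sum>q\<in>{-K..<K}. gr_dim2 Fs i j p q) =
     (int (dim (Fs i p \<inter> Fs j (-K))) - int (dim (Fs i (p + 1) \<inter> Fs j (-K)))) -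
     (int (dim (Fs i p \<inter> Fs j K)) - int (dim (Fs i (p + 1) \<inter> Fs j K)))"
    unfolding gr_dim2_def using assms by (intro sum_telescope_int) simp
  moreover have "Fs i p \<inter> Fs j (-K) = Fs i p" for p
    using Fs(3)[of "-K" j] Fs(5)[of i p] by auto
  moreover have "Fs i p \<inter> Fs j K = {0}" for p
    using Fs(4)[of K j] subspace_0[OF Fs(1), of i p] by auto
  ultimately show ?thesis by (simp add: gr_dim_def)
qed

end

section \<open>Opposed filtrations on a subquotient\<close>

context complex_space
begin

lemma sum_sets_mem: "a \<in> A \<Longrightarrow> b \<in> B \<Longrightarrow> a + b \<in> sum_sets A B"
  by (auto simp: sum_sets_def)

lemma sum_sets_mono: "A \<subseteq> A' \<Longrightarrow> sum_sets A B \<subseteq> sum_sets A' B"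
  unfolding sum_sets_def by blast

lemma sum_sets_upper:
  assumes "subspace B"
  shows "A \<subseteq> sum_sets A B"
proof
  show "x \<in> sum_sets A B" if "x \<in> A" for x
    using sum_sets_mem[OF that subspace_0[OF assms]] by simp
qed

lemma sum_sets_upper2:
  assumes "subspace A"
  shows "B \<subseteq> sum_sets A B"
proof
  show "x \<in> sum_sets A B" if "x \<in> B" for x
    using sum_sets_mem[OF subspace_0[OF assms] that] by simp
qed

lemma sum_sets_least: "subspace C \<Longrightarrow> A \<subseteq> C \<Longrightarrow> B \<subseteq> C \<Longrightarrow> sum_sets A B \<subseteq> C"
  by (auto simp: sum_sets_def intro: subspace_add)

text \<open>Since \<open>F\<close> and \<open>G\<close> are \<open>n\<close>-opposed on \<open>A/B\<close>, the graded piece of bidegree \<open>(p, q)\<close> with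
  \<open>p + q = n\<close> is all of the graded piece of degree \<open>p\<close>, and dually of degree \<open>q\<close>.\<close>

lemma pure_dims:
  assumes fd: "fin_dim A" and AB: "subspace A" "subspace B" "B \<subseteq> A"
    and F: "\<And>p. subspace (F p)" "\<And>p. F (p + 1) \<subseteq> F p" and G: "\<And>p. subspace (G p)"
    and pure: "pure_on F G n (A, B)" and n: "p + q = n"
  defines "X \<equiv> induced_step F (A, B)" and "Y \<equiv> induced_step G (A, B)"
  shows "int (subquotient_dim scl (Gr G q (Gr F p (A, B)))) = int (dim (X p)) - int (dim (X (p + 1)))"
    and "int (dim (X p)) - int (dim (X (p + 1))) = int (dim (Y q)) - int (dim (Y (q + 1)))"
proof -
  have X: "X p = sum_sets (F p \<inter> A) B" and Y: "Y p = sum_sets (G p \<inter> A) B" for p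
    by (simp_all add: X_def Y_def induced_step_def)
  have subX: "subspace (X p)" and subY: "subspace (Y p)" for p
    unfolding X Y using AB F(1) G by (auto intro!: subspace_sum_sets subspace_inter)
  have BX: "B \<subseteq> X p" for p unfolding X using AB F(1) by (intro sum_sets_upper2 subspace_inter)
  have XA: "X p \<subseteq> A" for p unfolding X using AB by (intro sum_sets_least) auto
  have YA: "Y p \<subseteq> A" for p unfolding Y using AB by (intro sum_sets_least) auto
  have GY: "G p \<inter> A \<subseteq> Y p" for p unfolding Y using AB by (intro sum_sets_upper)
  have Xmono: "X (p + 1) \<subseteq> X p" for p
    unfolding X using F(2)[of p] by (intro sum_sets_mono) blast
  have opp: "sum_sets (X p') (Y q') = A" "X p' \<inter> Y q' = B" if "p' + q' = n + 1" for p' q'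
    using pure that unfolding pure_on_def X_def Y_def by simp_all
  \<comment> \<open>The indices p + 1 and q add up to n + 1, so X (p + 1) and Y q span
    \<open>A\<close>; for \<open>x\<close> in X p the part from G q is a difference of elements of X
    p.\<close>
  have 1: "sum_sets (G q \<inter> X p) (X (p + 1)) = X p"
  proof (intro equalityI sum_sets_least subX Xmono subsetI)
    fix x assume x: "x \<in> X p"
    then have "x \<in> sum_sets (X (p + 1)) (Y q)" using opp(1)[of "p + 1" q] n XA by auto
    then obtain x' g b where d: "x = x' + (g + b)" "x' \<in> X (p + 1)" "g \<in> G q \<inter> A" "b \<in> B"
      unfolding Y sum_sets_def by blast
    have xb: "x' + b \<in> X (p + 1)" using d BX subX by (blast intro: subspace_add)
    have "g = x - (x' + b)" using d by simp
    then have "g \<in> X p" using x xb Xmono subX by (blast intro: subspace_diff)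
    then have "g + (x' + b) \<in> sum_sets (G q \<inter> X p) (X (p + 1))" using d xb by (intro sum_sets_mem) auto
    then show "x \<in> sum_sets (G q \<inter> X p) (X (p + 1))" using d by (simp add: add_ac)
  qed auto
  \<comment> \<open>Now p and q + 1 add up to n + 1, so X p meets Y (q + 1) in \<open>B\<close>
    alone and nothing new is contributed.\<close>
  have 2: "sum_sets (G (q + 1) \<inter> X p) (X (p + 1)) = X (p + 1)"
  proof (intro equalityI sum_sets_least subX sum_sets_upper2)
    have "G (q + 1) \<inter> X p \<subseteq> X p \<inter> Y (q + 1)" using GY XA by blast
    also have "\<dots> = B" using opp(2)[of p "q + 1"] n by simp
    finally show "G (q + 1) \<inter> X p \<subseteq> X (p + 1)" using BX by blast
  qed (auto intro: subspace_inter G subX)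
  have Gr: "Gr G q (Gr F p (A, B)) = (X p, X (p + 1))"
    by (simp add: Gr_def X_def[symmetric] induced_step_def[of G] 1 2)
  have fdX: "fin_dim (X p)" and fdY: "fin_dim (Y p)" for p
    using fin_dim_subset[OF fd] XA YA by auto
  have "dim (X (p + 1)) \<le> dim (X p)" by (rule dim_mono_fin_dim[OF fdX subX subX Xmono])
  then show "int (subquotient_dim scl (Gr G q (Gr F p (A, B)))) = int (dim (X p)) - int (dim (X (p + 1)))"
    unfolding Gr subquotient_dim_def by simp
  \<comment> \<open>Both pairs (p + 1, q) and (p, q + 1) satisfy this; the difference of the two
    equations is the claim.\<close>
  have "dim A + dim B = dim (X p') + dim (Y q')" if "p' + q' = n + 1" for p' q'
    using dim_sum_sets[OF fdX fdY subX subY, of p' q'] opp[OF that] by simp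
  from this[of "p + 1" q] this[of p "q + 1"] n
  show "int (dim (X p)) - int (dim (X (p + 1))) = int (dim (Y q)) - int (dim (Y (q + 1)))"
    by simp
qed

lemma dim_induced_step:
  assumes fd: "fin_dim A" and AB: "subspace A" "subspace B" "B \<subseteq> A" and F: "subspace (F p)"
  shows "int (dim (induced_step F (A, B) p)) = int (dim (F p \<inter> A)) - int (dim (F p \<inter> B)) + int (dim B)"
proof -
  have "F p \<inter> A \<inter> B = F p \<inter> B" using AB by auto
  then show ?thesis
    using dim_sum_sets[of "F p \<inter> A" B] assms
    by (simp add: induced_step_def fin_dim_subset[OF fd] subspace_inter)
qed

end

section \<open>Complex conjugation with respect to a rational form\<close>

lemma cnj_of_rat: "cnj (of_rat r) = of_rat r"
  by (cases r) (simp add: of_rat_rat)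

text \<open>Conjugating coordinates in a rational basis gives an antilinear involution that fixes
  \<open>HQ\<close>, as rational scalars are real. An antilinear map is determined by its values on
  that basis, so the definite description is met.\<close>

lemma (in complex_space) conjugation_exists:
  assumes "rational_form scl HQ"
  shows "conjugation scl HQ (x + y) = conjugation scl HQ x + conjugation scl HQ y"
    and "conjugation scl HQ (scl z x) = scl (cnj z) (conjugation scl HQ x)"
    and "conjugation scl HQ (conjugation scl HQ x) = x"
    and "span HQ = UNIV" "fin_dim UNIV"
proof -
  obtain B where B: "finite B" "independent B" "span B = UNIV" "HQ = module.span (rat_scale scl) B"
    using assms unfolding rational_form_def by blast
  interpret Q: vector_space "rat_scale scl"
    by unfold_locales (simp_all add: rat_scale_def scale_right_distrib scale_left_distrib of_rat_add of_rat_mult)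
  define R where "R = representation B"
  define \<kappa> where "\<kappa> x = (\<Sum>b\<in>B. scl (cnj (R x b)) b)" for x
  have R: "(\<Sum>b\<in>B. scl (R x b) b) = x" for x
    unfolding R_def by (rule sum_representation_eq) (use B in auto)
  have R_add: "R (x + y) b = R x b + R y b" and R_scale: "R (scl z x) b = z * R x b" for x y z b
    using B by (simp_all add: R_def representation_add representation_scale)
  have add: "\<kappa> (x + y) = \<kappa> x + \<kappa> y" for x y
    by (simp add: \<kappa>_def R_add scale_left_distrib sum.distrib)
  have scale: "\<kappa> (scl z x) = scl (cnj z) (\<kappa> x)" for z x
    by (simp add: \<kappa>_def R_scale scale_sum_right)
  have \<kappa>B: "\<kappa> b = b" if "b \<in> B" for b
  proof -
    have "\<kappa> b = (\<Sum>b'\<in>B. if b' = b then b else 0)"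
      unfolding \<kappa>_def R_def using that B by (intro sum.cong) (auto simp: representation_basis)
    then show ?thesis using that B(1) by simp
  qed
  have \<kappa>sum: "\<kappa> (sum h A) = (\<Sum>a\<in>A. \<kappa> (h a))" for h and A :: "'v set"
  proof -
    have "\<kappa> 0 = 0" using add[of 0 0] by simp
    then show ?thesis by (induction A rule: infinite_finite_induct) (simp_all add: add)
  qed
  have BH: "B \<subseteq> HQ" using Q.span_superset[of B] B(4) by simp
  have "Q.subspace {x. \<kappa> x = x}"
    unfolding Q.subspace_def using add[of 0 0] by (simp add: add scale rat_scale_def cnj_of_rat)
  then have fixed: "\<kappa> x = x" if "x \<in> HQ" for x
    using Q.span_minimal[of B "{x. \<kappa> x = x}"] that \<kappa>B unfolding B(4) by auto
  have conj: "conjugation scl HQ = \<kappa>"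
    unfolding conjugation_def
  proof (rule the_equality)
    fix k assume k: "(\<forall>x y. k (x + y) = k x + k y) \<and> (\<forall>z x. k (scl z x) = scl (cnj z) (k x)) \<and> (\<forall>x\<in>HQ. k x = x)"
    have "k 0 + k 0 = k 0" using k by (metis add_0)
    then have "k 0 = 0" by simp
    then have ksum: "k (sum h A) = (\<Sum>a\<in>A. k (h a))" for h and A :: "'v set"
      by (induction A rule: infinite_finite_induct) (use k in simp_all)
    show "k = \<kappa>"
    proof
      fix x
      have "k x = (\<Sum>b\<in>B. k (scl (R x b) b))" using ksum R by metis
      also have "\<dots> = \<kappa> x" unfolding \<kappa>_def using k BH by (intro sum.cong) auto
      finally show "k x = \<kappa> x" .
    qed
  qed (use add scale fixed in blast)
  show "conjugation scl HQ (x + y) = conjugation scl HQ x + conjugation scl HQ y"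
    "conjugation scl HQ (scl z x) = scl (cnj z) (conjugation scl HQ x)"
    by (simp_all add: conj add scale)
  have "\<kappa> (\<kappa> x) = (\<Sum>b\<in>B. scl (R x b) b)"
    by (simp add: \<kappa>_def[of x] \<kappa>sum scale \<kappa>B)
  then show "conjugation scl HQ (conjugation scl HQ x) = x" by (simp add: conj R)
  show "span HQ = UNIV" using span_mono[OF BH] B(3) by auto
  show "fin_dim UNIV" using B unfolding fin_dim_def by blast
qed

sublocale mixed_hodge_structure \<subseteq> complex_space scl ..

section \<open>The three filtrations of a mixed Hodge structure\<close>

context mixed_hodge_structure
begin

abbreviation "Wd \<equiv> weight_dec scl W"
abbreviation "Fc \<equiv> conj_filtration scl HQ F"

definition filtrations :: "3 \<Rightarrow> int \<Rightarrow> 'v set" where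
  "filtrations i = (if i = 0 then Wd else if i = 1 then F else Fc)"

lemma filtrations_simps: "filtrations 0 = Wd" "filtrations 1 = F" "filtrations 2 = Fc"
  by (simp_all add: filtrations_def)

lemma hodge_rees_bundle: "hodge_rees_bundle scl HQ W F = rees 0 filtrations"
  by (simp add: hodge_rees_bundle_def rees_0 filtrations_def[abs_def])

lemma filt_exists:
  obtains K where "0 \<le> K" "trifiltered_space scl K UNIV filtrations"
proof -
  note \<kappa> = conjugation_exists[OF rational_form]
  let ?\<kappa> = "conjugation scl HQ"
  have F: "subspace (F p)" "p \<le> q \<Longrightarrow> F q \<subseteq> F p" "\<exists>p. F p = UNIV" "\<exists>q. F q = {0}" for p q
    using F_filtration unfolding finite_decreasing_filtration_def by auto
  obtain p0 q0 where pq: "F p0 = UNIV" "F q0 = {0}" using F(3,4) by blast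
  obtain m n where mn: "W m = {0}" "W n = HQ" using W_separated W_exhaustive by blast
  \<comment> \<open>Any common bound will do; a symmetric one also survives the sign change in the
    weight filtration.\<close>
  define K where "K = \<bar>p0\<bar> + \<bar>q0\<bar> + \<bar>m\<bar> + \<bar>n\<bar>"
  have K: "-K \<le> p0" "q0 \<le> K" "n \<le> K" "-K \<le> m" "0 \<le> K" unfolding K_def by linarith+
  have \<kappa>0: "?\<kappa> 0 = 0" using \<kappa>(1)[of 0 0] by simp
  have F1: "filt K UNIV F"
    unfolding filt_def
  proof (intro conjI allI impI F(1,2))
    show "F p = UNIV" if "p \<le> -K" for p using F(2)[of p p0] that K pq by auto
    show "F p = {0}" if "K \<le> p" for p using F(2)[of q0 p] that K pq subspace_0[OF F(1)] by auto
  qed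
  have F2: "filt K UNIV Fc"
    unfolding filt_def
  proof (intro conjI allI impI)
    show "subspace (Fc p)" for p
    proof (rule subspaceI)
      have "?\<kappa> 0 \<in> Fc p" unfolding conj_filtration_def by (intro imageI subspace_0 F(1))
      then show "0 \<in> Fc p" by (simp add: \<kappa>0)
      fix x assume "x \<in> Fc p"
      then obtain x' where x: "x = ?\<kappa> x'" "x' \<in> F p" unfolding conj_filtration_def by blast
      have "?\<kappa> (scl (cnj z) x') \<in> Fc p" for z
        unfolding conj_filtration_def by (intro imageI subspace_scale F(1) x)
      then show "scl z x \<in> Fc p" for z by (simp add: \<kappa>(2) x(1))
      fix y assume "y \<in> Fc p"
      then obtain y' where y: "y = ?\<kappa> y'" "y' \<in> F p" unfolding conj_filtration_def by blast
      have "?\<kappa> (x' + y') \<in> Fc p"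
        unfolding conj_filtration_def by (intro imageI subspace_add F(1) x y)
      then show "x + y \<in> Fc p" by (simp add: \<kappa>(1) x(1) y(1))
    qed
    show "Fc q \<subseteq> Fc p" if "p \<le> q" for p q
      unfolding conj_filtration_def using F(2)[OF that] by (rule image_mono)
    show "Fc p = UNIV" if "p \<le> -K" for p
    proof -
      have "F p = UNIV" using F1 that by (rule filtD)
      moreover have "surj ?\<kappa>" using \<kappa>(3) by (metis surjI)
      ultimately show ?thesis by (simp add: conj_filtration_def)
    qed
    show "Fc p = {0}" if "K \<le> p" for p
      using filtD(4)[OF F1 that] \<kappa>0 by (simp add: conj_filtration_def)
  qed
  have F0: "filt K UNIV Wd"
    unfolding filt_def weight_dec_def
  proof (intro conjI allI impI subspace_span)
    show "span (W (- q)) \<subseteq> span (W (- p))" if "p \<le> q" for p q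
      using that by (intro span_mono W_mono) simp
    show "span (W (- p)) = UNIV" if "p \<le> -K" for p
    proof -
      have "HQ \<subseteq> W (- p)" using W_mono[of n "- p"] mn that K by auto
      then show ?thesis using span_mono[of HQ "W (- p)"] \<kappa>(4) by auto
    qed
    show "span (W (- p)) = {0}" if "K \<le> p" for p
    proof -
      have "W (- p) \<subseteq> {0}" using W_mono[of "- p" m] mn that K by auto
      then show ?thesis using span_minimal[of "W (- p)" "{0}"] span_zero by fastforce
    qed
  qed
  have "trifiltered_space scl K UNIV filtrations"
    by unfold_locales (use F0 F1 F2 \<kappa>(5) in \<open>auto simp: filtrations_def\<close>)
  then show ?thesis using that K by blast
qed

text \<open>By purity the Hodge number of bidegree (p, q) can be read off from W with F or from W
  with the conjugate of F. Both readings are needed, one for each mixed term with W. The weight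
  index is -(p + q) because \<open>weight_dec\<close> reverses the sign.\<close>

lemma hodge_numbers:
  assumes "trifiltered_space scl K UNIV filtrations"
  shows "int (hodge_t scl HQ F p q) = gr_dim2 filtrations 1 2 p q"
    and "int (hodge_h scl HQ W F p q) = gr_dim2 filtrations 1 0 p (- (p + q))"
    and "int (hodge_h scl HQ W F p q) = gr_dim2 filtrations 2 0 q (- (p + q))"
proof -
  interpret T: trifiltered_space scl K UNIV filtrations by fact
  have F: "subspace (F p)" "F (p + 1) \<subseteq> F p" and Fc: "subspace (Fc p)" "Fc (p + 1) \<subseteq> Fc p"
    and Wd: "subspace (Wd p)" for p
    using T.Fs(1)[of 1 p] T.Fs(1)[of 2 p] T.Fs(1)[of 0 p] T.Fs(2)[of p "p + 1" 1] T.Fs(2)[of p "p + 1" 2]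
    by (simp_all add: filtrations_simps)
  have fd: "fin_dim A" for A using T.fin_dim by (rule fin_dim_subset) simp
  have sum0: "sum_sets A {0} = A" for A by (simp add: sum_sets_def)
  have t: "Gr Fc q (Gr F p (UNIV, {0})) =
      (sum_sets (Fc q \<inter> F p) (F (p + 1)), sum_sets (Fc (q + 1) \<inter> F p) (F (p + 1)))"
    by (simp add: Gr_def induced_step_def sum0)
  have d: "int (dim (sum_sets (Fc q \<inter> F p) (F (p + 1)))) =
      int (dim (F p \<inter> Fc q)) + int (dim (F (p + 1))) - int (dim (F (p + 1) \<inter> Fc q))" for q
  proof -
    have "Fc q \<inter> F p \<inter> F (p + 1) = F (p + 1) \<inter> Fc q" using F(2)[of p] by blast
    then show ?thesis
      using dim_sum_sets[OF fd fd subspace_inter[OF Fc(1) F(1)] F(1), of q p "p + 1"]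
      by (simp add: Int_commute)
  qed
  have "dim (sum_sets (Fc (q + 1) \<inter> F p) (F (p + 1))) \<le> dim (sum_sets (Fc q \<inter> F p) (F (p + 1)))"
    using Fc(2)[of q] by (intro dim_mono_fin_dim fd subspace_sum_sets subspace_inter F Fc sum_sets_mono) blast
  then show "int (hodge_t scl HQ F p q) = gr_dim2 filtrations 1 2 p q"
    using d[of q] d[of "q + 1"]
    by (simp add: hodge_t_def t subquotient_dim_def gr_dim2_def filtrations_simps)
  define n where "n = p + q"
  have Gr: "Gr_weight scl W n = (Wd (- n), Wd (- n + 1))"
    by (simp add: Gr_weight_def weight_dec_def)
  have WW: "Wd (- n + 1) \<subseteq> Wd (- n)"
    using T.Fs(2)[of "- n" "- n + 1" 0] by (simp add: filtrations_simps)
  \<comment> \<open>The dimension of an induced step is a difference of two intersections with W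
    plus a constant, which cancels between consecutive steps and leaves a mixed second
    difference.\<close>
  note P = pure_dims[OF fd Wd Wd WW F Fc(1) pure[of n, unfolded Gr] n_def[symmetric]]
    and dX = dim_induced_step[OF fd Wd Wd WW]
  have h: "hodge_h scl HQ W F p q = subquotient_dim scl (Gr Fc q (Gr F p (Wd (- n), Wd (- n + 1))))"
    by (simp add: hodge_h_def n_def[symmetric] Gr)
  show "int (hodge_h scl HQ W F p q) = gr_dim2 filtrations 1 0 p (- (p + q))"
    unfolding h P(1) dX[OF F(1)] n_def[symmetric] gr_dim2_def filtrations_simps by simp
  show "int (hodge_h scl HQ W F p q) = gr_dim2 filtrations 2 0 q (- (p + q))"
    unfolding h P dX[OF Fc(1)] n_def[symmetric] gr_dim2_def filtrations_simps by simp
qed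

text \<open>A Hodge number of bidegree (p, q) counts jumps -(p + q) of W paired with p for F, or
  with q for the conjugate. In the second power sum it receives (p + q)^2 from the square of W and
  -2 p (p + q) - 2 q (p + q) from the mixed terms, in total -(p + q)^2. The other terms give p^2 +
  q^2 + 2 p q times t.\<close>

lemma power_sums_hodge:
  assumes K: "0 \<le> K" and "trifiltered_space scl K UNIV filtrations"
  defines "h \<equiv> \<lambda>p q. int (hodge_h scl HQ W F p q)" and "t \<equiv> \<lambda>p q. int (hodge_t scl HQ F p q)"
  shows "power_sum1 K filtrations = 0"
    and "power_sum2 K filtrations = (\<Sum>p\<in>{-K..<K}. \<Sum>q\<in>{-K..<K}. (p + q)\<^sup>2 * (t p q - h p q))"
    and "h p q \<noteq> 0 \<or> t p q \<noteq> 0 \<Longrightarrow> p \<in> {-K..<K} \<and> q \<in> {-K..<K}"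
proof -
  interpret T: trifiltered_space scl K UNIV filtrations by fact
  define D where "D = gr_dim2 filtrations"
  define g where "g = gr_dim filtrations"
  let ?I = "{-K..<K}"
  note H = hodge_numbers[OF assms(2), folded D_def]
  have hF: "h p q = D 1 0 p (- (p + q))" and hFc: "h p q = D 2 0 q (- (p + q))" and t: "t p q = D 1 2 p q" for p q
    using H by (simp_all add: h_def t_def)
  have comm: "D i j p q = D j i q p" for i j p q unfolding D_def by (rule T.gr_dim2_commute)
  have out: "D i j p q = 0" if "i \<noteq> j" "p \<notin> ?I" for i j p q
    unfolding D_def using that by (rule T.gr_dim2_outside)
  have out': "D i j p q = 0" if "i \<noteq> j" "q \<notin> ?I" for i j p q
    using out[of j i q p] that comm by metis
  have marg: "(\<Sum>q\<in>?I. D i j p q) = g i p" for i j p unfolding D_def g_def by (rule T.sum_gr_dim2[OF K])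
  have n01: "(1::3) \<noteq> 0" "(2::3) \<noteq> 0" "(1::3) \<noteq> 2" by auto
  show "p \<in> {-K..<K} \<and> q \<in> {-K..<K}" if "h p q \<noteq> 0 \<or> t p q \<noteq> 0"
    using that hF[of p q] hFc[of p q] t[of p q] out[OF n01(1), of p] out[OF n01(2), of q]
      out[OF n01(3), of p] out'[OF n01(3), of q] by metis
  \<comment> \<open>The substitution a = -(p + q) moves the range of summation. Outside the moved
    range the terms vanish by the reading of h through the conjugate of F, outside
    \<open>{-K..<K}\<close> by the bound on W.\<close>
  have reindex: "(\<Sum>q\<in>?I. f q * h p q) = (\<Sum>a\<in>?I. f (- a - p) * D 1 0 p a)" for f p
  proof -
    let ?J = "(\<lambda>q. - (p + q)) ` ?I"
    have "(\<Sum>q\<in>?I. f q * h p q) = (\<Sum>a\<in>?J. f (- a - p) * D 1 0 p a)"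
      by (subst sum.reindex) (auto simp: inj_on_def hF)
    also have "\<dots> = (\<Sum>a\<in>?J \<union> ?I. f (- a - p) * D 1 0 p a)"
    proof (rule sum.mono_neutral_left)
      show "\<forall>a\<in>(?J \<union> ?I) - ?J. f (- a - p) * D 1 0 p a = 0"
      proof
        fix a assume a: "a \<in> (?J \<union> ?I) - ?J"
        then have "- a - p \<notin> ?I" by (auto simp: image_iff)
        then have "h p (- a - p) = 0" using hFc out[OF n01(2)] by simp
        then show "f (- a - p) * D 1 0 p a = 0" using hF[of p "- a - p"] by simp
      qed
    qed auto
    also have "\<dots> = (\<Sum>a\<in>?I. f (- a - p) * D 1 0 p a)"
      by (rule sum.mono_neutral_right) (use out'[OF n01(1)] in auto)
    finally show ?thesis .
  qed
  have reindex': "(\<Sum>p\<in>?I. f p * h p q) = (\<Sum>a\<in>?I. f (- a - q) * D 2 0 q a)" for f q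
  proof -
    let ?J = "(\<lambda>p. - (p + q)) ` ?I"
    have "(\<Sum>p\<in>?I. f p * h p q) = (\<Sum>a\<in>?J. f (- a - q) * D 2 0 q a)"
      by (subst sum.reindex) (auto simp: inj_on_def hFc)
    also have "\<dots> = (\<Sum>a\<in>?J \<union> ?I. f (- a - q) * D 2 0 q a)"
    proof (rule sum.mono_neutral_left)
      show "\<forall>a\<in>(?J \<union> ?I) - ?J. f (- a - q) * D 2 0 q a = 0"
      proof
        fix a assume a: "a \<in> (?J \<union> ?I) - ?J"
        then have "- a - q \<notin> ?I" using image_eqI[of a "\<lambda>p. - (p + q)" "- a - q" ?I] by auto
        then have "h (- a - q) q = 0" using hF out[OF n01(1)] by simp
        then show "f (- a - q) * D 2 0 q a = 0" using hFc[of "- a - q" q] by simp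
      qed
    qed auto
    also have "\<dots> = (\<Sum>a\<in>?I. f (- a - q) * D 2 0 q a)"
      by (rule sum.mono_neutral_right) (use out'[OF n01(2)] in auto)
    finally show ?thesis .
  qed
  \<comment> \<open>Weighted sums of Hodge numbers serve as common currency: \<open>S1\<close> and
    \<open>S2\<close> translate them into the pairs of W with F and with its conjugate.\<close>
  define S where "S \<phi> = (\<Sum>p\<in>?I. \<Sum>q\<in>?I. \<phi> p q * h p q)" for \<phi>
  have S1: "S \<phi> = (\<Sum>p\<in>?I. \<Sum>a\<in>?I. \<phi> p (- a - p) * D 1 0 p a)" for \<phi>
    unfolding S_def reindex ..
  have S2: "S \<phi> = (\<Sum>q\<in>?I. \<Sum>a\<in>?I. \<phi> (- a - q) q * D 2 0 q a)" for \<phi>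
    unfolding S_def by (subst sum.swap) (simp only: reindex')
  have S_add: "S (\<lambda>p q. \<phi> p q + \<psi> p q) = S \<phi> + S \<psi>" for \<phi> \<psi>
    by (simp add: S_def distrib_right sum.distrib)
  have sF: "(\<Sum>p\<in>?I. f p * g 1 p) = S (\<lambda>p q. f p)" for f
    unfolding S1 marg[symmetric, of 1 _ 0] by (simp add: sum_distrib_left)
  have sFc: "(\<Sum>q\<in>?I. f q * g 2 q) = S (\<lambda>p q. f q)" for f
    unfolding S2 marg[symmetric, of 2 _ 0] by (simp add: sum_distrib_left)
  have sW: "(\<Sum>a\<in>?I. f a * g 0 a) = S (\<lambda>p q. f (- (p + q)))" for f
  proof -
    have "(\<Sum>a\<in>?I. f a * g 0 a) = (\<Sum>a\<in>?I. \<Sum>p\<in>?I. f a * D 0 1 a p)"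
      unfolding marg[symmetric, of 0 _ 1] by (simp add: sum_distrib_left)
    also have "\<dots> = (\<Sum>p\<in>?I. \<Sum>a\<in>?I. f a * D 1 0 p a)"
      by (subst sum.swap) (simp add: comm[of 0 1])
    finally show ?thesis unfolding S1 by simp
  qed
  have U3: "UNIV = {0::3, 1, 2}" by (rule card_subset_eq[symmetric]) simp_all
  have U: "(\<Sum>i\<in>UNIV. f i) = f 0 + f 1 + f 2" for f :: "3 \<Rightarrow> int"
    unfolding U3 by (simp add: add_ac)
  have C: "- {0::3} = {1, 2}" "- {1::3} = {0, 2}" "- {2::3} = {0, 1}"
    unfolding Compl_eq_Diff_UNIV U3 by auto
  have "power_sum1 K filtrations = S (\<lambda>p q. - (p + q)) + S (\<lambda>p q. p) + S (\<lambda>p q. q)"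
    unfolding power_sum1_def g_def[symmetric] U sF sFc sW ..
  also have "\<dots> = S (\<lambda>p q. - (p + q) + p + q)" unfolding S_add ..
  finally show "power_sum1 K filtrations = 0" by (simp add: S_def)

  define X where "X i j = (\<Sum>p\<in>?I. \<Sum>q\<in>?I. p * q * D i j p q)" for i j
  have Xc: "X i j = X j i" for i j
    unfolding X_def by (subst sum.swap) (simp add: comm[of i j] mult.commute)
  have X10: "X 1 0 = S (\<lambda>p q. - p * (p + q))"
    unfolding S1 X_def by (intro sum.cong) (auto simp: algebra_simps)
  have X20: "X 2 0 = S (\<lambda>p q. - q * (p + q))"
    unfolding S2 X_def by (intro sum.cong) (auto simp: algebra_simps)
  \<comment> \<open>The graded dimensions of F are marginals of h as well as of t. Here t is chosen,
    so that together with the mixed term of F and its conjugate a complete square arises.\<close>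
  have g1: "(\<Sum>p\<in>?I. p\<^sup>2 * g 1 p) = (\<Sum>p\<in>?I. \<Sum>q\<in>?I. p\<^sup>2 * t p q)"
    unfolding marg[symmetric, of 1 _ 2] t by (simp add: sum_distrib_left)
  have g2: "(\<Sum>q\<in>?I. q\<^sup>2 * g 2 q) = (\<Sum>p\<in>?I. \<Sum>q\<in>?I. q\<^sup>2 * t p q)"
    unfolding marg[symmetric, of 2 _ 1] t
    by (simp add: sum_distrib_left comm[of 2 1]) (rule sum.swap)
  have "power_sum2 K filtrations = S (\<lambda>p q. (- (p + q))\<^sup>2) + (\<Sum>p\<in>?I. p\<^sup>2 * g 1 p) + (\<Sum>p\<in>?I. p\<^sup>2 * g 2 p)
      + 2 * (X 1 0 + X 2 0 + X 1 2)"
    unfolding power_sum2_def g_def[symmetric] D_def[symmetric] X_def[symmetric] U sW[of "\<lambda>a. a\<^sup>2"] C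
    using n01 Xc[of 0 1] Xc[of 0 2] Xc[of 2 1] by simp
  also have "\<dots> = (S (\<lambda>p q. (- (p + q))\<^sup>2) + S (\<lambda>p q. - p * (p + q)) + S (\<lambda>p q. - p * (p + q))
      + S (\<lambda>p q. - q * (p + q)) + S (\<lambda>p q. - q * (p + q))) + (\<Sum>p\<in>?I. \<Sum>q\<in>?I. (p + q)\<^sup>2 * t p q)"
  proof -
    have "(\<Sum>p\<in>?I. \<Sum>q\<in>?I. (p + q)\<^sup>2 * t p q) =
        (\<Sum>p\<in>?I. \<Sum>q\<in>?I. p\<^sup>2 * t p q + q\<^sup>2 * t p q + 2 * (p * q * t p q))"
      by (intro sum.cong refl) (simp add: power2_eq_square algebra_simps)
    also have "\<dots> = (\<Sum>p\<in>?I. p\<^sup>2 * g 1 p) + (\<Sum>p\<in>?I. p\<^sup>2 * g 2 p) + 2 * X 1 2"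
      unfolding g1 g2 X_def t by (simp add: sum.distrib sum_distrib_left)
    finally show ?thesis unfolding X10 X20 by simp
  qed
  also have "\<dots> = S (\<lambda>p q. - (p + q)\<^sup>2) + (\<Sum>p\<in>?I. \<Sum>q\<in>?I. (p + q)\<^sup>2 * t p q)"
    unfolding S_add[symmetric] by (simp add: power2_eq_square algebra_simps)
  also have "\<dots> = (\<Sum>p\<in>?I. \<Sum>q\<in>?I. (p + q)\<^sup>2 * (t p q - h p q))"
    unfolding S_def sum.distrib[symmetric] by (intro sum.cong refl) (simp add: right_diff_distrib)
  finally show "power_sum2 K filtrations = (\<Sum>p\<in>?I. \<Sum>q\<in>?I. (p + q)\<^sup>2 * (t p q - h p q))" .
qed

end

theorem proposition4:
  fixes scl :: "complex \<Rightarrow> 'v::ab_group_add \<Rightarrow> 'v"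
    and HQ :: "'v set"
    and W F :: "int \<Rightarrow> 'v set"
    and c :: "std chart_modules \<Rightarrow> int poly"
  assumes "mixed_hodge_structure scl HQ W F"
    and "total_chern_class c"
  shows "chern_character c scl (hodge_rees_bundle scl HQ W F) =
           of_nat (vector_space.dim scl (UNIV :: 'v set)) +
           smult (1/2 * Sum_any (\<lambda>(p, q). of_int ((p + q)\<^sup>2) *
             (of_nat (hodge_t scl HQ F p q) - of_nat (hodge_h scl HQ W F p q)))) w4 \<and>
         chern_class c scl 2 (hodge_rees_bundle scl HQ W F) =
           smult (1/2 * Sum_any (\<lambda>(p, q). of_int ((p + q)\<^sup>2) *
             (of_nat (hodge_h scl HQ W F p q) - of_nat (hodge_t scl HQ F p q)))) w4"
proof -
  interpret mixed_hodge_structure scl HQ W F by fact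
  interpret chern c by unfold_locales fact
  obtain K where K: "0 \<le> K" and T: "trifiltered_space scl K UNIV filtrations" using filt_exists .
  interpret T: trifiltered_space scl K UNIV filtrations by (rule T)
  let ?E = "hodge_rees_bundle scl HQ W F" and ?I = "{-K..<K}"
  let ?h = "\<lambda>p q. int (hodge_h scl HQ W F p q)" and ?t = "\<lambda>p q. int (hodge_t scl HQ F p q)"
  define S where "S = (\<Sum>p\<in>?I. \<Sum>q\<in>?I. (p + q)\<^sup>2 * (?t p q - ?h p q))"
  note ps = power_sums_hodge[OF K T]
  let ?M = "std_model scl ?E"
  \<comment> \<open>As the first power sum vanishes, the second one is -2 times the second Chern
    number.\<close>
  have c1: "coeff (c ?M) 1 = 0" and c2: "- 2 * coeff (c ?M) 2 = S"
    using power_sums_std_model[OF T] ps(1,2) unfolding hodge_rees_bundle p1_def p2_def S_def by simp_all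
  \<comment> \<open>\<open>Sum_any\<close> has its intended value only on finite support, which lies
    in the square of the range of jumps.\<close>
  have supp: "{pq. (case pq of (p, q) \<Rightarrow> of_int ((p + q)\<^sup>2) * (of_int (f p q) :: rat)) \<noteq> 0} \<subseteq> ?I \<times> ?I"
    if "\<And>p q. f p q \<noteq> 0 \<Longrightarrow> ?h p q \<noteq> 0 \<or> ?t p q \<noteq> 0" for f
    using ps(3) that by fastforce
  have sum: "Sum_any (\<lambda>(p, q). of_int ((p + q)\<^sup>2) * (of_int (f p q) :: rat)) =
      of_int (\<Sum>p\<in>?I. \<Sum>q\<in>?I. (p + q)\<^sup>2 * f p q)"
    if "\<And>p q. f p q \<noteq> 0 \<Longrightarrow> ?h p q \<noteq> 0 \<or> ?t p q \<noteq> 0" for f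
    by (subst Sum_any.expand_superset[OF _ supp[OF that]]) (simp_all add: sum.cartesian_product case_prod_unfold)
  have th: "Sum_any (\<lambda>(p, q). of_int ((p + q)\<^sup>2) *
      (of_nat (hodge_t scl HQ F p q) - of_nat (hodge_h scl HQ W F p q) :: rat)) = of_int S"
  proof -
    have "?h p q \<noteq> 0 \<or> ?t p q \<noteq> 0" if "?t p q - ?h p q \<noteq> 0" for p q using that by auto
    from sum[of "\<lambda>p q. ?t p q - ?h p q", OF this] show ?thesis unfolding S_def by simp
  qed
  have ht: "Sum_any (\<lambda>(p, q). of_int ((p + q)\<^sup>2) *
      (of_nat (hodge_h scl HQ W F p q) - of_nat (hodge_t scl HQ F p q) :: rat)) = of_int (- S)"
  proof -
    have "?h p q \<noteq> 0 \<or> ?t p q \<noteq> 0" if "?h p q - ?t p q \<noteq> 0" for p q using that by auto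
    from sum[of "\<lambda>p q. ?h p q - ?t p q", OF this] show ?thesis
      unfolding S_def by (simp add: sum_negf[symmetric] right_diff_distrib)
  qed
  have class1: "chern_class c scl 1 ?E = 0" unfolding chern_class_def c1 by simp
  have "of_int (coeff (c ?M) 2) = (1/2 * of_int (- S) :: rat)" unfolding c2[symmetric] by simp
  then have class2: "chern_class c scl 2 ?E = smult (1/2 * of_int (- S)) w4"
    unfolding chern_class_def w4_def smult_monom by simp
  have "2 * w4 = smult 2 w4" by (simp add: numeral_poly)
  then have "chern_character c scl ?E = of_nat (dim UNIV) + smult (1/2 * of_int S) w4"
    unfolding chern_character_def class1 class2
    by (simp add: hodge_rees_bundle T.bundle_rank_rees smult_diff_right)
  then show ?thesis unfolding th ht using class2 by blast
qed

end
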